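(* Let $S$ be a spacelike codimension-two embedded submanifold of a spacetime $(M,g)$ of dimension $n+2\ge4$ with a lightlike normal vector field $\xi$, let $\Sigma=\Phi(\mathscr O)$ be the lightlike hypersurface emanating from $S$ by the normal exponential construction along $\xi$ (see context), with geodesic extension $U$ of $\xi$, screen distribution $\mathcal S$ and projection $F\colon\Sigma\to S$. Assume that $\Sigma$ is totally umbilical, with $B_U=\mu g$. Let $L$ and $\overline L$ be two leaves of $\mathcal S$ such that $F|_L\colon L\to S$ and $F|_{\overline L}\colon\overline L\to S$ are diffeomorphisms. For $p\in S$ let $t_p$ (respectively $\overline t_p$) be the unique parameter with $\Phi(p,t_p)\in L$ (respectively $\Phi(p,\overline t_p)\in\overline L$). Then the canonical conformal diffeomorphism $G=(F|_{\overline L})^{-1}\circ F|_L\colon L\to\overline L$ is an isometry (for the induced Riemannian metrics) if and only if $$\int_{\overline t_p}^{t_p}\mu\bigl(\Phi(p,r)\bigr)\,dr=0\qquad\text{for every }p\in S.$$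
   Context: A spacetime is a connected time-oriented Lorentzian manifold of signature $(-,+,\dots,+)$, with Levi-Civita connection $\widetilde\nabla$; lightlike vectors are nonzero null vectors; $S$ is connected of dimension $n$ with induced Riemannian metric. Normal exponential construction: choose an open neighborhood $\mathscr V$ of the zero section of the normal bundle $T^\perp S$, fiberwise star-shaped about $0$, such that the normal exponential map $\exp^\perp$ restricts to a diffeomorphism from $\mathscr V$ onto an open neighborhood of $S$ in $M$. Put $\mathscr O=\{(p,t)\in S\times\mathbb R: t\xi_p\in\mathscr V\}$, $\Phi\colon\mathscr O\to M$, $\Phi(p,t)=\exp^\perp_p(t\xi_p)$, and $\Sigma=\Phi(\mathscr O)$. Then $\Phi$ is an embedding, $\Sigma$ is a lightlike hypersurface (the induced metric is everywhere degenerate) containing $S=\Phi(S\times\{0\})$; $U=\Phi_*(\partial_t)$ is a lightlike vector field on $\Sigma$ with $\widetilde\nabla_UU=0$, $U|_S=\xi$; $\mathcal S$ is the integrable screen distribution given by the images under $\Phi_*$ of the tangent spaces to the slices $\{t=\text{const}\}$ of $\mathscr O$; $F=\pi\circ\Phi^{-1}$ with $\pi\colon\mathscr O\to S$ the projection. $B_U(X,Y)=-g(\widetilde\nabla_XU,Y)$ on $\Sigma$; $\Sigma$ is totally umbilical if $B_U=\mu g$ for a smooth function $\mu$ on $\Sigma$. *)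

theory Defs
  imports "HOL-Analysis.Analysis"
begin

section \<open>Smooth maps between Euclidean spaces\<close>

text \<open>\<open>C_on k D f\<close> and \<open>smooth_on D f\<close> are meant for open \<open>D\<close>.\<close>

primrec C_on :: "nat \<Rightarrow> 'a::euclidean_space set \<Rightarrow> ('a \<Rightarrow> 'b::euclidean_space) \<Rightarrow> bool" where
  "C_on 0 D f \<longleftrightarrow> continuous_on D f"
| "C_on (Suc k) D f \<longleftrightarrow> (\<forall>x\<in>D. f differentiable (at x)) \<and>
     (\<forall>v. C_on k D (\<lambda>x. frechet_derivative f (at x) v))"

definition smooth_on :: "'a::euclidean_space set \<Rightarrow> ('a \<Rightarrow> 'b::euclidean_space) \<Rightarrow> bool" where
  "smooth_on D f \<longleftrightarrow> (\<forall>k. C_on k D f)"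


section \<open>Smooth manifolds\<close>

text \<open>A manifold is given by a (not necessarily maximal) atlas; points have an arbitrary type, the
  model space is the Euclidean space \<open>'e\<close>, so the dimension is \<open>DIM('e)\<close>.\<close>

type_synonym ('a, 'e) chart = "'a set \<times> ('a \<Rightarrow> 'e)"

abbreviation cinv :: "('a, 'e) chart \<Rightarrow> 'e \<Rightarrow> 'a" where
  "cinv c \<equiv> inv_into (fst c) (snd c)"

definition is_chart :: "('a, 'e::euclidean_space) chart \<Rightarrow> bool" where
  "is_chart c \<longleftrightarrow> inj_on (snd c) (fst c) \<and> open (snd c ` fst c)"

definition compatible :: "('a, 'e::euclidean_space) chart \<Rightarrow> ('a, 'e) chart \<Rightarrow> bool" where
  "compatible c c' \<longleftrightarrow> open (snd c ` (fst c \<inter> fst c')) \<and>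
     smooth_on (snd c ` (fst c \<inter> fst c')) (snd c' \<circ> cinv c)"

definition is_atlas :: "('a, 'e::euclidean_space) chart set \<Rightarrow> bool" where
  "is_atlas A \<longleftrightarrow> (\<forall>c\<in>A. is_chart c) \<and> (\<forall>c\<in>A. \<forall>c'\<in>A. compatible c c')"

definition pts :: "('a, 'e) chart set \<Rightarrow> 'a set" where
  "pts A = (\<Union>c\<in>A. fst c)"

definition mtop :: "('a, 'e::euclidean_space) chart set \<Rightarrow> 'a topology" where
  "mtop A = topology (\<lambda>W. W \<subseteq> pts A \<and> (\<forall>c\<in>A. open (snd c ` (W \<inter> fst c))))"

definition manifold :: "('a, 'e::euclidean_space) chart set \<Rightarrow> bool" where
  "manifold A \<longleftrightarrow> is_atlas A \<and> Hausdorff_space (mtop A) \<and> second_countable (mtop A)"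

lemma istopology_mtop:
  assumes "is_atlas A"
  shows "istopology (\<lambda>W. W \<subseteq> pts A \<and> (\<forall>c\<in>A. open (snd c ` (W \<inter> fst c))))"
  unfolding istopology_def
proof (intro conjI allI impI ballI)
  fix V W c
  assume V: "V \<subseteq> pts A \<and> (\<forall>c\<in>A. open (snd c ` (V \<inter> fst c)))"
    and W: "W \<subseteq> pts A \<and> (\<forall>c\<in>A. open (snd c ` (W \<inter> fst c)))" and c: "c \<in> A"
  have inj: "inj_on (snd c) (fst c)"
    using assms c by (auto simp: is_atlas_def is_chart_def)
  have "snd c ` (V \<inter> W \<inter> fst c) = snd c ` ((V \<inter> fst c) \<inter> (W \<inter> fst c))"
    by (rule arg_cong[where f="image (snd c)"]) auto
  also have "\<dots> = snd c ` (V \<inter> fst c) \<inter> snd c ` (W \<inter> fst c)"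
    by (rule inj_on_image_Int[OF inj]) auto
  finally show "open (snd c ` (V \<inter> W \<inter> fst c))"
    using V W c by auto
next
  fix K c
  assume K: "\<forall>W\<in>K. W \<subseteq> pts A \<and> (\<forall>c\<in>A. open (snd c ` (W \<inter> fst c)))" and c: "c \<in> A"
  have "snd c ` (\<Union>K \<inter> fst c) = (\<Union>W\<in>K. snd c ` (W \<inter> fst c))"
    by blast
  then show "open (snd c ` (\<Union>K \<inter> fst c))"
    using K c by (auto intro!: open_UN)
qed auto

lemma openin_mtop:
  assumes "is_atlas A"
  shows "openin (mtop A) W \<longleftrightarrow> W \<subseteq> pts A \<and> (\<forall>c\<in>A. open (snd c ` (W \<inter> fst c)))"
  unfolding mtop_def using topology_inverse'[OF istopology_mtop[OF assms]] by simp

definition euclid :: "('e, 'e::euclidean_space) chart set" where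
  "euclid = {(UNIV, id)}"

definition smooth_on_open ::
  "('a, 'e::euclidean_space) chart set \<Rightarrow> 'a set \<Rightarrow> ('b, 'f::euclidean_space) chart set
     \<Rightarrow> ('a \<Rightarrow> 'b) \<Rightarrow> bool" where
  "smooth_on_open A W B h \<longleftrightarrow> openin (mtop A) W \<and> h ` W \<subseteq> pts B \<and>
     (\<forall>c\<in>A. \<forall>d\<in>B. let D = snd c ` {x \<in> W \<inter> fst c. h x \<in> fst d}
        in open D \<and> smooth_on D (snd d \<circ> h \<circ> cinv c))"

text \<open>Smoothness on an arbitrary subset \<open>X\<close> of a manifold: locally, the map is the restriction of a
  smooth map on an open set. For open \<open>X\<close> this is ordinary smoothness, and for an embedded
  submanifold \<open>X\<close> it is smoothness for the induced smooth structure. A map into an embedded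
  submanifold is smooth iff it is smooth as a map into the ambient manifold, so that \<open>diffeo\<close>
  below is the usual notion for open subsets and embedded submanifolds.\<close>

definition smooth_map ::
  "('a, 'e::euclidean_space) chart set \<Rightarrow> 'a set \<Rightarrow> ('b, 'f::euclidean_space) chart set
     \<Rightarrow> ('a \<Rightarrow> 'b) \<Rightarrow> bool" where
  "smooth_map A X B f \<longleftrightarrow>
     (\<forall>p\<in>X. \<exists>W h. p \<in> W \<and> smooth_on_open A W B h \<and> (\<forall>x\<in>X \<inter> W. h x = f x))"

definition diffeo ::
  "('a, 'e::euclidean_space) chart set \<Rightarrow> 'a set \<Rightarrow> ('b, 'f::euclidean_space) chart set
     \<Rightarrow> 'b set \<Rightarrow> ('a \<Rightarrow> 'b) \<Rightarrow> bool" where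
  "diffeo A X B Y f \<longleftrightarrow> bij_betw f X Y \<and> smooth_map A X B f \<and> smooth_map B Y A (inv_into X f)"

definition embedded_submanifold ::
  "('a, 'e::euclidean_space) chart set \<Rightarrow> nat \<Rightarrow> 'a set \<Rightarrow> bool" where
  "embedded_submanifold A k S \<longleftrightarrow> S \<subseteq> pts A \<and>
     (\<forall>p\<in>S. \<exists>c E. fst c \<subseteq> pts A \<and> is_atlas (insert c A) \<and> p \<in> fst c \<and>
        subspace E \<and> dim E = k \<and> snd c ` (fst c \<inter> S) = snd c ` fst c \<inter> E)"


section \<open>Tangent vectors\<close>

text \<open>At each point \<open>p\<close> one chart \<open>pref A p\<close> is chosen once and for all, and a tangent vector
  at \<open>p\<close> is represented by its components in that chart. Thus every tangent space is the type \<open>'e\<close>.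
  \<open>comps A c p v\<close> are the components of \<open>v\<close> in another chart \<open>c\<close> around \<open>p\<close>, and \<open>of_comps A c p u\<close>
  is the tangent vector at \<open>p\<close> whose components in \<open>c\<close> are \<open>u\<close>.\<close>

definition pref :: "('a, 'e) chart set \<Rightarrow> 'a \<Rightarrow> ('a, 'e) chart" where
  "pref A p = (SOME c. c \<in> A \<and> p \<in> fst c)"

definition comps ::
  "('a, 'e::euclidean_space) chart set \<Rightarrow> ('a, 'e) chart \<Rightarrow> 'a \<Rightarrow> 'e \<Rightarrow> 'e" where
  "comps A c p = frechet_derivative (snd c \<circ> cinv (pref A p)) (at (snd (pref A p) p))"

definition of_comps ::
  "('a, 'e::euclidean_space) chart set \<Rightarrow> ('a, 'e) chart \<Rightarrow> 'a \<Rightarrow> 'e \<Rightarrow> 'e" where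
  "of_comps A c p = frechet_derivative (snd (pref A p) \<circ> cinv c) (at (snd c p))"

definition tangent_bundle ::
  "('a, 'e::euclidean_space) chart set \<Rightarrow> ('a \<times> 'e, 'e \<times> 'e) chart set" where
  "tangent_bundle A = (\<lambda>c. (fst c \<times> UNIV, \<lambda>(p, v). (snd c p, comps A c p v))) ` A"

definition smooth_field ::
  "('a, 'e::euclidean_space) chart set \<Rightarrow> 'a set \<Rightarrow> ('a \<Rightarrow> 'e) \<Rightarrow> bool" where
  "smooth_field A X V \<longleftrightarrow> smooth_map A X (tangent_bundle A) (\<lambda>p. (p, V p))"

definition velocity ::
  "('a, 'e::euclidean_space) chart set \<Rightarrow> (real \<Rightarrow> 'a) \<Rightarrow> real \<Rightarrow> 'e" where
  "velocity A \<gamma> t = vector_derivative (\<lambda>s. snd (pref A (\<gamma> t)) (\<gamma> s)) (at t)"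

text \<open>Differentials are taken along curves: \<open>df(\<gamma>'(0)) = (f \<circ> \<gamma>)'(0)\<close>.\<close>

definition curve_through ::
  "('a, 'e::euclidean_space) chart set \<Rightarrow> 'a set \<Rightarrow> 'a \<Rightarrow> (real \<Rightarrow> 'a) \<Rightarrow> bool" where
  "curve_through A X p \<gamma> \<longleftrightarrow> (\<exists>\<epsilon>>0. smooth_map euclid {-\<epsilon><..<\<epsilon>} A \<gamma> \<and> \<gamma> ` {-\<epsilon><..<\<epsilon>} \<subseteq> X) \<and> \<gamma> 0 = p"

definition tangent_space ::
  "('a, 'e::euclidean_space) chart set \<Rightarrow> 'a set \<Rightarrow> 'a \<Rightarrow> 'e set" where
  "tangent_space A X p = {velocity A \<gamma> 0 | \<gamma>. curve_through A X p \<gamma>}"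


section \<open>Lorentzian metrics, the Levi-Civita connection, geodesics\<close>

type_synonym ('a, 'e) metric = "'a \<Rightarrow> 'e \<Rightarrow> 'e \<Rightarrow> real"

definition lorentz_product :: "('e::euclidean_space \<Rightarrow> 'e \<Rightarrow> real) \<Rightarrow> bool" where
  "lorentz_product b \<longleftrightarrow> bilinear b \<and> (\<forall>u v. b u v = b v u) \<and>
     (\<exists>E e0. independent E \<and> span E = UNIV \<and> e0 \<in> E \<and> b e0 e0 = -1 \<and>
        (\<forall>e\<in>E - {e0}. b e e = 1) \<and> (\<forall>e\<in>E. \<forall>f\<in>E. e \<noteq> f \<longrightarrow> b e f = 0))"

definition metric_in ::
  "('a, 'e::euclidean_space) chart set \<Rightarrow> ('a, 'e) metric \<Rightarrow> ('a, 'e) chart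
     \<Rightarrow> 'e \<Rightarrow> 'e \<Rightarrow> 'e \<Rightarrow> real" where
  "metric_in A g c x u v =
     (let p = cinv c x in g p (of_comps A c p u) (of_comps A c p v))"

definition lorentz_metric ::
  "('a, 'e::euclidean_space) chart set \<Rightarrow> ('a, 'e) metric \<Rightarrow> bool" where
  "lorentz_metric A g \<longleftrightarrow> (\<forall>p\<in>pts A. lorentz_product (g p)) \<and>
     (\<forall>c\<in>A. \<forall>u v. smooth_on (snd c ` fst c) (\<lambda>x. metric_in A g c x u v))"

text \<open>\<open>T\<close> is a timelike vector field fixing the time orientation.\<close>

definition spacetime ::
  "('a, 'e::euclidean_space) chart set \<Rightarrow> ('a, 'e) metric \<Rightarrow> ('a \<Rightarrow> 'e) \<Rightarrow> bool" where
  "spacetime A g T \<longleftrightarrow> manifold A \<and> connected_space (mtop A) \<and> lorentz_metric A g \<and>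
     smooth_field A (pts A) T \<and> (\<forall>p\<in>pts A. g p (T p) (T p) < 0)"

text \<open>In a chart, a connection is \<open>\<nabla>\<^sub>u V = DV(u) + \<Gamma>(u, V)\<close> with \<open>\<Gamma>\<close> bilinear at every point. It is
  torsion-free iff \<open>\<Gamma>\<close> is symmetric, and metric iff the third condition below holds.\<close>

definition is_levi_civita ::
  "('e::euclidean_space \<Rightarrow> 'e \<Rightarrow> 'e \<Rightarrow> real) \<Rightarrow> 'e \<Rightarrow> ('e \<Rightarrow> 'e \<Rightarrow> 'e) \<Rightarrow> bool" where
  "is_levi_civita G x \<Gamma> \<longleftrightarrow> bilinear \<Gamma> \<and> (\<forall>u v. \<Gamma> u v = \<Gamma> v u) \<and>
     (\<forall>w u v. frechet_derivative (\<lambda>y. G y u v) (at x) w = G x (\<Gamma> w u) v + G x u (\<Gamma> w v))"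

text \<open>Existence and uniqueness of the connection coefficients (the Koszul formula); the hypotheses hold
  for the components of a smooth nondegenerate metric.\<close>

lemma ex1_levi_civita:
  fixes G :: "'e::euclidean_space \<Rightarrow> 'e \<Rightarrow> 'e \<Rightarrow> real" and x :: 'e
  defines "D \<equiv> \<lambda>w u v. frechet_derivative (\<lambda>y. G y u v) (at x) w"
  assumes bil: "bilinear (G x)" and sym: "\<And>u v. G x u v = G x v u"
    and nondeg: "\<And>u. (\<And>v. G x u v = 0) \<Longrightarrow> u = 0"
    and D1: "\<And>u v. linear (\<lambda>w. D w u v)" and D2: "\<And>w. bilinear (D w)"
    and Dsym: "\<And>w u v. D w u v = D w v u"
  shows "\<exists>!\<Gamma>. is_levi_civita G x \<Gamma>"
proof -
  have lc: "is_levi_civita G x \<Gamma> \<longleftrightarrow> bilinear \<Gamma> \<and> (\<forall>u v. \<Gamma> u v = \<Gamma> v u) \<and>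
     (\<forall>w u v. D w u v = G x (\<Gamma> w u) v + G x u (\<Gamma> w v))" for \<Gamma>
    by (simp add: is_levi_civita_def D_def)
  define K where "K u v w = (D u v w + D v u w - D w u v) / 2" for u v w
  have b1: "linear (\<lambda>u. G x u v)" and b2: "linear (\<lambda>v. G x u v)" for u v
    using bil by (auto simp: bilinear_def)
  have d2: "linear (\<lambda>u. D w u v)" and d3: "linear (\<lambda>v. D w u v)" for w u v
    using D2 by (auto simp: bilinear_def)
  note lins = linear_add[OF D1] linear_add[OF d2] linear_add[OF d3]
    linear_cmul[OF D1] linear_cmul[OF d2] linear_cmul[OF d3]
  have K1: "linear (\<lambda>u. K u v w)" for v w
    by (rule linearI) (simp_all add: K_def lins field_simps)
  have K2: "linear (\<lambda>v. K u v w)" for u w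
    by (rule linearI) (simp_all add: K_def lins field_simps)
  have K3: "linear (\<lambda>w. K u v w)" for u v
    by (rule linearI) (simp_all add: K_def lins field_simps)
  have Ksym: "K u v w = K v u w" for u v w
    by (simp add: K_def Dsym[of w u v])
  have eqI: "u = u'" if "\<And>w. G x u w = G x u' w" for u u'
  proof -
    have "u - u' = 0"
      by (rule nondeg) (use that in \<open>simp add: linear_diff[OF b1]\<close>)
    then show ?thesis by simp
  qed
  define R where "R u = (\<Sum>i\<in>Basis. G x u i *\<^sub>R i)" for u
  have Rin: "R u \<bullet> i = G x u i" if "i \<in> Basis" for u i
    using that by (simp add: R_def)
  have Rlin: "linear R"
    by (rule linearI) (auto intro!: euclidean_eqI[where 'a='e]
        simp: Rin inner_add_left linear_add[OF b1] linear_cmul[OF b1])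
  have ext: "f = h" if "linear f" "linear h" "\<And>i. i \<in> Basis \<Longrightarrow> f i = h i"
    for f h :: "'e \<Rightarrow> real"
    using that by (intro linear_eq_stdbasis) auto
  have "inj R"
  proof (rule injI)
    fix u u' assume "R u = R u'"
    then have "(\<lambda>w. G x u w) = (\<lambda>w. G x u' w)"
      by (intro ext b2) (metis Rin)
    then show "u = u'" by (intro eqI) (simp add: fun_eq_iff)
  qed
  then have "surj R"
    using Rlin linear_injective_imp_surjective by blast
  have riesz: "\<exists>u. \<forall>w. G x u w = f w" if f: "linear f" for f
  proof -
    obtain u where "R u = (\<Sum>i\<in>Basis. f i *\<^sub>R i)"
      using \<open>surj R\<close> by (metis surjD)
    then have "G x u i = f i" if "i \<in> Basis" for i
      using Rin[OF that, of u] that by simp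
    then have "(\<lambda>w. G x u w) = f"
      by (intro ext b2 f)
    then show ?thesis by (auto simp: fun_eq_iff)
  qed
  have "\<forall>u v. \<exists>z. \<forall>w. G x z w = K u v w"
    using riesz K3 by blast
  then obtain \<Gamma> where \<Gamma>: "\<And>u v w. G x (\<Gamma> u v) w = K u v w"
    by metis
  have "is_levi_civita G x \<Gamma>"
    unfolding lc bilinear_def
  proof (intro conjI allI)
    show "linear (\<lambda>v. \<Gamma> u v)" for u
      by (rule linearI; rule eqI)
        (simp_all add: \<Gamma> linear_add[OF b1] linear_cmul[OF b1] linear_add[OF K2] linear_cmul[OF K2])
    show "linear (\<lambda>u. \<Gamma> u v)" for v
      by (rule linearI; rule eqI)
        (simp_all add: \<Gamma> linear_add[OF b1] linear_cmul[OF b1] linear_add[OF K1] linear_cmul[OF K1])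
    show "\<Gamma> u v = \<Gamma> v u" for u v
      by (rule eqI) (simp add: \<Gamma> Ksym[of u v])
    show "D w u v = G x (\<Gamma> w u) v + G x u (\<Gamma> w v)" for w u v
      using Dsym[of w u v] Dsym[of u w v] Dsym[of v w u]
      by (simp add: \<Gamma> sym[of u] K_def field_simps)
  qed
  moreover have "\<Gamma>' = \<Gamma>" if "is_levi_civita G x \<Gamma>'" for \<Gamma>'
  proof (intro HOL.ext)
    fix u v
    have s: "\<Gamma>' a b = \<Gamma>' b a" and m: "D w a b = G x (\<Gamma>' w a) b + G x a (\<Gamma>' w b)" for w a b
      using that unfolding lc by blast+
    show "\<Gamma>' u v = \<Gamma> u v"
    proof (rule eqI)
      fix w
      show "G x (\<Gamma>' u v) w = G x (\<Gamma> u v) w"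
        unfolding \<Gamma> K_def
        using m[of u v w] m[of v u w] m[of w u v] s[of u v] s[of u w] s[of v w]
          sym[of v "\<Gamma>' u w"] sym[of u "\<Gamma>' v w"] sym[of "\<Gamma>' w u" v]
        by simp
    qed
  qed
  ultimately show ?thesis by blast
qed

definition levi_civita ::
  "('a, 'e::euclidean_space) chart set \<Rightarrow> ('a, 'e) metric \<Rightarrow> ('a, 'e) chart
     \<Rightarrow> 'e \<Rightarrow> 'e \<Rightarrow> 'e \<Rightarrow> 'e" where
  "levi_civita A g c x = (THE \<Gamma>. is_levi_civita (metric_in A g c) x \<Gamma>)"

text \<open>The covariant derivative along the curve \<open>\<gamma>\<close> of a vector field \<open>V\<close> along \<open>\<gamma>\<close>, first by
  its components in an arbitrary chart \<open>c\<close> around \<open>\<gamma> t\<close>, then as a tangent vector at \<open>\<gamma> t\<close>.\<close>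

definition cov_deriv_in ::
  "('a, 'e::euclidean_space) chart set \<Rightarrow> ('a, 'e) metric \<Rightarrow> ('a, 'e) chart
     \<Rightarrow> (real \<Rightarrow> 'a) \<Rightarrow> (real \<Rightarrow> 'e) \<Rightarrow> real \<Rightarrow> 'e" where
  "cov_deriv_in A g c \<gamma> V t =
     vector_derivative (\<lambda>s. comps A c (\<gamma> s) (V s)) (at t) +
     levi_civita A g c (snd c (\<gamma> t)) (comps A c (\<gamma> t) (velocity A \<gamma> t)) (comps A c (\<gamma> t) (V t))"

definition cov_deriv ::
  "('a, 'e::euclidean_space) chart set \<Rightarrow> ('a, 'e) metric
     \<Rightarrow> (real \<Rightarrow> 'a) \<Rightarrow> (real \<Rightarrow> 'e) \<Rightarrow> real \<Rightarrow> 'e" where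
  "cov_deriv A g \<gamma> V t = cov_deriv_in A g (pref A (\<gamma> t)) \<gamma> V t"

definition geodesic ::
  "('a, 'e::euclidean_space) chart set \<Rightarrow> ('a, 'e) metric \<Rightarrow> real set \<Rightarrow> (real \<Rightarrow> 'a) \<Rightarrow> bool" where
  "geodesic A g J \<gamma> \<longleftrightarrow> open J \<and> is_interval J \<and> smooth_map euclid J A \<gamma> \<and>
     (\<forall>t\<in>J. \<forall>c\<in>A. \<gamma> t \<in> fst c \<longrightarrow> cov_deriv_in A g c \<gamma> (velocity A \<gamma>) t = 0)"

definition exp_rel ::
  "('a, 'e::euclidean_space) chart set \<Rightarrow> ('a, 'e) metric \<Rightarrow> 'a \<times> 'e \<Rightarrow> 'a \<Rightarrow> bool" where
  "exp_rel A g = (\<lambda>(p, v) q. \<exists>J \<gamma>. geodesic A g J \<gamma> \<and> {0..1} \<subseteq> J \<and>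
     \<gamma> 0 = p \<and> velocity A \<gamma> 0 = v \<and> \<gamma> 1 = q)"

definition exp_dom ::
  "('a, 'e::euclidean_space) chart set \<Rightarrow> ('a, 'e) metric \<Rightarrow> ('a \<times> 'e) set" where
  "exp_dom A g = {pv. \<exists>q. exp_rel A g pv q}"

definition exp_map ::
  "('a, 'e::euclidean_space) chart set \<Rightarrow> ('a, 'e) metric \<Rightarrow> 'a \<times> 'e \<Rightarrow> 'a" where
  "exp_map A g pv = (THE q. exp_rel A g pv q)"

text \<open>\<open>\<nabla>\<^sub>X V\<close> at \<open>q\<close> for a vector field \<open>V\<close> given only along \<open>N\<close> and \<open>X\<close> tangent to \<open>N\<close>: the covariant
  derivative of \<open>V\<close> along any curve in \<open>N\<close> with velocity \<open>X\<close>.\<close>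

definition nabla_on ::
  "('a, 'e::euclidean_space) chart set \<Rightarrow> ('a, 'e) metric \<Rightarrow> 'a set \<Rightarrow> ('a \<Rightarrow> 'e)
     \<Rightarrow> 'a \<Rightarrow> 'e \<Rightarrow> 'e" where
  "nabla_on A g N V q X = (THE Z. \<exists>\<gamma>. curve_through A N q \<gamma> \<and> velocity A \<gamma> 0 = X \<and>
     Z = cov_deriv A g \<gamma> (V \<circ> \<gamma>) 0)"


section \<open>Spacelike submanifolds and the normal exponential construction\<close>

definition spacelike ::
  "('a, 'e::euclidean_space) chart set \<Rightarrow> ('a, 'e) metric \<Rightarrow> 'a set \<Rightarrow> bool" where
  "spacelike A g S \<longleftrightarrow> (\<forall>p\<in>S. \<forall>v\<in>tangent_space A S p. v \<noteq> 0 \<longrightarrow> g p v v > 0)"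

definition normal_bundle ::
  "('a, 'e::euclidean_space) chart set \<Rightarrow> ('a, 'e) metric \<Rightarrow> 'a set \<Rightarrow> ('a \<times> 'e) set" where
  "normal_bundle A g S = {(p, v). p \<in> S \<and> (\<forall>u\<in>tangent_space A S p. g p u v = 0)}"

definition lightlike_normal_field ::
  "('a, 'e::euclidean_space) chart set \<Rightarrow> ('a, 'e) metric \<Rightarrow> 'a set \<Rightarrow> ('a \<Rightarrow> 'e) \<Rightarrow> bool" where
  "lightlike_normal_field A g S \<xi> \<longleftrightarrow> smooth_field A S \<xi> \<and>
     (\<forall>p\<in>S. (p, \<xi> p) \<in> normal_bundle A g S \<and> \<xi> p \<noteq> 0 \<and> g p (\<xi> p) (\<xi> p) = 0)"

definition normal_exp_nbhd ::
  "('a, 'e::euclidean_space) chart set \<Rightarrow> ('a, 'e) metric \<Rightarrow> 'a set \<Rightarrow> ('a \<times> 'e) set \<Rightarrow> bool" where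
  "normal_exp_nbhd A g S \<V> \<longleftrightarrow>
     openin (subtopology (mtop (tangent_bundle A)) (normal_bundle A g S)) \<V> \<and>
     (\<forall>p\<in>S. (p, 0) \<in> \<V>) \<and>
     (\<forall>p v s. (p, v) \<in> \<V> \<and> 0 \<le> s \<and> s \<le> 1 \<longrightarrow> (p, s *\<^sub>R v) \<in> \<V>) \<and>
     \<V> \<subseteq> exp_dom A g \<and>
     (\<exists>W. openin (mtop A) W \<and> S \<subseteq> W \<and> diffeo (tangent_bundle A) \<V> A W (exp_map A g))"

definition dom_Phi :: "'a set \<Rightarrow> ('a \<Rightarrow> 'e::euclidean_space) \<Rightarrow> ('a \<times> 'e) set \<Rightarrow> ('a \<times> real) set" where
  "dom_Phi S \<xi> \<V> = {(p, t). p \<in> S \<and> (p, t *\<^sub>R \<xi> p) \<in> \<V>}"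

definition Phi ::
  "('a, 'e::euclidean_space) chart set \<Rightarrow> ('a, 'e) metric \<Rightarrow> ('a \<Rightarrow> 'e) \<Rightarrow> 'a \<times> real \<Rightarrow> 'a" where
  "Phi A g \<xi> = (\<lambda>(p, t). exp_map A g (p, t *\<^sub>R \<xi> p))"

definition hypersurf ::
  "('a, 'e::euclidean_space) chart set \<Rightarrow> ('a, 'e) metric \<Rightarrow> 'a set \<Rightarrow> ('a \<Rightarrow> 'e)
     \<Rightarrow> ('a \<times> 'e) set \<Rightarrow> 'a set" where
  "hypersurf A g S \<xi> \<V> = Phi A g \<xi> ` dom_Phi S \<xi> \<V>"

definition Phi_inv ::
  "('a, 'e::euclidean_space) chart set \<Rightarrow> ('a, 'e) metric \<Rightarrow> 'a set \<Rightarrow> ('a \<Rightarrow> 'e)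
     \<Rightarrow> ('a \<times> 'e) set \<Rightarrow> 'a \<Rightarrow> 'a \<times> real" where
  "Phi_inv A g S \<xi> \<V> = inv_into (dom_Phi S \<xi> \<V>) (Phi A g \<xi>)"

definition proj ::
  "('a, 'e::euclidean_space) chart set \<Rightarrow> ('a, 'e) metric \<Rightarrow> 'a set \<Rightarrow> ('a \<Rightarrow> 'e)
     \<Rightarrow> ('a \<times> 'e) set \<Rightarrow> 'a \<Rightarrow> 'a" where
  "proj A g S \<xi> \<V> = fst \<circ> Phi_inv A g S \<xi> \<V>"

text \<open>\<open>\<Phi>\<^sub>*(\<partial>\<^sub>t)\<close>\<close>

definition geo_ext ::
  "('a, 'e::euclidean_space) chart set \<Rightarrow> ('a, 'e) metric \<Rightarrow> 'a set \<Rightarrow> ('a \<Rightarrow> 'e)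
     \<Rightarrow> ('a \<times> 'e) set \<Rightarrow> 'a \<Rightarrow> 'e" where
  "geo_ext A g S \<xi> \<V> q =
     (case Phi_inv A g S \<xi> \<V> q of (p, t) \<Rightarrow> velocity A (\<lambda>s. Phi A g \<xi> (p, s)) t)"

text \<open>The image under \<open>\<Phi>\<^sub>*\<close> of the tangent space of the slice of constant \<open>t\<close>.\<close>

definition screen ::
  "('a, 'e::euclidean_space) chart set \<Rightarrow> ('a, 'e) metric \<Rightarrow> 'a set \<Rightarrow> ('a \<Rightarrow> 'e)
     \<Rightarrow> ('a \<times> 'e) set \<Rightarrow> 'a \<Rightarrow> 'e set" where
  "screen A g S \<xi> \<V> q = (case Phi_inv A g S \<xi> \<V> q of (p, t) \<Rightarrow>
     {velocity A (\<lambda>s. Phi A g \<xi> (\<gamma> s, t)) 0 | \<gamma>.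
        curve_through A {x. (x, t) \<in> dom_Phi S \<xi> \<V>} p \<gamma>})"

definition null_second_form ::
  "('a, 'e::euclidean_space) chart set \<Rightarrow> ('a, 'e) metric \<Rightarrow> 'a set \<Rightarrow> ('a \<Rightarrow> 'e)
     \<Rightarrow> 'a \<Rightarrow> 'e \<Rightarrow> 'e \<Rightarrow> real" where
  "null_second_form A g N U q X Y = - g q (nabla_on A g N U q X) Y"

definition totally_umbilical ::
  "('a, 'e::euclidean_space) chart set \<Rightarrow> ('a, 'e) metric \<Rightarrow> 'a set \<Rightarrow> ('a \<Rightarrow> 'e)
     \<Rightarrow> ('a \<Rightarrow> real) \<Rightarrow> bool" where
  "totally_umbilical A g N U \<mu> \<longleftrightarrow> smooth_map A N euclid \<mu> \<and>
     (\<forall>q\<in>N. \<forall>X\<in>tangent_space A N q. \<forall>Y\<in>tangent_space A N q.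
        null_second_form A g N U q X Y = \<mu> q * g q X Y)"


section \<open>Leaves and isometries\<close>

text \<open>Leaves are immersed submanifolds: they carry an atlas of their own, whose topology may a priori
  be finer than the subspace topology.\<close>

definition immersed_tangent_space ::
  "('a, 'e::euclidean_space) chart set \<Rightarrow> ('a, 'k::euclidean_space) chart set \<Rightarrow> 'a \<Rightarrow> 'e set" where
  "immersed_tangent_space A L q = {velocity A \<gamma> 0 | \<gamma>. curve_through L (pts L) q \<gamma>}"

definition immersed_submanifold ::
  "('a, 'e::euclidean_space) chart set \<Rightarrow> ('a, 'k::euclidean_space) chart set \<Rightarrow> bool" where
  "immersed_submanifold A L \<longleftrightarrow> manifold L \<and> smooth_map L (pts L) A (\<lambda>q. q) \<and>
     (\<forall>q\<in>pts L. \<forall>\<gamma>. curve_through L (pts L) q \<gamma> \<and> velocity A \<gamma> 0 = 0 \<longrightarrow> velocity L \<gamma> 0 = 0)"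

definition integral_manifold ::
  "('a, 'e::euclidean_space) chart set \<Rightarrow> 'a set \<Rightarrow> ('a \<Rightarrow> 'e set)
     \<Rightarrow> ('a, 'k::euclidean_space) chart set \<Rightarrow> bool" where
  "integral_manifold A N D L \<longleftrightarrow> immersed_submanifold A L \<and> pts L \<subseteq> N \<and>
     (\<forall>q\<in>pts L. immersed_tangent_space A L q = D q)"

definition leaf ::
  "('a, 'e::euclidean_space) chart set \<Rightarrow> 'a set \<Rightarrow> ('a \<Rightarrow> 'e set)
     \<Rightarrow> ('a, 'k::euclidean_space) chart set \<Rightarrow> bool" where
  "leaf A N D L \<longleftrightarrow> pts L \<noteq> {} \<and> integral_manifold A N D L \<and> connected_space (mtop L) \<and>
     (\<forall>L' :: ('a, 'k) chart set. integral_manifold A N D L' \<and> connected_space (mtop L') \<and>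
        pts L \<subseteq> pts L' \<longrightarrow> pts L' = pts L)"

text \<open>Isometry for the metrics induced by \<open>g\<close>. Tangent vectors of \<open>L\<close> are velocities of curves
  \<open>\<alpha>\<close>, \<open>\<beta>\<close> in \<open>L\<close>, and their images under \<open>dG\<close> the velocities of \<open>G \<circ> \<alpha>\<close>, \<open>G \<circ> \<beta>\<close>.\<close>

definition induced_isometry ::
  "('a, 'e::euclidean_space) chart set \<Rightarrow> ('a, 'e) metric \<Rightarrow> ('a, 'k::euclidean_space) chart set
     \<Rightarrow> ('a, 'k) chart set \<Rightarrow> ('a \<Rightarrow> 'a) \<Rightarrow> bool" where
  "induced_isometry A g L L' G \<longleftrightarrow> diffeo L (pts L) L' (pts L') G \<and>
     (\<forall>q\<in>pts L. \<forall>\<alpha> \<beta>. curve_through L (pts L) q \<alpha> \<and> curve_through L (pts L) q \<beta> \<longrightarrow>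
        g (G q) (velocity A (G \<circ> \<alpha>) 0) (velocity A (G \<circ> \<beta>) 0) =
        g q (velocity A \<alpha> 0) (velocity A \<beta> 0))"

definition canonical_map ::
  "('a, 'e::euclidean_space) chart set \<Rightarrow> ('a, 'e) metric \<Rightarrow> 'a set \<Rightarrow> ('a \<Rightarrow> 'e)
     \<Rightarrow> ('a \<times> 'e) set \<Rightarrow> 'a set \<Rightarrow> 'a \<Rightarrow> 'a" where
  "canonical_map A g S \<xi> \<V> X' = inv_into X' (proj A g S \<xi> \<V>) \<circ> proj A g S \<xi> \<V>"

definition leaf_param ::
  "('a, 'e::euclidean_space) chart set \<Rightarrow> ('a, 'e) metric \<Rightarrow> 'a set \<Rightarrow> ('a \<Rightarrow> 'e)
     \<Rightarrow> ('a \<times> 'e) set \<Rightarrow> 'a set \<Rightarrow> 'a \<Rightarrow> real" where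
  "leaf_param A g S \<xi> \<V> X p = (THE t. (p, t) \<in> dom_Phi S \<xi> \<V> \<and> Phi A g \<xi> (p, t) \<in> X)"

end

theory Submission
  imports Defs
begin

text \<open>For a curve \<open>\<gamma>\<close> in \<open>S\<close> through \<open>p\<close>, let \<open>J(t) = \<partial>\<^sub>s\<Phi>(\<gamma>(s), t)\<close> at \<open>s = 0\<close>. Mixed derivatives commute
  and the connection is torsion-free, so \<open>\<nabla>\<^sub>t J = \<nabla>\<^sub>J U\<close>, and umbilicity gives
  \<open>d/dt g(J, K) = -2 \<mu> g(J, K)\<close> along \<open>t \<mapsto> \<Phi>(p, t)\<close> for two such fields \<open>J\<close>, \<open>K\<close>. Since \<open>\<Phi>(p, 0) = p\<close>, this integrates to
  \<open>g(J(t), K(t)) = exp(-2 \<integral>\<^sub>0\<^sup>t \<mu>(\<Phi>(p, r)) dr) g(J(0), K(0))\<close>. A vector tangent to a leaf at \<open>\<Phi>(p, t)\<close> is such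
  a \<open>J(t)\<close> with \<open>J(0)\<close> its image under \<open>dF\<close>, and \<open>F \<circ> G = F\<close>; hence \<open>G\<close> is isometric at \<open>\<Phi>(p, t\<^sub>p)\<close> iff the
  integrals up to the two parameters agree.

  The geodesic equation enters only through \<open>\<Phi>(p, 0) = p\<close>: \<open>exp_map\<close> is a definite description, so geodesics
  with zero initial velocity must be shown to be constant.\<close>

section \<open>Calculus of smooth maps\<close>

text \<open>\<open>U\<close> is a field on \<open>\<Sigma>\<close> alone, and
  \<open>nabla_on\<close> is a definite description over the curves in \<open>\<Sigma>\<close> with
  a given velocity, so \<open>\<nabla>\<^sub>J U\<close> has a value only once independence of the
  curve is known. The inverse of the normal exponential map supplies this: at
  \<open>\<Phi>(p, t)\<close> the vector \<open>U\<close> is a smooth function of the lifts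
  \<open>(p, t \<xi>\<^sub>p)\<close> and \<open>(p, \<xi>\<^sub>p)\<close>, and both lifts depend
  smoothly on the point of \<open>\<Sigma>\<close>. \<open>S\<close> is a subset without an atlas of
  its own. Hence \<open>\<Phi>\<close> is studied through curves: a curve in \<open>S\<close> turns
  it into a map on an open subset of the plane, and mixed derivatives are compared there. Geodesics
  with zero initial velocity are handled by a direct estimate: the geodesic equation is quadratic in
  the velocity, so the set of times with zero velocity is open as well as closed. To recover the
  integrals from an isometry, one vector with nonzero image under \<open>dF\<close> is needed over
  each point: a coordinate line in \<open>L\<close> provides it, and since \<open>S\<close> is
  spacelike its image has positive square, which can be cancelled.\<close>

lemma differentiable_has_frechet:
  "f differentiable (at x) \<Longrightarrow> (f has_derivative frechet_derivative f (at x)) (at x)"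
  by (simp add: frechet_derivative_works)

lemma C_on_imp_continuous: "C_on k D f \<Longrightarrow> continuous_on D f"
  by (cases k) (auto simp: continuous_at_imp_continuous_on differentiable_imp_continuous_within)

lemma C_on_Suc_D: "C_on (Suc k) D f \<Longrightarrow> C_on k D f"
proof (induction k arbitrary: f)
  case 0
  then show ?case using C_on_imp_continuous[OF 0] by simp
next
  case (Suc k)
  then show ?case by (metis C_on.simps(2))
qed

lemma C_on_subset: "C_on k D f \<Longrightarrow> D' \<subseteq> D \<Longrightarrow> C_on k D' f"
  by (induction k arbitrary: f) (auto intro: continuous_on_subset)

text \<open>\<open>frechet_derivative\<close> is taken in the whole space, so agreement on
  \<open>D\<close> passes to derivatives because \<open>D\<close> is open; the induction then
  transfers one order after another.\<close>

lemma C_on_cong: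
  assumes "open D" "\<And>x. x \<in> D \<Longrightarrow> f x = g x" "C_on k D f"
  shows "C_on k D g"
  using assms(2,3)
proof (induction k arbitrary: f g)
  case 0
  then show ?case using continuous_on_cong by force
next
  case (Suc k)
  have d: "f differentiable (at x)" if "x \<in> D" for x
    using Suc.prems that by auto
  have d': "(g has_derivative frechet_derivative f (at x)) (at x)" if "x \<in> D" for x
    using has_derivative_transform_within_open[OF differentiable_has_frechet[OF d[OF that]] assms(1) that]
      Suc.prems(1) by auto
  then have eq: "frechet_derivative f (at x) = frechet_derivative g (at x)" if "x \<in> D" for x
    using frechet_derivative_at that by blast
  have "C_on k D (\<lambda>x. frechet_derivative g (at x) v)" for v
    by (rule Suc.IH[of "\<lambda>x. frechet_derivative f (at x) v"]) (use Suc.prems eq in auto)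
  then show ?case
    using d' by (auto simp: differentiable_def)
qed

lemma C_on_local:
  assumes "\<And>x. x \<in> D \<Longrightarrow> \<exists>N. open N \<and> x \<in> N \<and> C_on k N f"
  shows "C_on k D f"
  using assms
proof (induction k arbitrary: f)
  case 0
  show ?case
    using 0 by (auto intro!: continuous_at_imp_continuous_on simp: continuous_on_eq_continuous_at)
      (metis continuous_on_eq_continuous_at)
next
  case (Suc k)
  show ?case
    unfolding C_on.simps
  proof (intro conjI ballI allI)
    fix x assume "x \<in> D"
    then show "f differentiable (at x)" using Suc.prems by (metis C_on.simps(2))
  next
    fix v show "C_on k D (\<lambda>x. frechet_derivative f (at x) v)"
      by (rule Suc.IH) (metis Suc.prems C_on.simps(2))
  qed
qed

lemma C_on_const: "C_on k D (\<lambda>x. c)"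
  by (induction k arbitrary: c) auto

lemma C_on_linear:
  assumes "bounded_linear f"
  shows "C_on k D f"
proof (cases k)
  case 0
  then show ?thesis using assms by (simp add: linear_continuous_on)
next
  case (Suc k')
  have d: "(f has_derivative f) (at x)" for x
    using assms by (rule bounded_linear_imp_has_derivative)
  then have "frechet_derivative f (at x) = f" for x
    using frechet_derivative_at by metis
  then show ?thesis
    using d by (auto simp: Suc differentiable_def C_on_const)
qed

lemma C_on_add:
  assumes "open D" "C_on k D f" "C_on k D g"
  shows "C_on k D (\<lambda>x. f x + g x)"
  using assms(2,3)
proof (induction k arbitrary: f g)
  case 0
  then show ?case by (simp add: continuous_on_add)
next
  case (Suc k)
  have d: "((\<lambda>x. f x + g x) has_derivative
      (\<lambda>v. frechet_derivative f (at x) v + frechet_derivative g (at x) v)) (at x)" if "x \<in> D" for x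
    using Suc.prems that by (intro has_derivative_add differentiable_has_frechet) auto
  have "C_on k D (\<lambda>x. frechet_derivative (\<lambda>x. f x + g x) (at x) v)" for v
    by (rule C_on_cong[OF assms(1) _ Suc.IH, of "\<lambda>x. frechet_derivative f (at x) v"
          "\<lambda>x. frechet_derivative g (at x) v"])
       (use Suc.prems frechet_derivative_at[OF d] in \<open>auto dest: fun_cong\<close>)
  then show ?case using d by (auto simp: differentiable_def)
qed

lemma C_on_sum:
  assumes "open D" "\<And>i. i \<in> I \<Longrightarrow> C_on k D (f i)"
  shows "C_on k D (\<lambda>x. \<Sum>i\<in>I. f i x)"
  using assms(2)
  by (induction I rule: infinite_finite_induct) (auto simp: C_on_const intro!: C_on_add assms(1))

text \<open>The product rule pairs the derivative of one factor with the other factor itself. The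
  induction therefore runs over all pairs \<open>f\<close>, \<open>g\<close>, and the
  undifferentiated factor is lowered from order \<open>Suc k\<close> to order
  \<open>k\<close>.\<close>

lemma C_on_bilinear:
  assumes "bounded_bilinear b" "open D" "C_on k D f" "C_on k D g"
  shows "C_on k D (\<lambda>x. b (f x) (g x))"
  using assms(3,4)
proof (induction k arbitrary: f g)
  case 0
  then show ?case by (simp add: bounded_bilinear.continuous_on[OF assms(1)])
next
  case (Suc k)
  have d: "((\<lambda>x. b (f x) (g x)) has_derivative
      (\<lambda>v. b (f x) (frechet_derivative g (at x) v) + b (frechet_derivative f (at x) v) (g x))) (at x)"
    if "x \<in> D" for x
    using Suc.prems that
    by (intro bounded_bilinear.FDERIV[OF assms(1)] differentiable_has_frechet) auto
  have "C_on k D (\<lambda>x. frechet_derivative (\<lambda>x. b (f x) (g x)) (at x) v)" for v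
  proof (rule C_on_cong[OF assms(2)])
    show "C_on k D (\<lambda>x. b (f x) (frechet_derivative g (at x) v) + b (frechet_derivative f (at x) v) (g x))"
      using Suc.prems C_on_Suc_D[OF Suc.prems(1)] C_on_Suc_D[OF Suc.prems(2)]
      by (intro C_on_add assms(2) Suc.IH) auto
  qed (use frechet_derivative_at[OF d] in \<open>auto dest: fun_cong\<close>)
  then show ?case using d by (auto simp: differentiable_def)
qed

text \<open>\<open>C_on\<close> controls derivatives in fixed directions only. Expansion in the
  basis turns a direction that moves with the point, as the chain rule produces, into scalar
  coefficients times derivatives in fixed directions.\<close>

lemma frechet_derivative_sum_Basis:
  fixes f :: "'a::euclidean_space \<Rightarrow> 'b::real_normed_vector"
  assumes "f differentiable (at x)"
  shows "frechet_derivative f (at x) w = (\<Sum>i\<in>Basis. (w \<bullet> i) *\<^sub>R frechet_derivative f (at x) i)"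
proof -
  have l: "linear (frechet_derivative f (at x))"
    using assms by (rule linear_frechet_derivative)
  have "frechet_derivative f (at x) (\<Sum>i\<in>Basis. (w \<bullet> i) *\<^sub>R i) = (\<Sum>i\<in>Basis. (w \<bullet> i) *\<^sub>R frechet_derivative f (at x) i)"
    by (simp add: linear_sum[OF l] linear_cmul[OF l])
  then show ?thesis by (simp add: euclidean_representation)
qed

lemma C_on_compose:
  assumes "open D" "open E" "C_on k D f" "C_on k E g" "g ` E \<subseteq> D"
  shows "C_on k E (\<lambda>x. f (g x))"
  using assms(3-5)
proof (induction k arbitrary: f g)
  case 0
  then show ?case by (auto intro: continuous_on_compose2)
next
  case (Suc k)
  have df: "f differentiable (at (g x))" and dg: "g differentiable (at x)" if "x \<in> E" for x
    using Suc.prems that by auto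
  have d: "((\<lambda>x. f (g x)) has_derivative
      (\<lambda>v. frechet_derivative f (at (g x)) (frechet_derivative g (at x) v))) (at x)" if "x \<in> E" for x
    using has_derivative_compose[OF differentiable_has_frechet[OF dg[OF that]] differentiable_has_frechet[OF df[OF that]]] .
  have "C_on k E (\<lambda>x. frechet_derivative (\<lambda>x. f (g x)) (at x) v)" for v
  proof (rule C_on_cong[OF assms(2)])
    show "C_on k E (\<lambda>x. \<Sum>i\<in>Basis. (frechet_derivative g (at x) v \<bullet> i) *\<^sub>R frechet_derivative f (at (g x)) i)"
    proof (rule C_on_sum[OF assms(2)])
      fix i :: 'a
      have 1: "C_on k E (\<lambda>x. frechet_derivative g (at x) v \<bullet> i)"
        using Suc.prems
        by (intro C_on_bilinear[OF bounded_bilinear_inner] assms C_on_const) auto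
      have 2: "C_on k E (\<lambda>x. frechet_derivative f (at (g x)) i)"
        using Suc.prems C_on_Suc_D[OF Suc.prems(2)]
        by (intro Suc.IH[of "\<lambda>y. frechet_derivative f (at y) i"]) auto
      show "C_on k E (\<lambda>x. (frechet_derivative g (at x) v \<bullet> i) *\<^sub>R frechet_derivative f (at (g x)) i)"
        by (rule C_on_bilinear[OF bounded_bilinear_scaleR assms(2) 1 2])
    qed
    fix x assume x: "x \<in> E"
    show "(\<Sum>i\<in>Basis. (frechet_derivative g (at x) v \<bullet> i) *\<^sub>R frechet_derivative f (at (g x)) i) =
        frechet_derivative (\<lambda>x. f (g x)) (at x) v"
      unfolding frechet_derivative_at[OF d[OF x], symmetric]
      by (rule frechet_derivative_sum_Basis[OF df[OF x], symmetric])
  qed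
  then show ?case using d by (auto simp: differentiable_def)
qed

section \<open>Smooth maps on open sets, with derivatives in moving directions\<close>

lemma smooth_on_differentiable: "smooth_on D f \<Longrightarrow> x \<in> D \<Longrightarrow> f differentiable (at x)"
  unfolding smooth_on_def by (metis C_on.simps(2))

lemma smooth_on_has_derivative:
  "smooth_on D f \<Longrightarrow> x \<in> D \<Longrightarrow> (f has_derivative frechet_derivative f (at x)) (at x)"
  using smooth_on_differentiable differentiable_has_frechet by blast

lemma smooth_on_continuous: "smooth_on D f \<Longrightarrow> continuous_on D f"
  unfolding smooth_on_def using C_on_imp_continuous by blast

lemma smooth_on_subset: "smooth_on D f \<Longrightarrow> D' \<subseteq> D \<Longrightarrow> smooth_on D' f"
  unfolding smooth_on_def using C_on_subset by blast

lemma smooth_on_cong: "open D \<Longrightarrow> (\<And>x. x \<in> D \<Longrightarrow> f x = g x) \<Longrightarrow> smooth_on D f \<Longrightarrow> smooth_on D g"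
  unfolding smooth_on_def using C_on_cong[of D f g] by blast

lemma smooth_on_local: "(\<And>x. x \<in> D \<Longrightarrow> \<exists>N. open N \<and> x \<in> N \<and> smooth_on N f) \<Longrightarrow> smooth_on D f"
  unfolding smooth_on_def using C_on_local[of D _ f] by meson

lemma smooth_on_const: "smooth_on D (\<lambda>x. c)"
  by (simp add: smooth_on_def C_on_const)

lemma smooth_on_linear: "bounded_linear f \<Longrightarrow> smooth_on D f"
  by (simp add: smooth_on_def C_on_linear)

lemma smooth_on_add:
  "open D \<Longrightarrow> smooth_on D f \<Longrightarrow> smooth_on D g \<Longrightarrow> smooth_on D (\<lambda>x. f x + g x)"
  by (simp add: smooth_on_def C_on_add)

lemma smooth_on_sum:
  "open D \<Longrightarrow> (\<And>i. i \<in> I \<Longrightarrow> smooth_on D (f i)) \<Longrightarrow> smooth_on D (\<lambda>x. \<Sum>i\<in>I. f i x)"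
  by (simp add: smooth_on_def C_on_sum)

lemma smooth_on_bilinear:
  "bounded_bilinear b \<Longrightarrow> open D \<Longrightarrow> smooth_on D f \<Longrightarrow> smooth_on D g \<Longrightarrow> smooth_on D (\<lambda>x. b (f x) (g x))"
  by (simp add: smooth_on_def C_on_bilinear)

lemma smooth_on_compose:
  "open D \<Longrightarrow> open E \<Longrightarrow> smooth_on D f \<Longrightarrow> smooth_on E g \<Longrightarrow> g ` E \<subseteq> D \<Longrightarrow> smooth_on E (\<lambda>x. f (g x))"
  by (simp add: smooth_on_def C_on_compose)

lemma smooth_on_Pair:
  assumes "open D" "smooth_on D f" "smooth_on D g"
  shows "smooth_on D (\<lambda>x. (f x, g x))"
proof -
  have "bounded_linear (\<lambda>x. (x, 0))" "bounded_linear (\<lambda>y. (0, y))"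
    by (simp_all add: bounded_linear_Pair bounded_linear_ident bounded_linear_zero)
  then have "smooth_on D (\<lambda>x. (\<lambda>x. (x, 0)) (f x) + (\<lambda>y. (0, y)) (g x))"
    by (intro smooth_on_add assms smooth_on_compose[OF open_UNIV, where g=f]
        smooth_on_compose[OF open_UNIV, where g=g]  smooth_on_linear) auto
  then show ?thesis by simp
qed

lemma smooth_on_fst: "smooth_on D f \<Longrightarrow> open D \<Longrightarrow> smooth_on D (\<lambda>x. fst (f x))"
  by (rule smooth_on_compose[OF open_UNIV _ smooth_on_linear[OF bounded_linear_fst]]) auto

lemma smooth_on_snd: "smooth_on D f \<Longrightarrow> open D \<Longrightarrow> smooth_on D (\<lambda>x. snd (f x))"
  by (rule smooth_on_compose[OF open_UNIV _ smooth_on_linear[OF bounded_linear_snd]]) auto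

lemma smooth_on_deriv: "smooth_on D f \<Longrightarrow> smooth_on D (\<lambda>x. frechet_derivative f (at x) v)"
  unfolding smooth_on_def by (metis C_on.simps(2))

text \<open>Joint smoothness in base point and direction is what the fibre part of the tangent
  bundle transition maps needs, and later the formula that reads \<open>U\<close> off the
  exponential map.\<close>

lemma smooth_on_deriv_apply:
  assumes "open D" "open E" "smooth_on D f" "smooth_on E h" "smooth_on E w" "h ` E \<subseteq> D"
  shows "smooth_on E (\<lambda>x. frechet_derivative f (at (h x)) (w x))"
proof (rule smooth_on_cong[OF assms(2)])
  show "smooth_on E (\<lambda>x. \<Sum>i\<in>Basis. (w x \<bullet> i) *\<^sub>R frechet_derivative f (at (h x)) i)"
    by (intro smooth_on_sum smooth_on_bilinear[OF bounded_bilinear_scaleR]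
        smooth_on_bilinear[OF bounded_bilinear_inner] assms smooth_on_const
        smooth_on_compose[OF assms(1) assms(2) smooth_on_deriv])
  fix x assume "x \<in> E"
  then show "(\<Sum>i\<in>Basis. (w x \<bullet> i) *\<^sub>R frechet_derivative f (at (h x)) i) = frechet_derivative f (at (h x)) (w x)"
    using assms smooth_on_differentiable by (intro frechet_derivative_sum_Basis[symmetric]) blast
qed

text \<open>Both mixed derivatives are limits of the same second difference quotient.\<close>

lemma second_difference:
  fixes f :: "'a::euclidean_space \<Rightarrow> real"
  assumes "open D" "smooth_on D f" "h > 0"
    and sub: "\<And>a b. 0 \<le> a \<Longrightarrow> a \<le> h \<Longrightarrow> 0 \<le> b \<Longrightarrow> b \<le> h \<Longrightarrow> x + a *\<^sub>R u + b *\<^sub>R v \<in> D"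
  shows "\<exists>a b. 0 \<le> a \<and> a \<le> h \<and> 0 \<le> b \<and> b \<le> h \<and>
     f (x + h *\<^sub>R u + h *\<^sub>R v) - f (x + h *\<^sub>R u) - f (x + h *\<^sub>R v) + f x =
     h * h * frechet_derivative (\<lambda>y. frechet_derivative f (at y) u) (at (x + a *\<^sub>R u + b *\<^sub>R v)) v"
proof -
  define f1 where "f1 y = frechet_derivative f (at y) u" for y
  have s1: "smooth_on D f1"
    unfolding f1_def using assms(2) by (rule smooth_on_deriv)
  have c: "((\<lambda>a. f (x + a *\<^sub>R u + b *\<^sub>R v)) has_real_derivative f1 (x + a *\<^sub>R u + b *\<^sub>R v)) (at a)"
    if "0 \<le> a" "a \<le> h" "0 \<le> b" "b \<le> h" for a b
  proof -
    have "((\<lambda>a. f (x + a *\<^sub>R u + b *\<^sub>R v)) has_derivative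
        (\<lambda>t. frechet_derivative f (at (x + a *\<^sub>R u + b *\<^sub>R v)) (t *\<^sub>R u))) (at a)"
      by (rule has_derivative_compose[where g=f and f="\<lambda>a. x + a *\<^sub>R u + b *\<^sub>R v", OF _ smooth_on_has_derivative[OF assms(2) sub[OF that]]])
         (auto intro!: derivative_eq_intros)
    then show ?thesis
      unfolding has_field_derivative_def f1_def
      using linear_cmul[OF linear_frechet_derivative[OF smooth_on_differentiable[OF assms(2) sub[OF that]]]]
      by (auto simp: mult.commute[of _ "frechet_derivative _ _ _"])
  qed
  have c2: "((\<lambda>b. f1 (x + a *\<^sub>R u + b *\<^sub>R v)) has_real_derivative
      frechet_derivative f1 (at (x + a *\<^sub>R u + b *\<^sub>R v)) v) (at b)"
    if "0 \<le> a" "a \<le> h" "0 \<le> b" "b \<le> h" for a b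
  proof -
    have "((\<lambda>b. f1 (x + a *\<^sub>R u + b *\<^sub>R v)) has_derivative
        (\<lambda>t. frechet_derivative f1 (at (x + a *\<^sub>R u + b *\<^sub>R v)) (t *\<^sub>R v))) (at b)"
      by (rule has_derivative_compose[where g=f1 and f="\<lambda>b. x + a *\<^sub>R u + b *\<^sub>R v", OF _ smooth_on_has_derivative[OF s1 sub[OF that]]])
         (auto intro!: derivative_eq_intros)
    then show ?thesis
      unfolding has_field_derivative_def
      using linear_cmul[OF linear_frechet_derivative[OF smooth_on_differentiable[OF s1 sub[OF that]]]]
      by (auto simp: mult.commute[of _ "frechet_derivative _ _ _"])
  qed
  \<comment> \<open>The second difference is \<open>G h - G 0\<close>. The mean value theorem in the
    \<open>u\<close> parameter turns it into \<open>h\<close> times a difference of values of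
    \<open>f1\<close>; a second application, in the \<open>v\<close> parameter, supplies the other
    factor \<open>h\<close>.\<close>
  define G where "G a = f (x + a *\<^sub>R u + h *\<^sub>R v) - f (x + a *\<^sub>R u + 0 *\<^sub>R v)" for a
  have "\<exists>a. 0 < a \<and> a < h \<and> G h - G 0 =
      (h - 0) * (f1 (x + a *\<^sub>R u + h *\<^sub>R v) - f1 (x + a *\<^sub>R u + 0 *\<^sub>R v))"
    unfolding G_def
    by (rule MVT2[OF \<open>h > 0\<close>]) (use \<open>h > 0\<close> in \<open>intro DERIV_diff c; simp\<close>)
  then obtain a where a: "0 < a" "a < h" "G h - G 0 =
      h * (f1 (x + a *\<^sub>R u + h *\<^sub>R v) - f1 (x + a *\<^sub>R u + 0 *\<^sub>R v))" by auto
  have "\<exists>b. 0 < b \<and> b < h \<and> f1 (x + a *\<^sub>R u + h *\<^sub>R v) - f1 (x + a *\<^sub>R u + 0 *\<^sub>R v) =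
      (h - 0) * frechet_derivative f1 (at (x + a *\<^sub>R u + b *\<^sub>R v)) v"
    by (rule MVT2[OF \<open>h > 0\<close>]) (use a in \<open>intro c2; simp\<close>)
  then obtain b where "0 < b" "b < h" "f1 (x + a *\<^sub>R u + h *\<^sub>R v) - f1 (x + a *\<^sub>R u + 0 *\<^sub>R v) =
      h * frechet_derivative f1 (at (x + a *\<^sub>R u + b *\<^sub>R v)) v" by auto
  then show ?thesis
    using a unfolding f1_def[symmetric] G_def
    by (intro exI[of _ a] exI[of _ b]) (auto simp: algebra_simps)
qed

lemma second_difference_tendsto:
  fixes f :: "'a::euclidean_space \<Rightarrow> real"
  assumes "open D" "smooth_on D f" "x \<in> D"
  shows "((\<lambda>h. (f (x + h *\<^sub>R u + h *\<^sub>R v) - f (x + h *\<^sub>R u) - f (x + h *\<^sub>R v) + f x) / (h * h)) \<longlongrightarrow>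
     frechet_derivative (\<lambda>y. frechet_derivative f (at y) u) (at x) v) (at_right 0)"
proof -
  define f2 where "f2 y = frechet_derivative (\<lambda>y. frechet_derivative f (at y) u) (at y) v" for y
  have "smooth_on D f2"
    unfolding f2_def by (intro smooth_on_deriv assms)
  then have "isCont f2 x"
    using assms smooth_on_continuous continuous_on_eq_continuous_at by blast
  show ?thesis
    unfolding f2_def[symmetric]
  proof (rule tendstoI)
    fix e :: real assume "e > 0"
    then obtain d1 where d1: "d1 > 0" "\<And>y. dist y x < d1 \<Longrightarrow> dist (f2 y) (f2 x) < e"
      using \<open>isCont f2 x\<close> unfolding continuous_at_eps_delta by blast
    obtain d2 where d2: "d2 > 0" "ball x d2 \<subseteq> D"
      using assms openE by blast
    \<comment> \<open>For steps below \<open>d\<close> the whole parallelogram stays within both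
      radii. The summand 1 keeps the denominator positive when \<open>u\<close> and \<open>v\<close>
      vanish.\<close>
    define d where "d = min d1 d2 / (norm u + norm v + 1)"
    have pos: "norm u + norm v + 1 > 0" by (smt (verit) norm_ge_zero)
    have "d > 0"
      using d1 d2 pos by (simp add: d_def)
    have near: "dist (x + a *\<^sub>R u + b *\<^sub>R v) x < min d1 d2"
      if "0 \<le> a" "a \<le> h" "0 \<le> b" "b \<le> h" "h < d" for a b h
    proof -
      have "dist (x + a *\<^sub>R u + b *\<^sub>R v) x = norm (a *\<^sub>R u + b *\<^sub>R v)"
        by (simp add: dist_norm algebra_simps)
      also have "\<dots> \<le> a * norm u + b * norm v"
        using norm_triangle_ineq[of "a *\<^sub>R u" "b *\<^sub>R v"] that by simp
      also have "\<dots> \<le> h * norm u + h * norm v"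
        using that by (intro add_mono mult_right_mono) auto
      also have "\<dots> \<le> h * (norm u + norm v + 1)"
        using that by (simp add: algebra_simps)
      also have "\<dots> < d * (norm u + norm v + 1)"
        using that pos by simp
      also have "\<dots> = min d1 d2"
        using pos by (simp add: d_def)
      finally show ?thesis .
    qed
    have "dist ((f (x + h *\<^sub>R u + h *\<^sub>R v) - f (x + h *\<^sub>R u) - f (x + h *\<^sub>R v) + f x) / (h * h)) (f2 x) < e"
      if h: "0 < h" "h < d" for h
    proof -
      have "\<exists>a b. 0 \<le> a \<and> a \<le> h \<and> 0 \<le> b \<and> b \<le> h \<and>
         f (x + h *\<^sub>R u + h *\<^sub>R v) - f (x + h *\<^sub>R u) - f (x + h *\<^sub>R v) + f x = h * h * f2 (x + a *\<^sub>R u + b *\<^sub>R v)"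
        unfolding f2_def
        by (rule second_difference[OF assms(1,2) h(1)])
           (use near[OF _ _ _ _ h(2)] d2 in \<open>force simp: dist_commute\<close>)
      then show ?thesis
        using h d1(2) near by force
    qed
    then show "\<forall>\<^sub>F h in at_right 0. dist ((f (x + h *\<^sub>R u + h *\<^sub>R v) - f (x + h *\<^sub>R u) - f (x + h *\<^sub>R v) + f x) / (h * h)) (f2 x) < e"
      using \<open>d > 0\<close> by (auto simp: eventually_at_right_field)
  qed
qed

lemma frechet_derivative_inner_left:
  assumes "f differentiable (at x)"
  shows "frechet_derivative (\<lambda>y. f y \<bullet> i) (at x) u = frechet_derivative f (at x) u \<bullet> i"
proof -
  have "((\<lambda>y. f y \<bullet> i) has_derivative (\<lambda>u. frechet_derivative f (at x) u \<bullet> i)) (at x)"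
    using differentiable_has_frechet[OF assms] by (rule has_derivative_inner_left)
  then show ?thesis by (metis frechet_derivative_at)
qed

lemma schwarz:
  fixes f :: "'a::euclidean_space \<Rightarrow> 'b::euclidean_space"
  assumes D: "open D" and f: "smooth_on D f" and x: "x \<in> D"
  shows "frechet_derivative (\<lambda>y. frechet_derivative f (at y) u) (at x) v =
    frechet_derivative (\<lambda>y. frechet_derivative f (at y) v) (at x) u"
proof (rule euclidean_eqI)
  fix i :: 'b assume "i \<in> Basis"
  \<comment> \<open>Passing to components is forced by the mean value theorem behind
    \<open>second_difference_tendsto\<close>, which concerns real values.\<close>
  define F where "F y = f y \<bullet> i" for y
  have F: "smooth_on D F"
    unfolding F_def by (intro smooth_on_bilinear[OF bounded_bilinear_inner] D f smooth_on_const)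
  have eq: "frechet_derivative (\<lambda>y. frechet_derivative F (at y) u) (at x) v =
      frechet_derivative (\<lambda>y. frechet_derivative f (at y) u) (at x) v \<bullet> i" for u v
  proof -
    have "frechet_derivative (\<lambda>y. frechet_derivative F (at y) u) (at x) =
        frechet_derivative (\<lambda>y. frechet_derivative f (at y) u \<bullet> i) (at x)"
      by (rule frechet_derivative_transform_within_open[OF smooth_on_differentiable[OF smooth_on_deriv[OF F] x] D x])
         (use smooth_on_differentiable[OF f] in \<open>auto simp: F_def[abs_def] frechet_derivative_inner_left\<close>)
    then show ?thesis
      by (simp add: frechet_derivative_inner_left smooth_on_differentiable[OF smooth_on_deriv[OF f] x])
  qed
  have l: "((\<lambda>h. (F (x + h *\<^sub>R u + h *\<^sub>R v) - F (x + h *\<^sub>R u) - F (x + h *\<^sub>R v) + F x) / (h * h)) \<longlongrightarrow>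
     frechet_derivative (\<lambda>y. frechet_derivative F (at y) u) (at x) v) (at_right 0)"
    by (rule second_difference_tendsto[OF D F x])
  have "((\<lambda>h. (F (x + h *\<^sub>R v + h *\<^sub>R u) - F (x + h *\<^sub>R v) - F (x + h *\<^sub>R u) + F x) / (h * h)) \<longlongrightarrow>
     frechet_derivative (\<lambda>y. frechet_derivative F (at y) v) (at x) u) (at_right 0)"
    by (rule second_difference_tendsto[OF D F x])
  then have r: "((\<lambda>h. (F (x + h *\<^sub>R u + h *\<^sub>R v) - F (x + h *\<^sub>R u) - F (x + h *\<^sub>R v) + F x) / (h * h)) \<longlongrightarrow>
     frechet_derivative (\<lambda>y. frechet_derivative F (at y) v) (at x) u) (at_right 0)"
    by (simp add: algebra_simps)
  show "frechet_derivative (\<lambda>y. frechet_derivative f (at y) u) (at x) v \<bullet> i =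
    frechet_derivative (\<lambda>y. frechet_derivative f (at y) v) (at x) u \<bullet> i"
    using tendsto_unique[OF _ l r] by (simp add: eq)
qed

section \<open>Charts and smooth maps between manifolds\<close>

lemma cinv_chart: "is_atlas A \<Longrightarrow> c \<in> A \<Longrightarrow> p \<in> fst c \<Longrightarrow> cinv c (snd c p) = p"
  by (auto simp: is_atlas_def is_chart_def intro: inv_into_f_f)

lemma chart_image_mem:
  assumes A: "is_atlas A" "c \<in> A" and p: "p \<in> fst c" and X: "X \<subseteq> fst c"
  shows "snd c p \<in> snd c ` X \<longleftrightarrow> p \<in> X"
proof
  assume "snd c p \<in> snd c ` X"
  then obtain q where q: "q \<in> X" "snd c p = snd c q" by blast
  then have "p = q"
    using cinv_chart[OF A p] cinv_chart[OF A, of q] X by auto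
  then show "p \<in> X" using q by simp
qed simp

lemma chart_cinv: "x \<in> snd c ` fst c \<Longrightarrow> snd c (cinv c x) = x"
  by (rule f_inv_into_f)

lemma cinv_in: "x \<in> snd c ` fst c \<Longrightarrow> cinv c x \<in> fst c"
  by (rule inv_into_into)

lemma open_chart: "is_atlas A \<Longrightarrow> c \<in> A \<Longrightarrow> open (snd c ` fst c)"
  by (auto simp: is_atlas_def is_chart_def)

lemma open_overlap: "is_atlas A \<Longrightarrow> c \<in> A \<Longrightarrow> c' \<in> A \<Longrightarrow> open (snd c ` (fst c \<inter> fst c'))"
  by (auto simp: is_atlas_def compatible_def)

lemma smooth_transition:
  "is_atlas A \<Longrightarrow> c \<in> A \<Longrightarrow> c' \<in> A \<Longrightarrow> smooth_on (snd c ` (fst c \<inter> fst c')) (\<lambda>x. snd c' (cinv c x))"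
  unfolding is_atlas_def compatible_def comp_def by blast

lemma openin_chart: "is_atlas A \<Longrightarrow> c \<in> A \<Longrightarrow> openin (mtop A) (fst c)"
  by (simp add: openin_mtop pts_def Int_commute[of "fst c"] open_overlap UN_upper)

lemma openin_imp_open_image:
  "is_atlas A \<Longrightarrow> openin (mtop A) W \<Longrightarrow> c \<in> A \<Longrightarrow> open (snd c ` (W \<inter> fst c))"
  by (simp add: openin_mtop)

lemma openin_pts: "is_atlas A \<Longrightarrow> openin (mtop A) W \<Longrightarrow> W \<subseteq> pts A"
  by (simp add: openin_mtop)

lemma open_preimage:
  assumes "open D" "continuous_on D f" "open U"
  shows "open {x \<in> D. f x \<in> U}"
proof -
  have "{x \<in> D. f x \<in> U} = D \<inter> f -` U" by auto
  then show ?thesis using continuous_open_preimage[OF assms(2,1,3)] by simp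
qed

lemma smooth_on_openD:
  assumes "smooth_on_open A W B h" "c \<in> A" "d \<in> B"
  shows "open (snd c ` {x \<in> W \<inter> fst c. h x \<in> fst d})"
    and "smooth_on (snd c ` {x \<in> W \<inter> fst c. h x \<in> fst d}) (\<lambda>x. snd d (h (cinv c x)))"
  using assms by (auto simp: smooth_on_open_def Let_def comp_def)

text \<open>The definition asks for smoothness in every pair of charts. Since transition maps are
  smooth, one suitable pair near each point already decides the matter for all others.\<close>

lemma smooth_on_openI:
  assumes A: "is_atlas A" and B: "is_atlas B" and W: "openin (mtop A) W"
    and loc: "\<And>p. p \<in> W \<Longrightarrow> \<exists>c\<in>A. \<exists>d\<in>B. \<exists>U. p \<in> fst c \<and> open U \<and> snd c p \<in> U \<and>
       U \<subseteq> snd c ` (W \<inter> fst c) \<and> (\<forall>x\<in>U. h (cinv c x) \<in> fst d) \<and> smooth_on U (\<lambda>x. snd d (h (cinv c x)))"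
  shows "smooth_on_open A W B h"
proof -
  have im: "h ` W \<subseteq> pts B"
  proof clarify
    fix p assume "p \<in> W"
    then obtain c d U where c: "c \<in> A" "d \<in> B" "p \<in> fst c" "snd c p \<in> U" "\<forall>x\<in>U. h (cinv c x) \<in> fst d"
      using loc by blast
    then have "h p \<in> fst d"
      using cinv_chart[OF A c(1,3)] by metis
    then show "h p \<in> pts B"
      using c by (auto simp: pts_def)
  qed
  have main: "\<exists>N. open N \<and> x \<in> N \<and> N \<subseteq> snd c' ` {x \<in> W \<inter> fst c'. h x \<in> fst d'} \<and>
      smooth_on N (\<lambda>x. snd d' (h (cinv c' x)))"
    if c': "c' \<in> A" and d': "d' \<in> B" and x: "x \<in> snd c' ` {x \<in> W \<inter> fst c'. h x \<in> fst d'}" for c' d' x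
  proof -
    obtain p where p: "p \<in> W" "p \<in> fst c'" "h p \<in> fst d'" "x = snd c' p"
      using x by auto
    obtain c d U where c: "c \<in> A" and d: "d \<in> B" and U: "p \<in> fst c" "open U" "snd c p \<in> U"
        "U \<subseteq> snd c ` (W \<inter> fst c)" "\<And>x. x \<in> U \<Longrightarrow> h (cinv c x) \<in> fst d"
        "smooth_on U (\<lambda>x. snd d (h (cinv c x)))"
      using loc[OF p(1)] by blast
    let ?\<phi> = "\<lambda>x. snd c (cinv c' x)" and ?\<psi> = "\<lambda>x. snd d (h (cinv c x))"
    let ?\<chi> = "\<lambda>x. snd d' (cinv d x)"
    \<comment> \<open>\<open>U'\<close> keeps the values in the overlap of \<open>d\<close> and
      \<open>d'\<close>, and \<open>N\<close> transports \<open>U'\<close> back to the chart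
      \<open>c'\<close>. On \<open>N\<close> the local form in the new charts is a transition map,
      then the old local form, then a transition map.\<close>
    define U' where "U' = {y \<in> U. ?\<psi> y \<in> snd d ` (fst d \<inter> fst d')}"
    define N where "N = {y \<in> snd c' ` (fst c' \<inter> fst c). ?\<phi> y \<in> U'}"
    have oU': "open U'"
      unfolding U'_def by (intro open_preimage U smooth_on_continuous open_overlap[OF B d d'])
    have oN: "open N"
      unfolding N_def
      by (rule open_preimage[OF open_overlap[OF A c' c] smooth_on_continuous[OF smooth_transition[OF A c' c]] oU'])
    have eq: "snd d' (h (cinv c' y)) = ?\<chi> (?\<psi> (?\<phi> y))" and mem: "y \<in> snd c' ` {x \<in> W \<inter> fst c'. h x \<in> fst d'}"
      if y: "y \<in> N" for y
    proof -
      obtain q where q: "y = snd c' q" "q \<in> fst c'" "q \<in> fst c"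
        using y N_def by auto
      have c'q: "cinv c' y = q" "cinv c (?\<phi> y) = q"
        using q cinv_chart A c c' by metis+
      have "?\<phi> y \<in> U'" using y N_def by auto
      then have "snd c q \<in> U" and i: "snd d (h q) \<in> snd d ` (fst d \<inter> fst d')"
        using c'q U'_def by auto
      then have hq: "h q \<in> fst d" using U(5)[of "snd c q"] c'q by simp
      then show "snd d' (h (cinv c' y)) = ?\<chi> (?\<psi> (?\<phi> y))"
        using c'q cinv_chart[OF B d hq] by simp
      have "h q \<in> fst d'"
        using i chart_image_mem[OF B d hq, of "fst d \<inter> fst d'"] by simp
      moreover have "q \<in> W"
        using U(4) \<open>snd c q \<in> U\<close> chart_image_mem[OF A c q(3), of "W \<inter> fst c"] by blast
      ultimately show "y \<in> snd c' ` {x \<in> W \<inter> fst c'. h x \<in> fst d'}"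
        using q by auto
    qed
    have "smooth_on N (\<lambda>y. ?\<chi> (?\<psi> (?\<phi> y)))"
    proof (rule smooth_on_compose[of _ _ "\<lambda>y. ?\<chi> (?\<psi> y)"])
      show "smooth_on U' (\<lambda>y. ?\<chi> (?\<psi> y))"
        by (rule smooth_on_compose[OF open_overlap[OF B d d'] oU' smooth_transition[OF B d d'] smooth_on_subset[OF U(6)]])
           (auto simp: U'_def)
      show "smooth_on N ?\<phi>"
        by (rule smooth_on_subset[OF smooth_transition[OF A c' c]]) (auto simp: N_def)
    qed (use oU' oN N_def in auto)
    then have "smooth_on N (\<lambda>x. snd d' (h (cinv c' x)))"
      by (rule smooth_on_cong[OF oN, rotated]) (simp add: eq)
    moreover have "x \<in> N"
      using p U cinv_chart[OF A c' p(2)] cinv_chart[OF A c U(1)] U(5)[OF U(3)] by (auto simp: N_def U'_def)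
    ultimately show ?thesis using oN mem by blast
  qed
  show ?thesis
    unfolding smooth_on_open_def Let_def comp_def
  proof (intro conjI ballI W im)
    fix c' d' assume cd: "c' \<in> A" "d' \<in> B"
    let ?D = "snd c' ` {x \<in> W \<inter> fst c'. h x \<in> fst d'}"
    show "open ?D"
      using main[OF cd] by (meson openI open_subopen)
    show "smooth_on ?D (\<lambda>x. snd d' (h (cinv c' x)))"
      using main[OF cd] by (intro smooth_on_local) meson
  qed
qed

text \<open>Smoothness in charts gives continuity for the manifold topologies, and continuity gives
  the open domain on which two local extensions can be composed.\<close>

lemma smooth_on_open_preimage:
  assumes A: "is_atlas A" and B: "is_atlas B" and h: "smooth_on_open A W B h" and V: "openin (mtop B) V"
  shows "openin (mtop A) {x \<in> W. h x \<in> V}"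
  unfolding openin_mtop[OF A]
proof (intro conjI ballI)
  have W: "W \<subseteq> pts A" and im: "h ` W \<subseteq> pts B"
    using h openin_pts[OF A] by (auto simp: smooth_on_open_def)
  then show "{x \<in> W. h x \<in> V} \<subseteq> pts A" by auto
  fix c assume c: "c \<in> A"
  show "open (snd c ` ({x \<in> W. h x \<in> V} \<inter> fst c))"
  proof (subst open_subopen, intro ballI)
    fix y assume "y \<in> snd c ` ({x \<in> W. h x \<in> V} \<inter> fst c)"
    then obtain x where x: "y = snd c x" "x \<in> W" "h x \<in> V" "x \<in> fst c" by auto
    obtain d where d: "d \<in> B" "h x \<in> fst d"
      using im x by (auto simp: pts_def)
    note D = smooth_on_openD[OF h c d(1)]
    let ?T = "{y \<in> snd c ` {x \<in> W \<inter> fst c. h x \<in> fst d}. snd d (h (cinv c y)) \<in> snd d ` (V \<inter> fst d)}"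
    have "open ?T"
      by (rule open_preimage[OF D(1) smooth_on_continuous[OF D(2)] openin_imp_open_image[OF B V d(1)]])
    moreover have "y \<in> ?T"
      using x d cinv_chart[OF A c] by auto
    moreover have "?T \<subseteq> snd c ` ({x \<in> W. h x \<in> V} \<inter> fst c)"
    proof
      fix z assume "z \<in> ?T"
      then obtain w where w: "z = snd c w" "w \<in> W" "w \<in> fst c" "h w \<in> fst d"
          "snd d (h (cinv c z)) \<in> snd d ` (V \<inter> fst d)" by auto
      then have "snd d (h w) \<in> snd d ` (V \<inter> fst d)"
        using cinv_chart[OF A c w(3)] by simp
      then have "h w \<in> V"
        using chart_image_mem[OF B d(1) w(4), of "V \<inter> fst d"] by simp
      then show "z \<in> snd c ` ({x \<in> W. h x \<in> V} \<inter> fst c)" using w by auto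
    qed
    ultimately show "\<exists>T. open T \<and> y \<in> T \<and> T \<subseteq> snd c ` ({x \<in> W. h x \<in> V} \<inter> fst c)"
      by blast
  qed
qed

lemma smooth_on_open_compose:
  assumes A: "is_atlas A" and B: "is_atlas B" and C: "is_atlas C"
    and h: "smooth_on_open A W B h" and k: "smooth_on_open B V C k"
  shows "smooth_on_open A {x \<in> W. h x \<in> V} C (\<lambda>x. k (h x))"
proof (rule smooth_on_openI[OF A C])
  show "openin (mtop A) {x \<in> W. h x \<in> V}"
    using smooth_on_open_preimage[OF A B h] k by (auto simp: smooth_on_open_def)
  fix p assume p: "p \<in> {x \<in> W. h x \<in> V}"
  have W: "W \<subseteq> pts A" "h ` W \<subseteq> pts B" "k ` V \<subseteq> pts C"
    using h k openin_pts[OF A] by (auto simp: smooth_on_open_def)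
  then have "p \<in> pts A" "h p \<in> pts B" "k (h p) \<in> pts C" using p by auto
  then obtain c d e where c: "c \<in> A" "p \<in> fst c" and d: "d \<in> B" "h p \<in> fst d"
      and e: "e \<in> C" "k (h p) \<in> fst e"
    by (auto simp: pts_def)
  note D = smooth_on_openD[OF h c(1) d(1)] and D' = smooth_on_openD[OF k d(1) e(1)]
  let ?U = "{y \<in> snd c ` {x \<in> W \<inter> fst c. h x \<in> fst d}.
     snd d (h (cinv c y)) \<in> snd d ` {x \<in> V \<inter> fst d. k x \<in> fst e}}"
  have oU: "open ?U"
    by (rule open_preimage[OF D(1) smooth_on_continuous[OF D(2)] D'(1)])
  have U: "y \<in> snd c ` ({x \<in> W. h x \<in> V} \<inter> fst c) \<and> k (h (cinv c y)) \<in> fst e \<and>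
      snd e (k (cinv d (snd d (h (cinv c y))))) = snd e (k (h (cinv c y)))" if y: "y \<in> ?U" for y
  proof -
    let ?X = "{x \<in> V \<inter> fst d. k x \<in> fst e}"
    obtain w where w: "y = snd c w" "w \<in> W" "w \<in> fst c" "h w \<in> fst d"
      using y by blast
    have cw: "cinv c y = w" using w(1) cinv_chart[OF A c(1) w(3)] by simp
    have "snd d (h (cinv c y)) \<in> snd d ` ?X" using y by blast
    then have "h w \<in> ?X"
      unfolding cw using chart_image_mem[OF B d(1) w(4), of ?X] by blast
    then show ?thesis using w(1-3) cinv_chart[OF B d(1) w(4)] unfolding cw by auto
  qed
  have "smooth_on ?U (\<lambda>y. snd e (k (cinv d (snd d (h (cinv c y))))))"
    by (rule smooth_on_compose[OF D'(1) oU D'(2) smooth_on_subset[OF D(2)]]) auto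
  then have "smooth_on ?U (\<lambda>y. snd e (k (h (cinv c y))))"
    by (rule smooth_on_cong[OF oU, rotated]) (simp only: U)
  moreover have "snd c p \<in> ?U"
    using p c d e unfolding mem_Collect_eq cinv_chart[OF A c] by blast
  ultimately show "\<exists>c\<in>A. \<exists>d\<in>C. \<exists>U. p \<in> fst c \<and> open U \<and> snd c p \<in> U \<and>
     U \<subseteq> snd c ` ({x \<in> W. h x \<in> V} \<inter> fst c) \<and> (\<forall>x\<in>U. k (h (cinv c x)) \<in> fst d) \<and>
     smooth_on U (\<lambda>x. snd d (k (h (cinv c x))))"
  proof (intro bexI[OF _ c(1)] bexI[OF _ e(1)] exI[of _ ?U] conjI subsetI ballI)
    show "p \<in> fst c" by (rule c(2))
    show "open ?U" by (rule oU)
    show "y \<in> snd c ` ({x \<in> W. h x \<in> V} \<inter> fst c)" if "y \<in> ?U" for y using U[OF that] by (rule conjunct1)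
    show "k (h (cinv c y)) \<in> fst e" if "y \<in> ?U" for y using U[OF that] by blast
  qed assumption+
qed

section \<open>Smooth maps on arbitrary subsets, and maps on Euclidean spaces\<close>

lemma smooth_mapE:
  assumes "smooth_map A X B f" "p \<in> X"
  obtains W h where "p \<in> W" "smooth_on_open A W B h" "\<And>x. x \<in> X \<Longrightarrow> x \<in> W \<Longrightarrow> h x = f x"
  using assms unfolding smooth_map_def by (meson IntI)

lemma smooth_mapI:
  assumes "\<And>p. p \<in> X \<Longrightarrow> \<exists>W h. p \<in> W \<and> smooth_on_open A W B h \<and> (\<forall>x\<in>X \<inter> W. h x = f x)"
  shows "smooth_map A X B f"
  using assms unfolding smooth_map_def by (rule ballI)

lemma smooth_map_subset:
  assumes "smooth_map A X B f" "Y \<subseteq> X"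
  shows "smooth_map A Y B f"
proof (rule smooth_mapI)
  fix p assume "p \<in> Y"
  then obtain W h where "p \<in> W" "smooth_on_open A W B h" "\<And>x. x \<in> X \<Longrightarrow> x \<in> W \<Longrightarrow> h x = f x"
    using smooth_mapE[OF assms(1)] assms(2) by blast
  then show "\<exists>W h. p \<in> W \<and> smooth_on_open A W B h \<and> (\<forall>x\<in>Y \<inter> W. h x = f x)"
    using assms(2) by blast
qed

lemma smooth_map_cong:
  assumes "smooth_map A X B f" "\<And>x. x \<in> X \<Longrightarrow> f x = f' x"
  shows "smooth_map A X B f'"
proof (rule smooth_mapI)
  fix p assume "p \<in> X"
  then obtain W h where "p \<in> W" "smooth_on_open A W B h" "\<And>x. x \<in> X \<Longrightarrow> x \<in> W \<Longrightarrow> h x = f x"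
    using smooth_mapE[OF assms(1)] by blast
  then show "\<exists>W h. p \<in> W \<and> smooth_on_open A W B h \<and> (\<forall>x\<in>X \<inter> W. h x = f' x)"
    using assms(2) by (intro exI[of _ W] exI[of _ h]) auto
qed

lemma smooth_map_compose:
  assumes A: "is_atlas A" and B: "is_atlas B" and C: "is_atlas C"
    and f: "smooth_map A X B f" and k: "smooth_map B Y C k" and im: "f ` X \<subseteq> Y"
  shows "smooth_map A X C (\<lambda>x. k (f x))"
  unfolding smooth_map_def
proof
  fix p assume p: "p \<in> X"
  obtain W h where W: "p \<in> W" "smooth_on_open A W B h" "\<And>x. x \<in> X \<inter> W \<Longrightarrow> h x = f x"
    using f p unfolding smooth_map_def by meson
  obtain V l where V: "f p \<in> V" "smooth_on_open B V C l" "\<And>x. x \<in> Y \<inter> V \<Longrightarrow> l x = k x"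
    using k im p unfolding smooth_map_def by (meson imageI subsetD)
  \<comment> \<open>The composite of the two local extensions is used where the first one lands in
    the domain of the second; this set is open, contains \<open>p\<close>, and on it the composite
    agrees with \<open>k (f x)\<close> for \<open>x\<close> in \<open>X\<close>.\<close>
  show "\<exists>W h. p \<in> W \<and> smooth_on_open A W C h \<and> (\<forall>x\<in>X \<inter> W. h x = k (f x))"
    using W V p im
    by (intro exI[of _ "{x \<in> W. h x \<in> V}"] exI[of _ "\<lambda>x. l (h x)"] conjI smooth_on_open_compose[OF A B C W(2) V(2)]) auto
qed

lemma is_atlas_euclid: "is_atlas euclid"
  by (auto simp: is_atlas_def euclid_def is_chart_def compatible_def inj_on_def
      intro!: smooth_on_cong[OF open_UNIV _ smooth_on_linear[OF bounded_linear_ident]])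

lemma openin_euclid: "openin (mtop euclid) W \<longleftrightarrow> open W"
  unfolding openin_mtop[OF is_atlas_euclid] by (auto simp: euclid_def pts_def)

lemma smooth_map_euclidI:
  fixes D :: "'x::euclidean_space set"
  assumes A: "is_atlas A"
    and loc: "\<And>x. x \<in> D \<Longrightarrow> \<exists>c\<in>A. \<exists>N. open N \<and> x \<in> N \<and> f ` N \<subseteq> fst c \<and> smooth_on N (\<lambda>y. snd c (f y))"
  shows "smooth_map euclid D A f"
  unfolding smooth_map_def
proof
  fix x assume "x \<in> D"
  then obtain c N where c: "c \<in> A" and N: "open N" "x \<in> N" "f ` N \<subseteq> fst c" "smooth_on N (\<lambda>y. snd c (f y))"
    using loc by meson
  have "smooth_on_open euclid N A f"
    by (rule smooth_on_openI[OF is_atlas_euclid A])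
       (use c N openin_euclid[of N] in \<open>auto simp: euclid_def intro!: bexI[of _ c]\<close>)
  then show "\<exists>W h. x \<in> W \<and> smooth_on_open euclid W A h \<and> (\<forall>x\<in>D \<inter> W. h x = f x)"
    using N by blast
qed

text \<open>On an open \<open>D\<close> a local extension coincides with \<open>f\<close> near
  \<open>x\<close>, so its smoothness in the chart is that of \<open>f\<close> itself.\<close>

lemma smooth_map_euclidD:
  fixes D :: "'x::euclidean_space set"
  assumes A: "is_atlas A" and f: "smooth_map euclid D A f" and D: "open D" "x \<in> D"
    and c: "c \<in> A" "f x \<in> fst c"
  shows "\<exists>N. open N \<and> x \<in> N \<and> N \<subseteq> D \<and> f ` N \<subseteq> fst c \<and> smooth_on N (\<lambda>y. snd c (f y))"
proof -
  obtain W h where W: "x \<in> W" "smooth_on_open euclid W A h" "\<And>y. y \<in> D \<inter> W \<Longrightarrow> h y = f y"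
    using f D(2) unfolding smooth_map_def by meson
  have i: "(UNIV, id) \<in> (euclid :: ('x, 'x) chart set)" by (simp add: euclid_def)
  have oW: "open W" using W(2) by (simp add: smooth_on_open_def openin_euclid)
  note S = smooth_on_openD[OF W(2) i c(1), simplified]
  let ?N = "{x \<in> W. h x \<in> fst c} \<inter> D"
  have oN: "open ?N" using S(1) D(1) by auto
  have "smooth_on ?N (\<lambda>y. snd c (f y))"
    by (rule smooth_on_cong[OF oN _ smooth_on_subset[OF S(2)]]) (use W in auto)
  moreover have "x \<in> ?N" "f ` ?N \<subseteq> fst c"
    using W D c by auto
  ultimately show ?thesis using oN by blast
qed

lemma smooth_map_image_pts:
  assumes "smooth_map A X B f"
  shows "f ` X \<subseteq> pts B"
proof
  fix y assume "y \<in> f ` X"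
  then obtain p where p: "y = f p" "p \<in> X" by blast
  then obtain W h where W: "p \<in> W" "smooth_on_open A W B h" "\<And>x. x \<in> X \<Longrightarrow> x \<in> W \<Longrightarrow> h x = f x"
    using smooth_mapE[OF assms] by blast
  then have "h p \<in> pts B" by (auto simp: smooth_on_open_def)
  then show "y \<in> pts B" using W(1) W(3)[of p] p by simp
qed

lemma smooth_map_preimage_open:
  fixes D :: "'x::euclidean_space set"
  assumes A: "is_atlas A" and f: "smooth_map euclid D A f" and D: "open D"
    and V: "openin (mtop A) V"
  shows "open {x \<in> D. f x \<in> V}"
proof (subst open_subopen, intro ballI)
  fix x assume x: "x \<in> {x \<in> D. f x \<in> V}"
  then obtain W h where W: "x \<in> W" "smooth_on_open euclid W A h" "\<And>y. y \<in> D \<Longrightarrow> y \<in> W \<Longrightarrow> h y = f y"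
    using smooth_mapE[OF f] by blast
  have "open {x \<in> W. h x \<in> V}"
    using smooth_on_open_preimage[OF is_atlas_euclid A W(2) V] by (simp add: openin_euclid)
  then show "\<exists>T. open T \<and> x \<in> T \<and> T \<subseteq> {x \<in> D. f x \<in> V}"
    using D x W by (intro exI[of _ "{x \<in> W. h x \<in> V} \<inter> D"]) auto
qed

lemma smooth_map_euclid_smooth_on:
  fixes f :: "'x::euclidean_space \<Rightarrow> 'y::euclidean_space"
  assumes "open D" "smooth_on D f"
  shows "smooth_map euclid D euclid f"
  by (rule smooth_map_euclidI[OF is_atlas_euclid]) (use assms in \<open>auto simp: euclid_def\<close>)

lemma smooth_map_euclid_const:
  fixes D :: "'x::euclidean_space set"
  assumes "is_atlas A" "p \<in> pts A"
  shows "smooth_map euclid D A (\<lambda>x. p)"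
proof (rule smooth_map_euclidI[OF assms(1)])
  fix x assume "x \<in> D"
  obtain c where "c \<in> A" "p \<in> fst c" using assms(2) by (auto simp: pts_def)
  then show "\<exists>c\<in>A. \<exists>N. open N \<and> x \<in> N \<and> (\<lambda>x. p) ` N \<subseteq> fst c \<and> smooth_on N (\<lambda>y. snd c p)"
    by (intro bexI[of _ c] exI[of _ UNIV]) (auto simp: smooth_on_const)
qed

lemma smooth_on_euclid:
  fixes f :: "'x::euclidean_space \<Rightarrow> 'y::euclidean_space"
  assumes f: "smooth_map euclid D euclid f" and D: "open D"
  shows "smooth_on D f"
proof (rule smooth_on_local)
  fix x assume x: "x \<in> D"
  have "(UNIV, id) \<in> (euclid :: ('y, 'y) chart set)" by (simp add: euclid_def)
  from smooth_map_euclidD[OF is_atlas_euclid f D x this]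
  show "\<exists>N. open N \<and> x \<in> N \<and> smooth_on N f" by auto
qed

section \<open>Tangent vectors and velocities\<close>

lemma pref_chart: "p \<in> pts A \<Longrightarrow> pref A p \<in> A \<and> p \<in> fst (pref A p)"
  unfolding pref_def pts_def by (rule someI_ex) blast

lemma chart_pts: "c \<in> A \<Longrightarrow> p \<in> fst c \<Longrightarrow> p \<in> pts A"
  by (auto simp: pts_def)

lemma transition_has_derivative:
  assumes "is_atlas A" "c \<in> A" "c' \<in> A" "p \<in> fst c" "p \<in> fst c'"
  shows "((\<lambda>x. snd c' (cinv c x)) has_derivative frechet_derivative (\<lambda>x. snd c' (cinv c x)) (at (snd c p)))
    (at (snd c p))"
  using assms by (intro smooth_on_has_derivative[OF smooth_transition]) auto

text \<open>This is the chain rule for two successive transition maps. It makes components in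
  different charts consistent, although all of them are defined relative to the arbitrary choice
  \<open>pref A p\<close>.\<close>

lemma transition_cocycle:
  assumes A: "is_atlas A" and c: "c \<in> A" "p \<in> fst c" and d: "d \<in> A" "p \<in> fst d" and e: "e \<in> A" "p \<in> fst e"
  shows "frechet_derivative (\<lambda>x. snd e (cinv d x)) (at (snd d p))
      (frechet_derivative (\<lambda>x. snd d (cinv c x)) (at (snd c p)) v) =
    frechet_derivative (\<lambda>x. snd e (cinv c x)) (at (snd c p)) v"
proof -
  have "((\<lambda>x. snd e (cinv d (snd d (cinv c x)))) has_derivative (\<lambda>v. frechet_derivative (\<lambda>x. snd e (cinv d x)) (at (snd d p))
      (frechet_derivative (\<lambda>x. snd d (cinv c x)) (at (snd c p)) v))) (at (snd c p))"
    by (rule has_derivative_compose[of "\<lambda>x. snd d (cinv c x)", OF transition_has_derivative[OF A c(1) d(1) c(2) d(2)]])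
       (use transition_has_derivative[OF A d(1) e(1) d(2) e(2)] cinv_chart[OF A c] in simp)
  then have "((\<lambda>x. snd e (cinv c x)) has_derivative (\<lambda>v. frechet_derivative (\<lambda>x. snd e (cinv d x)) (at (snd d p))
      (frechet_derivative (\<lambda>x. snd d (cinv c x)) (at (snd c p)) v))) (at (snd c p))"
    by (rule has_derivative_transform_within_open[OF _ open_overlap[OF A c(1) d(1)]])
       (use c d cinv_chart[OF A c(1)] cinv_chart[OF A d(1)] in auto)
  then show ?thesis by (metis frechet_derivative_at)
qed

lemma transition_self:
  assumes A: "is_atlas A" and c: "c \<in> A" "p \<in> fst c"
  shows "frechet_derivative (\<lambda>x. snd c (cinv c x)) (at (snd c p)) v = v"
proof -
  have "((\<lambda>x. snd c (cinv c x)) has_derivative (\<lambda>v. v)) (at (snd c p))"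
    by (rule has_derivative_transform_within_open[OF has_derivative_ident open_chart[OF A c(1)]])
       (use c chart_cinv[of _ c] in auto)
  then show ?thesis by (metis frechet_derivative_at)
qed

lemma comps_of_comps_transition:
  assumes A: "is_atlas A" and c: "c \<in> A" "p \<in> fst c" and d: "d \<in> A" "p \<in> fst d"
  shows "comps A d p (of_comps A c p u) = frechet_derivative (\<lambda>x. snd d (cinv c x)) (at (snd c p)) u"
  using transition_cocycle[OF A c _ _ d, of "pref A p"] pref_chart[OF chart_pts[OF c]]
  by (simp add: of_comps_def comps_def comp_def)

lemma comps_of_comps:
  "is_atlas A \<Longrightarrow> c \<in> A \<Longrightarrow> p \<in> fst c \<Longrightarrow> comps A c p (of_comps A c p u) = u"
  by (simp add: comps_of_comps_transition transition_self)

lemma of_comps_comps: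
  assumes A: "is_atlas A" and c: "c \<in> A" "p \<in> fst c"
  shows "of_comps A c p (comps A c p v) = v"
proof -
  have p: "pref A p \<in> A" "p \<in> fst (pref A p)" using pref_chart[OF chart_pts[OF c]] by auto
  show ?thesis
    using transition_cocycle[OF A p c p] transition_self[OF A p]
    by (simp add: of_comps_def comps_def comp_def)
qed

lemma linear_comps:
  assumes A: "is_atlas A" and c: "c \<in> A" "p \<in> fst c"
  shows "linear (comps A c p)"
proof -
  have p: "pref A p \<in> A" "p \<in> fst (pref A p)" using pref_chart[OF chart_pts[OF c]] by auto
  show ?thesis unfolding comps_def comp_def
    by (rule has_derivative_linear[OF transition_has_derivative[OF A p(1) c(1) p(2) c(2)]])
qed

lemma linear_of_comps:
  assumes A: "is_atlas A" and c: "c \<in> A" "p \<in> fst c"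
  shows "linear (of_comps A c p)"
proof -
  have p: "pref A p \<in> A" "p \<in> fst (pref A p)" using pref_chart[OF chart_pts[OF c]] by auto
  show ?thesis unfolding of_comps_def comp_def
    by (rule has_derivative_linear[OF transition_has_derivative[OF A c(1) p(1) c(2) p(2)]])
qed

lemma comps_inj:
  "is_atlas A \<Longrightarrow> c \<in> A \<Longrightarrow> p \<in> fst c \<Longrightarrow> comps A c p v = comps A c p w \<longleftrightarrow> v = w"
  by (metis of_comps_comps)

lemma comps_pref:
  assumes "is_atlas A" "p \<in> pts A"
  shows "comps A (pref A p) p v = v"
  using transition_self[OF assms(1), of "pref A p" p v] pref_chart[OF assms(2)]
  by (simp add: comps_def comp_def)

text \<open>\<open>velocity\<close> differentiates in the preferred chart of the point reached, and
  that chart changes with \<open>t\<close>. Composing with the transition map out of it gives the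
  derivative in any fixed chart.\<close>

lemma curve_chart_has_derivative:
  fixes \<gamma> :: "real \<Rightarrow> 'a"
  assumes A: "is_atlas A" and \<gamma>: "smooth_map euclid J A \<gamma>" "open J" "t \<in> J"
    and c: "c \<in> A" "\<gamma> t \<in> fst c"
  shows "((\<lambda>s. snd c (\<gamma> s)) has_vector_derivative comps A c (\<gamma> t) (velocity A \<gamma> t)) (at t)"
proof -
  let ?b = "pref A (\<gamma> t)"
  have b: "?b \<in> A" "\<gamma> t \<in> fst ?b" using pref_chart[OF chart_pts[OF c]] by auto
  obtain N where N: "open N" "t \<in> N" "\<gamma> ` N \<subseteq> fst ?b" "smooth_on N (\<lambda>y. snd ?b (\<gamma> y))"
    using smooth_map_euclidD[OF A \<gamma> b] by blast
  have "(\<lambda>s. snd ?b (\<gamma> s)) differentiable (at t)"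
    using smooth_on_differentiable N by blast
  then have "((\<lambda>s. snd ?b (\<gamma> s)) has_derivative (\<lambda>x. x *\<^sub>R velocity A \<gamma> t)) (at t)"
    by (simp add: vector_derivative_works has_vector_derivative_def velocity_def)
  then have "((\<lambda>s. snd c (cinv ?b (snd ?b (\<gamma> s)))) has_derivative
      (\<lambda>x. comps A c (\<gamma> t) (x *\<^sub>R velocity A \<gamma> t))) (at t)"
    unfolding comps_def comp_def
    by (rule has_derivative_compose) (rule transition_has_derivative[OF A b(1) c(1) b(2) c(2)])
  then have "((\<lambda>s. snd c (\<gamma> s)) has_derivative (\<lambda>x. comps A c (\<gamma> t) (x *\<^sub>R velocity A \<gamma> t))) (at t)"
    by (rule has_derivative_transform_within_open[OF _ N(1,2)]) (use N cinv_chart[OF A b(1)] in auto)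
  then show ?thesis
    unfolding has_vector_derivative_def using linear_cmul[OF linear_comps[OF A c]] by simp
qed

lemma comps_velocity:
  fixes \<gamma> :: "real \<Rightarrow> 'a"
  assumes "is_atlas A" "smooth_map euclid J A \<gamma>" "open J" "t \<in> J" "c \<in> A" "\<gamma> t \<in> fst c"
  shows "comps A c (\<gamma> t) (velocity A \<gamma> t) = vector_derivative (\<lambda>s. snd c (\<gamma> s)) (at t)"
  using vector_derivative_at[OF curve_chart_has_derivative[OF assms]] by simp

lemma velocity_cong:
  assumes "open N" "t \<in> N" "\<And>s. s \<in> N \<Longrightarrow> \<gamma> s = \<delta> s"
  shows "velocity A \<gamma> t = velocity A \<delta> t"
  unfolding velocity_def assms(3)[OF assms(2)]
  by (rule vector_derivative_cong_eq)
     (use assms in \<open>auto simp: eventually_nhds\<close>)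

lemma has_vector_derivative_chain:
  assumes "(f has_derivative f') (at (\<gamma> t))" "(\<gamma> has_vector_derivative v) (at t)"
  shows "((\<lambda>s. f (\<gamma> s)) has_vector_derivative f' v) (at t)"
  using vector_derivative_diff_chain_within[OF assms(2) has_derivative_at_withinI[OF assms(1)]]
  by (simp add: comp_def)

lemma velocity_compose:
  fixes \<gamma> :: "real \<Rightarrow> 'a"
  assumes A: "is_atlas A" and B: "is_atlas B" and h: "smooth_on_open A W B h"
    and \<gamma>: "smooth_map euclid J A \<gamma>" "open J" "t \<in> J" "\<gamma> t \<in> W"
    and c: "c \<in> A" "\<gamma> t \<in> fst c" and d: "d \<in> B" "h (\<gamma> t) \<in> fst d"
  shows "velocity B (\<lambda>s. h (\<gamma> s)) t =
    of_comps B d (h (\<gamma> t)) (frechet_derivative (\<lambda>x. snd d (h (cinv c x))) (at (snd c (\<gamma> t)))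
      (comps A c (\<gamma> t) (velocity A \<gamma> t)))"
proof -
  let ?F = "\<lambda>x. snd d (h (cinv c x))"
  have oW: "openin (mtop A) W" using h by (simp add: smooth_on_open_def)
  let ?J = "{s \<in> J. \<gamma> s \<in> W}"
  have oJ: "open ?J" by (rule smooth_map_preimage_open[OF A \<gamma>(1,2) oW])
  have "smooth_map A W B h" using h unfolding smooth_map_def by blast
  then have h\<gamma>: "smooth_map euclid ?J B (\<lambda>s. h (\<gamma> s))"
    by (intro smooth_map_compose[OF is_atlas_euclid A B smooth_map_subset[OF \<gamma>(1)]]) auto
  have "(?F has_derivative frechet_derivative ?F (at (snd c (\<gamma> t)))) (at (snd c (\<gamma> t)))"
    by (rule smooth_on_has_derivative[OF smooth_on_openD(2)[OF h c(1) d(1)]]) (use \<gamma> c d in auto)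
  then have "((\<lambda>s. ?F (snd c (\<gamma> s))) has_vector_derivative
      frechet_derivative ?F (at (snd c (\<gamma> t))) (comps A c (\<gamma> t) (velocity A \<gamma> t))) (at t)"
    by (rule has_vector_derivative_chain) (rule curve_chart_has_derivative[OF A \<gamma>(1-3) c])
  moreover obtain N where N: "open N" "t \<in> N" "\<gamma> ` N \<subseteq> fst c"
    using smooth_map_euclidD[OF A \<gamma>(1-3) c] by blast
  ultimately have "((\<lambda>s. snd d (h (\<gamma> s))) has_vector_derivative
      frechet_derivative ?F (at (snd c (\<gamma> t))) (comps A c (\<gamma> t) (velocity A \<gamma> t))) (at t)"
    by (elim has_vector_derivative_transform_within_open) (use cinv_chart[OF A c(1)] in auto)
  then have "comps B d (h (\<gamma> t)) (velocity B (\<lambda>s. h (\<gamma> s)) t) =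
      frechet_derivative ?F (at (snd c (\<gamma> t))) (comps A c (\<gamma> t) (velocity A \<gamma> t))"
    using comps_velocity[OF B h\<gamma> oJ _ d] \<gamma> by (simp add: vector_derivative_at)
  then show ?thesis using of_comps_comps[OF B d] by metis
qed

lemma curve_throughE:
  assumes "curve_through A X p \<gamma>"
  obtains J where "smooth_map euclid J A \<gamma>" "open J" "0 \<in> J" "\<gamma> ` J \<subseteq> X" "\<gamma> 0 = p" "connected J"
  using assms unfolding curve_through_def by (metis connected_Ioo greaterThanLessThan_iff
      neg_less_0_iff_less open_greaterThanLessThan)

lemma curve_throughI:
  assumes "smooth_map euclid J A \<gamma>" "open J" "0 \<in> J" "\<gamma> ` J \<subseteq> X" "\<gamma> 0 = p"
  shows "curve_through A X p \<gamma>"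
proof -
  obtain e where "e > 0" "ball 0 e \<subseteq> J" using assms openE by blast
  moreover have "ball (0::real) e = {-e<..<e}" by (auto simp: dist_real_def)
  ultimately show ?thesis
    unfolding curve_through_def using assms smooth_map_subset[OF assms(1)] by (metis image_mono subset_trans)
qed

lemma curve_through_compose:
  assumes A: "is_atlas A" "is_atlas B" and \<gamma>: "curve_through A X p \<gamma>" and f: "smooth_map A X B f" "f ` X \<subseteq> Y"
  shows "curve_through B Y (f p) (\<lambda>s. f (\<gamma> s))"
proof -
  obtain J where J: "smooth_map euclid J A \<gamma>" "open J" "0 \<in> J" "\<gamma> ` J \<subseteq> X" "\<gamma> 0 = p"
    using \<gamma> by (rule curve_throughE)
  then show ?thesis
    using f by (intro curve_throughI[OF smooth_map_compose[OF is_atlas_euclid A J(1) f(1)] J(2,3)]) auto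
qed

text \<open>A map given only on the subset \<open>X\<close> has no derivative in charts, but a local
  extension \<open>h\<close> has one, and both composed curves agree with their composites with
  \<open>h\<close> near 0. This replaces the differential of \<open>f\<close>: the velocity of an
  image curve is a function of the velocity of the curve.\<close>

lemma velocity_compose_cong:
  assumes A: "is_atlas A" and B: "is_atlas B" and f: "smooth_map A X B f"
    and \<gamma>: "curve_through A X p \<gamma>" and \<delta>: "curve_through A X p \<delta>"
    and eq: "velocity A \<gamma> 0 = velocity A \<delta> 0"
  shows "velocity B (\<lambda>s. f (\<gamma> s)) 0 = velocity B (\<lambda>s. f (\<delta> s)) 0"
proof -
  have p: "p \<in> X" using \<gamma> by (metis curve_throughE image_subset_iff)
  then obtain W h where W: "p \<in> W" "smooth_on_open A W B h" "\<And>x. x \<in> X \<Longrightarrow> x \<in> W \<Longrightarrow> h x = f x"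
    using smooth_mapE[OF f] by blast
  have oW: "openin (mtop A) W" and im: "h ` W \<subseteq> pts B" using W(2) by (auto simp: smooth_on_open_def)
  have "p \<in> pts A" "h p \<in> pts B" using im W(1) openin_pts[OF A oW] by auto
  then obtain c d where c: "c \<in> A" "p \<in> fst c" and d: "d \<in> B" "h p \<in> fst d"
    by (auto simp: pts_def)
  have "velocity B (\<lambda>s. f (\<eta> s)) 0 =
    of_comps B d (h p) (frechet_derivative (\<lambda>x. snd d (h (cinv c x))) (at (snd c p))
      (comps A c p (velocity A \<eta> 0)))" if \<eta>: "curve_through A X p \<eta>" for \<eta>
  proof -
    obtain J where J: "smooth_map euclid J A \<eta>" "open J" "0 \<in> J" "\<eta> ` J \<subseteq> X" "\<eta> 0 = p"
      using \<eta> by (rule curve_throughE)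
    have "open {s \<in> J. \<eta> s \<in> W}" by (rule smooth_map_preimage_open[OF A J(1,2) oW])
    then have "velocity B (\<lambda>s. f (\<eta> s)) 0 = velocity B (\<lambda>s. h (\<eta> s)) 0"
      by (rule velocity_cong) (use J W in auto)
    then show ?thesis
      using velocity_compose[OF A B W(2) J(1-3), of c d] J(5) W(1) c d by simp
  qed
  then show ?thesis using \<gamma> \<delta> eq by simp
qed

lemma velocity_const: "velocity A (\<lambda>s. p) t = 0"
  by (simp add: velocity_def)

lemma curve_through_mono: "curve_through A X p \<gamma> \<Longrightarrow> X \<subseteq> Y \<Longrightarrow> curve_through A Y p \<gamma>"
  unfolding curve_through_def by blast

text \<open>A coordinate line through \<open>q\<close> serves, since \<open>Basis\<close> is never
  empty. It is the source of the vector on which the two conformal factors are compared.\<close>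

lemma ex_curve_nonzero_velocity:
  fixes L :: "('a, 'k::euclidean_space) chart set"
  assumes L: "is_atlas L" and q: "q \<in> pts L"
  shows "\<exists>\<alpha>. curve_through L (pts L) q \<alpha> \<and> velocity L \<alpha> 0 \<noteq> 0"
proof -
  obtain c where c: "c \<in> L" "q \<in> fst c" using q by (auto simp: pts_def)
  obtain e :: 'k where e: "e \<in> Basis" using nonempty_Basis by blast
  let ?x = "\<lambda>s. snd c q + s *\<^sub>R e"
  define J where "J = {s \<in> UNIV. ?x s \<in> snd c ` fst c}"
  define \<alpha> where "\<alpha> = (\<lambda>s. cinv c (?x s))"
  have oJ: "open J"
    unfolding J_def by (intro open_preimage open_UNIV open_chart[OF L c(1)] continuous_intros)
  have J0: "0 \<in> J" using c by (simp add: J_def)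
  have in_c: "\<alpha> s \<in> fst c" "snd c (\<alpha> s) = ?x s" if "s \<in> J" for s
    using that cinv_in[of "?x s" c] chart_cinv[of "?x s" c] by (auto simp: J_def \<alpha>_def)
  have "smooth_on J ?x"
    by (intro smooth_on_add oJ smooth_on_const smooth_on_linear bounded_linear_scaleR_left)
  then have "smooth_on J (\<lambda>s. snd c (\<alpha> s))"
    by (rule smooth_on_cong[OF oJ, rotated]) (simp add: in_c)
  then have \<alpha>: "smooth_map euclid J L \<alpha>"
    using oJ in_c c(1) by (intro smooth_map_euclidI[OF L]) blast
  have \<alpha>0: "\<alpha> 0 = q" using cinv_chart[OF L c] by (simp add: \<alpha>_def)
  have "curve_through L (pts L) q \<alpha>"
    using chart_pts[OF c(1)] in_c by (intro curve_throughI[OF \<alpha> oJ J0 _ \<alpha>0]) blast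
  moreover have "velocity L \<alpha> 0 \<noteq> 0"
  proof
    assume "velocity L \<alpha> 0 = 0"
    then have "vector_derivative (\<lambda>s. snd c (\<alpha> s)) (at 0) = 0"
      using comps_velocity[OF L \<alpha> oJ J0 c(1)] c(2) \<alpha>0 linear_0[OF linear_comps[OF L c]] by simp
    moreover have "(?x has_vector_derivative e) (at 0)"
      by (auto intro!: derivative_eq_intros)
    then have "((\<lambda>s. snd c (\<alpha> s)) has_vector_derivative e) (at 0)"
      by (rule has_vector_derivative_transform_within_open[OF _ oJ J0]) (simp add: in_c)
    ultimately have "e = 0" using vector_derivative_at by metis
    then show False using e nonzero_Basis by blast
  qed
  ultimately show ?thesis by blast
qed

section \<open>The tangent bundle\<close>

lemma tangent_bundle_image:
  "is_atlas A \<Longrightarrow> c \<in> A \<Longrightarrow> X \<subseteq> fst c \<Longrightarrow>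
    (\<lambda>(p, v). (snd c p, comps A c p v)) ` (X \<times> UNIV) = snd c ` X \<times> UNIV"
  by (auto simp: image_iff split: prod.splits) (metis comps_of_comps subsetD)

lemma inj_on_tangent_chart:
  assumes "is_atlas A" "c \<in> A"
  shows "inj_on (\<lambda>(p, v). (snd c p, comps A c p v)) (fst c \<times> UNIV)"
  using cinv_chart[OF assms] comps_inj[OF assms] by (auto simp: inj_on_def) metis+

lemma cinv_tangent_chart:
  assumes A: "is_atlas A" "c \<in> A" and x: "x \<in> snd c ` fst c"
  shows "inv_into (fst c \<times> UNIV) (\<lambda>(p, v). (snd c p, comps A c p v)) (x, w) =
    (cinv c x, of_comps A c (cinv c x) w)"
proof (rule inv_into_f_eq[OF inj_on_tangent_chart[OF A]])
  show "(cinv c x, of_comps A c (cinv c x) w) \<in> fst c \<times> UNIV"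
    using cinv_in[OF x] by simp
  show "(case (cinv c x, of_comps A c (cinv c x) w) of (p, v) \<Rightarrow> (snd c p, comps A c p v)) = (x, w)"
    using comps_of_comps[OF A cinv_in[OF x]] chart_cinv[OF x] by simp
qed

text \<open>If \<open>\<tau>\<close> is the transition map on the base, then the one on the bundle
  is \<open>(x, w) \<mapsto> (\<tau> x, D\<tau>(x) w)\<close>, by the cocycle rule for components;
  its fibre part is a derivative in a moving direction.\<close>

lemma is_atlas_tangent_bundle:
  assumes A: "is_atlas A"
  shows "is_atlas (tangent_bundle A)"
proof -
  have "compatible (fst c \<times> UNIV, \<lambda>(p, v). (snd c p, comps A c p v))
      (fst d \<times> UNIV, \<lambda>(p, v). (snd d p, comps A d p v))" if c: "c \<in> A" and d: "d \<in> A" for c d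
  proof -
    let ?D = "snd c ` (fst c \<inter> fst d)"
    have eq: "(\<lambda>(p, v). (snd c p, comps A c p v)) ` (fst c \<times> UNIV \<inter> fst d \<times> UNIV) = ?D \<times> UNIV"
      using tangent_bundle_image[OF A c, of "fst c \<inter> fst d"] by (simp add: Times_Int_Times)
    have o: "open (?D \<times> (UNIV :: 'b set))"
      by (intro open_Times open_overlap[OF A c d] open_UNIV)
    note oD = open_overlap[OF A c d] and sD = smooth_transition[OF A c d]
    have "smooth_on (?D \<times> (UNIV :: 'b set)) (\<lambda>xw. snd d (cinv c (fst xw)))"
      using smooth_on_compose[OF oD o sD smooth_on_linear[OF bounded_linear_fst]] by fastforce
    moreover have "smooth_on (?D \<times> UNIV) (\<lambda>xw. frechet_derivative (\<lambda>x. snd d (cinv c x)) (at (fst xw)) (snd xw))"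
      using smooth_on_deriv_apply[OF oD o sD smooth_on_linear[OF bounded_linear_fst]
            smooth_on_linear[OF bounded_linear_snd]] by fastforce
    ultimately have "smooth_on (?D \<times> UNIV) (\<lambda>xw. (snd d (cinv c (fst xw)),
        frechet_derivative (\<lambda>x. snd d (cinv c x)) (at (fst xw)) (snd xw)))"
      by (rule smooth_on_Pair[OF o])
    then have "smooth_on (?D \<times> UNIV) ((\<lambda>(p, v). (snd d p, comps A d p v)) \<circ>
        inv_into (fst c \<times> UNIV) (\<lambda>(p, v). (snd c p, comps A c p v)))"
    proof (rule smooth_on_cong[OF o, rotated], clarsimp)
      fix p and w :: 'b assume p: "p \<in> fst c" "p \<in> fst d"
      have i: "inv_into (fst c \<times> UNIV) (\<lambda>(p, v). (snd c p, comps A c p v)) (snd c p, w) = (p, of_comps A c p w)"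
        using cinv_tangent_chart[OF A c, of "snd c p" w] cinv_chart[OF A c p(1)] p by auto
      show "(snd d (cinv c (snd c p)), frechet_derivative (\<lambda>x. snd d (cinv c x)) (at (snd c p)) w) =
        (case inv_into (fst c \<times> UNIV) (\<lambda>(p, v). (snd c p, comps A c p v)) (snd c p, w) of
           (p, v) \<Rightarrow> (snd d p, comps A d p v))"
        unfolding i using comps_of_comps_transition[OF A c p(1) d p(2)] cinv_chart[OF A c p(1)] by simp
    qed
    then show ?thesis using o eq by (simp add: compatible_def)
  qed
  then show ?thesis
    using inj_on_tangent_chart[OF A] tangent_bundle_image[OF A] open_chart[OF A]
    by (auto simp: is_atlas_def tangent_bundle_def is_chart_def open_Times)
qed

definition tchart ::
  "('a, 'e::euclidean_space) chart set \<Rightarrow> ('a, 'e) chart \<Rightarrow> ('a \<times> 'e, 'e \<times> 'e) chart" where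
  "tchart A c = (fst c \<times> UNIV, \<lambda>(p, v). (snd c p, comps A c p v))"

lemma tchart_mem: "c \<in> A \<Longrightarrow> tchart A c \<in> tangent_bundle A"
  by (auto simp: tchart_def tangent_bundle_def)

lemma fst_tchart [simp]: "fst (tchart A c) = fst c \<times> UNIV"
  by (simp add: tchart_def)

lemma snd_tchart [simp]: "snd (tchart A c) (p, v) = (snd c p, comps A c p v)"
  by (simp add: tchart_def)

lemma cinv_tchart:
  "is_atlas A \<Longrightarrow> c \<in> A \<Longrightarrow> x \<in> snd c ` fst c \<Longrightarrow>
    cinv (tchart A c) (x, w) = (cinv c x, of_comps A c (cinv c x) w)"
  unfolding tchart_def fst_conv snd_conv by (rule cinv_tangent_chart)

lemma smooth_map_fst:
  assumes A: "is_atlas A"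
  shows "smooth_map (tangent_bundle A) (pts (tangent_bundle A)) A fst"
proof -
  let ?T = "tangent_bundle A"
  have T: "is_atlas ?T" by (rule is_atlas_tangent_bundle[OF A])
  have o: "openin (mtop ?T) (pts ?T)"
    using open_chart[OF T] by (auto simp: openin_mtop[OF T] pts_def) (metis Int_absorb1 UN_upper fst_conv snd_conv)
  have "smooth_on_open ?T (pts ?T) A fst"
  proof (rule smooth_on_openI[OF T A o])
    fix q assume "q \<in> pts ?T"
    then obtain c where c: "c \<in> A" "q \<in> fst (tchart A c)"
      by (auto simp: pts_def tangent_bundle_def)
    let ?U = "snd (tchart A c) ` fst (tchart A c)"
    have U: "?U = snd c ` fst c \<times> UNIV"
      using tangent_bundle_image[OF A c(1) order_refl] by (simp add: tchart_def)
    have oU: "open ?U" using open_chart[OF T tchart_mem[OF c(1)]] .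
    have "smooth_on ?U (\<lambda>x. snd c (fst (cinv (tchart A c) x)))"
    proof (rule smooth_on_cong[OF oU _ smooth_on_linear[OF bounded_linear_fst]])
      fix x assume "x \<in> ?U"
      then obtain y w where "x = (y, w)" "y \<in> snd c ` fst c" unfolding U by auto
      then show "fst x = snd c (fst (cinv (tchart A c) x))"
        using cinv_tchart[OF A c(1)] chart_cinv[of y c] by simp
    qed
    moreover have "fst (cinv (tchart A c) x) \<in> fst c" if "x \<in> ?U" for x
      using cinv_in[OF that] by auto
    moreover have "?U \<subseteq> snd (tchart A c) ` (pts ?T \<inter> fst (tchart A c))"
      using chart_pts[OF tchart_mem[OF c(1)]] by blast
    ultimately show "\<exists>c\<in>?T. \<exists>d\<in>A. \<exists>U. q \<in> fst c \<and> open U \<and> snd c q \<in> U \<and>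
       U \<subseteq> snd c ` (pts ?T \<inter> fst c) \<and> (\<forall>x\<in>U. fst (cinv c x) \<in> fst d) \<and> smooth_on U (\<lambda>x. snd d (fst (cinv c x)))"
      using oU c imageI[OF c(2)]
      by (intro bexI[OF _ tchart_mem[OF c(1)]] bexI[OF _ c(1)] exI[of _ ?U] conjI ballI) simp_all
  qed
  then show ?thesis by (intro smooth_mapI) blast
qed

section \<open>The metric and its Levi-Civita connection in a chart\<close>

text \<open>In the orthogonal basis \<open>E\<close>, pairing \<open>u\<close> with a basis vector
  isolates its coefficient up to a sign.\<close>

lemma lorentz_product_nondeg:
  assumes b: "lorentz_product b" and z: "\<And>v. b u v = 0"
  shows "u = 0"
proof -
  obtain E e0 where E: "independent E" "span E = UNIV" "b e0 e0 = -1"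
      "\<And>e. e \<in> E - {e0} \<Longrightarrow> b e e = 1" "\<And>e f. e \<in> E \<Longrightarrow> f \<in> E \<Longrightarrow> e \<noteq> f \<Longrightarrow> b e f = 0"
    using b unfolding lorentz_product_def by blast
  have fin: "finite E" using E(1) by (rule independent_imp_finite)
  have "u \<in> span E" using E(2) by simp
  then obtain k where u: "u = (\<Sum>e\<in>E. k e *\<^sub>R e)"
    unfolding span_finite[OF fin] by blast
  have "k f = 0" if f: "f \<in> E" for f
  proof -
    have l: "linear (\<lambda>u. b u f)"
      using b unfolding lorentz_product_def bilinear_def by blast
    have "0 = b u f" using z by simp
    also have "\<dots> = (\<Sum>e\<in>E. k e * b e f)"
      unfolding u by (simp add: linear_sum[OF l] linear_cmul[OF l])
    also have "\<dots> = (\<Sum>e\<in>E. if e = f then k f * b f f else 0)"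
      using E(5) f by (intro sum.cong) auto
    also have "\<dots> = k f * b f f"
      using fin f by simp
    finally show "k f = 0"
      using E(3) E(4)[of f] f by (cases "f = e0") auto
  qed
  then show "u = 0" unfolding u by simp
qed

lemma metric_eq_metric_in:
  assumes "is_atlas A" "c \<in> A" "p \<in> fst c"
  shows "g p u v = metric_in A g c (snd c p) (comps A c p u) (comps A c p v)"
  using assms by (simp add: metric_in_def cinv_chart of_comps_comps)

context
  fixes A :: "('a, 'e::euclidean_space) chart set" and g :: "('a, 'e) metric" and c :: "('a, 'e) chart"
  assumes A: "is_atlas A" and g: "lorentz_metric A g" and c: "c \<in> A"
begin

lemma metric_in_smooth: "smooth_on (snd c ` fst c) (\<lambda>x. metric_in A g c x u v)"
  using g c by (auto simp: lorentz_metric_def)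

lemma metric_in_sym: "x \<in> snd c ` fst c \<Longrightarrow> metric_in A g c x u v = metric_in A g c x v u"
  using g chart_pts[OF c cinv_in[of x c]]
  by (auto simp: lorentz_metric_def lorentz_product_def metric_in_def Let_def)

lemma metric_in_linear1: "x \<in> snd c ` fst c \<Longrightarrow> linear (\<lambda>u. metric_in A g c x u v)"
proof -
  assume x: "x \<in> snd c ` fst c"
  have "linear (\<lambda>u. g (cinv c x) u w)" for w
    using g chart_pts[OF c cinv_in[OF x]]
    unfolding lorentz_metric_def lorentz_product_def bilinear_def by blast
  from linear_compose[OF linear_of_comps[OF A c cinv_in[OF x]] this]
  show ?thesis by (simp add: metric_in_def Let_def comp_def)
qed

lemma metric_in_linear2: "x \<in> snd c ` fst c \<Longrightarrow> linear (\<lambda>v. metric_in A g c x u v)"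
  using metric_in_linear1[of x u] metric_in_sym[of x u] by (simp only:)

lemma metric_in_bilinear: "x \<in> snd c ` fst c \<Longrightarrow> bilinear (metric_in A g c x)"
  unfolding bilinear_def by (intro conjI allI metric_in_linear1 metric_in_linear2)

lemma metric_in_nondeg:
  assumes x: "x \<in> snd c ` fst c" and z: "\<And>v. metric_in A g c x u v = 0"
  shows "u = 0"
proof -
  let ?p = "cinv c x"
  have p: "?p \<in> fst c" using x by (rule cinv_in)
  have lp: "lorentz_product (g ?p)"
    using g chart_pts[OF c p] unfolding lorentz_metric_def by blast
  have "g ?p (of_comps A c ?p u) v = 0" for v
    using z[of "comps A c ?p v"] of_comps_comps[OF A c p] by (simp add: metric_in_def Let_def)
  then have "of_comps A c ?p u = 0"
    by (rule lorentz_product_nondeg[OF lp])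
  then have "u = comps A c ?p 0"
    using comps_of_comps[OF A c p] by metis
  then show "u = 0" using linear_0[OF linear_comps[OF A c p]] by simp
qed

lemma metric_in_has_derivative:
  "x \<in> snd c ` fst c \<Longrightarrow> ((\<lambda>y. metric_in A g c y u v) has_derivative
     frechet_derivative (\<lambda>y. metric_in A g c y u v) (at x)) (at x)"
  by (rule smooth_on_has_derivative[OF metric_in_smooth])

lemma metric_in_deriv_linear1:
  assumes x: "x \<in> snd c ` fst c"
  shows "linear (\<lambda>u. frechet_derivative (\<lambda>y. metric_in A g c y u v) (at x) w)"
proof (rule linearI)
  let ?D = "\<lambda>u. frechet_derivative (\<lambda>y. metric_in A g c y u v) (at x)"
  note o = open_chart[OF A c]
  show "?D (u + u') w = ?D u w + ?D u' w" for u u'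
  proof -
    have "((\<lambda>y. metric_in A g c y (u + u') v) has_derivative (\<lambda>w. ?D u w + ?D u' w)) (at x)"
      by (rule has_derivative_transform_within_open[OF has_derivative_add[OF
              metric_in_has_derivative[OF x, of u v] metric_in_has_derivative[OF x, of u' v]] o x])
         (simp add: linear_add[OF metric_in_linear1])
    from fun_cong[OF frechet_derivative_at[OF this], of w] show ?thesis by (rule sym)
  qed
  show "?D (k *\<^sub>R u) w = k *\<^sub>R ?D u w" for k u
  proof -
    have "((\<lambda>y. metric_in A g c y (k *\<^sub>R u) v) has_derivative (\<lambda>w. k *\<^sub>R ?D u w)) (at x)"
      by (rule has_derivative_transform_within_open[OF has_derivative_scaleR_right[OF
              metric_in_has_derivative[OF x, of u v]] o x])
         (simp add: linear_cmul[OF metric_in_linear1])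
    from fun_cong[OF frechet_derivative_at[OF this], of w] show ?thesis by (rule sym)
  qed
qed

lemma metric_in_deriv_sym:
  assumes x: "x \<in> snd c ` fst c"
  shows "frechet_derivative (\<lambda>y. metric_in A g c y u v) (at x) =
    frechet_derivative (\<lambda>y. metric_in A g c y v u) (at x)"
  by (rule frechet_derivative_transform_within_open[OF _ open_chart[OF A c] x])
     (fact smooth_on_differentiable[OF metric_in_smooth x], rule metric_in_sym)

lemma metric_in_deriv_bilinear:
  assumes x: "x \<in> snd c ` fst c"
  shows "bilinear (\<lambda>u v. frechet_derivative (\<lambda>y. metric_in A g c y u v) (at x) w)"
  unfolding bilinear_def
proof (intro conjI allI)
  show "linear (\<lambda>v. frechet_derivative (\<lambda>y. metric_in A g c y u v) (at x) w)" for u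
    unfolding metric_in_deriv_sym[OF x, of u] by (rule metric_in_deriv_linear1[OF x])
qed (rule metric_in_deriv_linear1[OF x])

text \<open>The preceding facts are the hypotheses of the Koszul formula at a point of the chart;
  with existence and uniqueness the definite description in \<open>levi_civita\<close> has the
  intended value.\<close>

lemma levi_civita_in:
  assumes x: "x \<in> snd c ` fst c"
  shows "is_levi_civita (metric_in A g c) x (levi_civita A g c x)"
proof -
  have "\<exists>!\<Gamma>. is_levi_civita (metric_in A g c) x \<Gamma>"
  proof (rule ex1_levi_civita)
    show "linear (\<lambda>w. frechet_derivative (\<lambda>y. metric_in A g c y u v) (at x) w)" for u v
      by (rule linear_frechet_derivative[OF smooth_on_differentiable[OF metric_in_smooth x]])
    show "u = 0" if "\<And>v. metric_in A g c x u v = 0" for u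
      using metric_in_nondeg[OF x that] .
    show "bilinear (metric_in A g c x)" by (rule metric_in_bilinear[OF x])
    show "bilinear (\<lambda>u v. frechet_derivative (\<lambda>y. metric_in A g c y u v) (at x) w)" for w
      by (rule metric_in_deriv_bilinear[OF x])
    show "metric_in A g c x u v = metric_in A g c x v u" for u v by (rule metric_in_sym[OF x])
    show "frechet_derivative (\<lambda>y. metric_in A g c y u v) (at x) w =
        frechet_derivative (\<lambda>y. metric_in A g c y v u) (at x) w" for u v w
      by (rule fun_cong[OF metric_in_deriv_sym[OF x]])
  qed
  then show ?thesis unfolding levi_civita_def by (rule theI')
qed

text \<open>With this, a metric evaluated on moving vectors becomes a finite sum of products of real
  functions, to which the ordinary product rule applies.\<close>

lemma bilinear_expand:
  fixes b :: "'e \<Rightarrow> 'e \<Rightarrow> real"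
  assumes "bilinear b"
  shows "b u v = (\<Sum>i\<in>Basis. \<Sum>j\<in>Basis. (u \<bullet> i) * (v \<bullet> j) * b i j)"
proof -
  have l: "linear (\<lambda>u. b u v)" "linear (\<lambda>v. b u v)" for u v
    using assms by (auto simp: bilinear_def)
  have 2: "b w v = (\<Sum>j\<in>Basis. (v \<bullet> j) * b w j)" for w
  proof -
    have "b w v = b w (\<Sum>j\<in>Basis. (v \<bullet> j) *\<^sub>R j)" by (simp only: euclidean_representation)
    then show ?thesis by (simp only: linear_sum[OF l(2)] linear_cmul[OF l(2)] real_scaleR_def)
  qed
  have "b u v = b (\<Sum>i\<in>Basis. (u \<bullet> i) *\<^sub>R i) v" by (simp only: euclidean_representation)
  also have "\<dots> = (\<Sum>i\<in>Basis. (u \<bullet> i) * b i v)"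
    by (simp only: linear_sum[OF l(1)] linear_cmul[OF l(1)] real_scaleR_def)
  also have "\<dots> = (\<Sum>i\<in>Basis. (u \<bullet> i) * (\<Sum>j\<in>Basis. (v \<bullet> j) * b i j))"
    by (simp only: 2[symmetric])
  finally show ?thesis by (simp add: sum_distrib_left mult.assoc)
qed

text \<open>Differentiating the component expansion gives \<open>G(a', b) + G(a, b')\<close> and a
  term from the moving base point. The metric condition on \<open>\<Gamma>\<close> splits that term
  so as to complete \<open>a'\<close> and \<open>b'\<close> to covariant derivatives along the
  curve.\<close>

lemma metric_in_along_curve:
  fixes x a b :: "real \<Rightarrow> 'e"
  assumes x: "(x has_vector_derivative x') (at t)" "x t \<in> snd c ` fst c"
    and a: "(a has_vector_derivative a') (at t)" and b: "(b has_vector_derivative b') (at t)"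
  defines "\<Gamma> \<equiv> levi_civita A g c (x t)"
  shows "((\<lambda>s. metric_in A g c (x s) (a s) (b s)) has_real_derivative
    metric_in A g c (x t) (a' + \<Gamma> x' (a t)) (b t) + metric_in A g c (x t) (a t) (b' + \<Gamma> x' (b t))) (at t)"
proof -
  let ?G = "metric_in A g c"
  let ?D = "\<lambda>u v. frechet_derivative (\<lambda>y. ?G y u v) (at (x t)) x'"
  let ?C = "snd c ` fst c"
  have dG: "((\<lambda>s. ?G (x s) i j) has_real_derivative ?D i j) (at t)" for i j
    using has_vector_derivative_chain[OF metric_in_has_derivative[OF x(2)] x(1)]
    by (simp add: has_real_derivative_iff_has_vector_derivative)
  have da: "((\<lambda>s. a s \<bullet> i) has_real_derivative a' \<bullet> i) (at t)" for i
    using has_derivative_inner_left[OF a[unfolded has_vector_derivative_def], of i]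
    by (simp add: has_field_derivative_def mult.commute[of _ "a' \<bullet> i"])
  have db: "((\<lambda>s. b s \<bullet> i) has_real_derivative b' \<bullet> i) (at t)" for i
    using has_derivative_inner_left[OF b[unfolded has_vector_derivative_def], of i]
    by (simp add: has_field_derivative_def mult.commute[of _ "b' \<bullet> i"])
  have "((\<lambda>s. \<Sum>i\<in>Basis. \<Sum>j\<in>Basis. (a s \<bullet> i) * (b s \<bullet> j) * ?G (x s) i j) has_real_derivative
      (\<Sum>i\<in>Basis. \<Sum>j\<in>Basis. ((a' \<bullet> i) * (b t \<bullet> j) + (b' \<bullet> j) * (a t \<bullet> i)) * ?G (x t) i j
         + ?D i j * ((a t \<bullet> i) * (b t \<bullet> j)))) (at t)"
    by (intro DERIV_sum DERIV_mult' [THEN DERIV_cong] DERIV_mult dG da db)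
  also have "(\<Sum>i\<in>Basis. \<Sum>j\<in>Basis. ((a' \<bullet> i) * (b t \<bullet> j) + (b' \<bullet> j) * (a t \<bullet> i)) * ?G (x t) i j
         + ?D i j * ((a t \<bullet> i) * (b t \<bullet> j))) = ?G (x t) a' (b t) + ?G (x t) (a t) b' + ?D (a t) (b t)"
    unfolding bilinear_expand[OF metric_in_bilinear[OF x(2)], of a' "b t"]
      bilinear_expand[OF metric_in_bilinear[OF x(2)], of "a t" b']
      bilinear_expand[OF metric_in_deriv_bilinear[OF x(2), of x'], of "a t" "b t"]
      sum.distrib[symmetric]
    by (intro sum.cong refl) (simp add: algebra_simps)
  also have "?D (a t) (b t) = ?G (x t) (\<Gamma> x' (a t)) (b t) + ?G (x t) (a t) (\<Gamma> x' (b t))"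
    using levi_civita_in[OF x(2)] unfolding is_levi_civita_def \<Gamma>_def by blast
  finally have 1: "((\<lambda>s. \<Sum>i\<in>Basis. \<Sum>j\<in>Basis. (a s \<bullet> i) * (b s \<bullet> j) * ?G (x s) i j) has_real_derivative
    ?G (x t) (a' + \<Gamma> x' (a t)) (b t) + ?G (x t) (a t) (b' + \<Gamma> x' (b t))) (at t)"
    by (simp add: linear_add[OF metric_in_linear1[OF x(2)]] linear_add[OF metric_in_linear2[OF x(2)]] algebra_simps)
  \<comment> \<open>Bilinearity of \<open>metric_in\<close> is available inside the chart only, so
    the expansion is valid for parameters near \<open>t\<close>, where continuity keeps the curve in
    the chart.\<close>
  have "isCont x t"
    using x(1) has_vector_derivative_continuous by blast
  then have "\<forall>\<^sub>F s in nhds t. x s \<in> ?C"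
    using open_chart[OF A c] x(2) by (simp add: continuous_within tendsto_at_iff_tendsto_nhds topological_tendstoD)
  then have "\<forall>\<^sub>F s in nhds t. (\<Sum>i\<in>Basis. \<Sum>j\<in>Basis. (a s \<bullet> i) * (b s \<bullet> j) * ?G (x s) i j) = ?G (x s) (a s) (b s)"
    by eventually_elim (rule bilinear_expand[OF metric_in_bilinear, symmetric])
  from DERIV_cong_ev[OF refl this refl] 1 show ?thesis by simp
qed

text \<open>The Koszul formula bounds \<open>\<Gamma>(u, u)\<close> after inverting the metric, uniformly near a point.\<close>

lemma levi_civita_bound:
  assumes x0: "x0 \<in> snd c ` fst c"
  shows "\<exists>K N. open N \<and> x0 \<in> N \<and> N \<subseteq> snd c ` fst c \<and>
    (\<forall>x\<in>N. \<forall>u. norm (levi_civita A g c x u u) \<le> K * norm u ^ 2)"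
proof -
  let ?G = "metric_in A g c"
  let ?C = "snd c ` fst c"
  define D where "D x w u v = frechet_derivative (\<lambda>y. ?G y u v) (at x) w" for x w u v
  note oC = open_chart[OF A c]
  \<comment> \<open>This is the metric at \<open>x0\<close> as a linear endomorphism. Nondegeneracy
    makes it injective, hence bounded below by some \<open>B > 0\<close>, which stands in for an
    explicit inverse matrix.\<close>
  define R where "R u = (\<Sum>i\<in>Basis. ?G x0 u i *\<^sub>R i)" for u
  have Ri: "R u \<bullet> i = ?G x0 u i" if "i \<in> Basis" for u i
    using that by (simp add: R_def)
  have "linear R"
    by (rule linearI) (auto intro!: euclidean_eqI[where 'a='e]
        simp: Ri inner_add_left linear_add[OF metric_in_linear1[OF x0]] linear_cmul[OF metric_in_linear1[OF x0]])
  moreover have "inj R"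
  proof (subst linear_injective_0[OF \<open>linear R\<close>], intro allI impI)
    fix u assume "R u = 0"
    then have "?G x0 u i = 0" if "i \<in> Basis" for i
      using Ri[OF that, of u] by simp
    then have "?G x0 u v = 0" for v
      using linear_eq_stdbasis[OF metric_in_linear2[OF x0, of u] linear_zero] by metis
    then show "u = 0" by (rule metric_in_nondeg[OF x0])
  qed
  ultimately obtain B where B: "B > 0" "\<And>u. B * norm u \<le> norm (R u)"
    using linear_inj_bounded_below_pos by blast
  define n where "n x = (\<Sum>i\<in>Basis. \<Sum>j\<in>Basis. \<bar>?G x j i - ?G x0 j i\<bar>)" for x
  define S where "S x = (\<Sum>l\<in>Basis. \<Sum>j\<in>Basis. \<Sum>k\<in>Basis. \<bar>D x l j k\<bar>)" for x
  have cn: "continuous_on ?C n"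
    unfolding n_def by (intro continuous_intros smooth_on_continuous[OF metric_in_smooth])
  have cS: "continuous_on ?C S"
    unfolding S_def D_def by (intro continuous_intros smooth_on_continuous[OF smooth_on_deriv[OF metric_in_smooth]])
  \<comment> \<open>\<open>n x < B/2\<close> ensures that replacing the metric at \<open>x\<close>
    by the one at \<open>x0\<close> costs at most half of the lower bound \<open>B\<close>. The
    condition on \<open>S\<close> bounds all first derivatives of the metric. \<open>K\<close> below
    results from solving \<open>B/2 * norm z \<le> DIM('e) * (2 * (S x0 + 1) * norm u ^ 2)\<close>
    for \<open>norm z\<close>.\<close>
  define N where "N = {x \<in> {x \<in> ?C. n x \<in> {..<B/2}}. S x \<in> {..<S x0 + 1}}"
  have o1: "open {x \<in> ?C. n x \<in> {..<B/2}}"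
    by (rule open_preimage[OF oC cn open_lessThan])
  have oN: "open N"
    unfolding N_def by (rule open_preimage[OF o1 continuous_on_subset[OF cS] open_lessThan]) auto
  have x0N: "x0 \<in> N" using x0 B(1) by (simp add: N_def n_def)
  define K where "K = 2 / B * (DIM('e) * (2 * (S x0 + 1)))"
  have "norm (levi_civita A g c x u u) \<le> K * norm u ^ 2" if xN: "x \<in> N" for x u
  proof -
    have x: "x \<in> ?C" "n x < B/2" "S x < S x0 + 1" using xN by (auto simp: N_def)
    let ?z = "levi_civita A g c x u u"
    have Dbound: "\<bar>D x w a b\<bar> \<le> S x * (norm w * norm a * norm b)" for w a b
    proof -
      have lw: "linear (\<lambda>w. D x w a b)"
        unfolding D_def by (rule linear_frechet_derivative[OF smooth_on_differentiable[OF metric_in_smooth x(1)]])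
      have "D x w a b = D x (\<Sum>l\<in>Basis. (w \<bullet> l) *\<^sub>R l) a b"
        by (simp add: euclidean_representation)
      also have "\<dots> = (\<Sum>l\<in>Basis. (w \<bullet> l) * D x l a b)"
        by (simp only: linear_sum[OF lw] linear_cmul[OF lw] real_scaleR_def)
      also have "\<dots> = (\<Sum>l\<in>Basis. \<Sum>j\<in>Basis. \<Sum>k\<in>Basis. (w \<bullet> l) * ((a \<bullet> j) * (b \<bullet> k) * D x l j k))"
      proof (rule sum.cong[OF refl])
        fix l
        show "(w \<bullet> l) * D x l a b = (\<Sum>j\<in>Basis. \<Sum>k\<in>Basis. (w \<bullet> l) * ((a \<bullet> j) * (b \<bullet> k) * D x l j k))"
          using bilinear_expand[OF metric_in_deriv_bilinear[OF x(1), of l], of a b]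
          by (simp add: D_def sum_distrib_left)
      qed
      finally have "\<bar>D x w a b\<bar> \<le> (\<Sum>l\<in>Basis. \<Sum>j\<in>Basis. \<Sum>k\<in>Basis. \<bar>(w \<bullet> l) * ((a \<bullet> j) * (b \<bullet> k) * D x l j k)\<bar>)"
        by (auto intro!: order_trans[OF sum_abs] sum_mono)
      also have "\<dots> \<le> (\<Sum>l\<in>Basis. \<Sum>j\<in>Basis. \<Sum>k\<in>Basis. \<bar>D x l j k\<bar> * (norm w * norm a * norm b))"
      proof (intro sum_mono)
        fix l j k :: 'e assume "l \<in> Basis" "j \<in> Basis" "k \<in> Basis"
        then have "\<bar>w \<bullet> l\<bar> * (\<bar>a \<bullet> j\<bar> * \<bar>b \<bullet> k\<bar>) \<le> norm w * (norm a * norm b)"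
          by (intro mult_mono Basis_le_norm) auto
        then have "\<bar>w \<bullet> l\<bar> * (\<bar>a \<bullet> j\<bar> * \<bar>b \<bullet> k\<bar>) * \<bar>D x l j k\<bar> \<le> norm w * (norm a * norm b) * \<bar>D x l j k\<bar>"
          by (rule mult_right_mono) simp
        then show "\<bar>(w \<bullet> l) * ((a \<bullet> j) * (b \<bullet> k) * D x l j k)\<bar> \<le> \<bar>D x l j k\<bar> * (norm w * norm a * norm b)"
          by (simp add: abs_mult algebra_simps)
      qed
      also have "\<dots> = S x * (norm w * norm a * norm b)"
        by (simp add: S_def sum_distrib_right)
      finally show ?thesis .
    qed
    have Gz: "\<bar>?G x ?z i\<bar> \<le> 2 * (S x0 + 1) * norm u ^ 2" if i: "i \<in> Basis" for i
    proof -
      let ?\<Gamma> = "levi_civita A g c x"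
      have lc: "?\<Gamma> a b = ?\<Gamma> b a" "D x w a b = ?G x (?\<Gamma> w a) b + ?G x a (?\<Gamma> w b)" for a b w
        using levi_civita_in[OF x(1)] unfolding is_levi_civita_def D_def by blast+
      \<comment> \<open>The Koszul formula on the diagonal: expand \<open>D x u u i\<close>, and
        note that \<open>D x i u u\<close> is twice \<open>G(u, \<Gamma>(u, i))\<close> by the
        symmetry of \<open>\<Gamma>\<close> and of the metric.\<close>
      have "?G x ?z i = D x u u i - D x i u u / 2"
        using lc(1)[of u i] metric_in_sym[OF x(1), of u "?\<Gamma> i u"] by (simp add: lc(2))
      then have "\<bar>?G x ?z i\<bar> \<le> \<bar>D x u u i\<bar> + \<bar>D x i u u\<bar>" by linarith
      also have "\<dots> \<le> S x * (norm u * norm u * norm i) + S x * (norm i * norm u * norm u)"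
        by (intro add_mono Dbound)
      also have "\<dots> = 2 * S x * norm u ^ 2"
        using i by (simp add: power2_eq_square)
      also have "\<dots> \<le> 2 * (S x0 + 1) * norm u ^ 2"
        using x(3) by (intro mult_right_mono) auto
      finally show ?thesis .
    qed
    have "B * norm ?z \<le> norm (R ?z)" by (rule B)
    also have "\<dots> \<le> (\<Sum>i\<in>Basis. \<bar>R ?z \<bullet> i\<bar>)" by (rule norm_le_l1)
    also have "\<dots> \<le> (\<Sum>i\<in>Basis. 2 * (S x0 + 1) * norm u ^ 2 + (\<Sum>j\<in>Basis. norm ?z * \<bar>?G x j i - ?G x0 j i\<bar>))"
    proof (rule sum_mono)
      fix i :: 'e assume i: "i \<in> Basis"
      have e: "?G y ?z i = (\<Sum>j\<in>Basis. (?z \<bullet> j) * ?G y j i)" if "y \<in> ?C" for y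
      proof -
        note l = metric_in_linear1[OF that, of i]
        have "?G y ?z i = ?G y (\<Sum>j\<in>Basis. (?z \<bullet> j) *\<^sub>R j) i" by (simp only: euclidean_representation)
        then show ?thesis by (simp only: linear_sum[OF l] linear_cmul[OF l] real_scaleR_def)
      qed
      have "\<bar>?G x ?z i - ?G x0 ?z i\<bar> = \<bar>\<Sum>j\<in>Basis. (?z \<bullet> j) * (?G x j i - ?G x0 j i)\<bar>"
        by (simp add: e[OF x(1)] e[OF x0] sum_subtractf algebra_simps)
      also have "\<dots> \<le> (\<Sum>j\<in>Basis. norm ?z * \<bar>?G x j i - ?G x0 j i\<bar>)"
        by (auto intro!: order_trans[OF sum_abs] sum_mono mult_right_mono Basis_le_norm simp: abs_mult)
      finally show "\<bar>R ?z \<bullet> i\<bar> \<le> 2 * (S x0 + 1) * norm u ^ 2 + (\<Sum>j\<in>Basis. norm ?z * \<bar>?G x j i - ?G x0 j i\<bar>)"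
        using Gz[OF i] Ri[OF i, of ?z] by linarith
    qed
    also have "\<dots> = DIM('e) * (2 * (S x0 + 1) * norm u ^ 2) + norm ?z * n x"
      by (simp add: sum.distrib n_def sum_distrib_left)
    also have "\<dots> \<le> DIM('e) * (2 * (S x0 + 1) * norm u ^ 2) + norm ?z * (B/2)"
      using x(2) by (intro add_left_mono mult_left_mono) auto
    finally have "B / 2 * norm ?z \<le> DIM('e) * (2 * (S x0 + 1) * norm u ^ 2)" by (simp add: algebra_simps)
    then show ?thesis
      using B(1) by (simp add: K_def field_simps)
  qed
  moreover have "N \<subseteq> ?C" by (auto simp: N_def)
  ultimately show ?thesis using oN x0N by blast
qed

end

section \<open>Geodesics with vanishing initial velocity\<close>

text \<open>A self-improving bound: on a ball of radius \<open>r\<close> with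
  \<open>\<bar>K\<bar> * r \<le> 1/2\<close>, the mean value inequality bounds the maximum of
  \<open>norm u\<close> by half of itself, so this maximum is 0.\<close>

lemma linear_growth_vanishes:
  fixes u :: "real \<Rightarrow> 'b::euclidean_space"
  assumes N: "open N" "t0 \<in> N" and u0: "u t0 = 0"
    and d: "\<And>t. t \<in> N \<Longrightarrow> (u has_vector_derivative u' t) (at t)"
    and bd: "\<And>t. t \<in> N \<Longrightarrow> norm (u' t) \<le> K * norm (u t)"
  shows "\<exists>r>0. cball t0 r \<subseteq> N \<and> (\<forall>t\<in>cball t0 r. u t = 0)"
proof -
  obtain e where e: "e > 0" "cball t0 e \<subseteq> N" using N open_contains_cball by blast
  define r where "r = min e (1 / (2 * (\<bar>K\<bar> + 1)))"
  have r: "r > 0" "cball t0 r \<subseteq> N" using e by (auto simp: r_def)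
  have "\<bar>K\<bar> * r \<le> \<bar>K\<bar> * (1 / (2 * (\<bar>K\<bar> + 1)))"
    by (intro mult_left_mono) (auto simp: r_def)
  also have "\<dots> \<le> 1 / 2" by (simp add: field_simps)
  finally have rK: "\<bar>K\<bar> * r \<le> 1 / 2" .
  have cont: "continuous_on (cball t0 r) (\<lambda>t. norm (u t))"
    using r d by (intro continuous_on_norm continuous_at_imp_continuous_on)
      (metis has_vector_derivative_continuous subsetD)
  obtain s where s: "s \<in> cball t0 r" "\<And>t. t \<in> cball t0 r \<Longrightarrow> norm (u t) \<le> norm (u s)"
    using continuous_attains_sup[OF compact_cball _ cont] r(1) by (metis centre_in_cball empty_iff less_le)
  have "norm (u s - u t0) \<le> (\<bar>K\<bar> * norm (u s)) * norm (s - t0)"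
  proof (rule differentiable_bound[OF convex_cball[of t0 r]])
    fix t assume t: "t \<in> cball t0 r"
    then have tN: "t \<in> N" using r by blast
    show "(u has_derivative (\<lambda>h. h *\<^sub>R u' t)) (at t within cball t0 r)"
      using d[OF tN] has_derivative_at_withinI unfolding has_vector_derivative_def by blast
    have "norm (u' t) \<le> \<bar>K\<bar> * norm (u t)"
      using bd[OF tN] by (smt (verit) mult_right_mono norm_ge_zero)
    also have "\<dots> \<le> \<bar>K\<bar> * norm (u s)" using s(2)[OF t] by (rule mult_left_mono) simp
    finally show "onorm (\<lambda>h. h *\<^sub>R u' t) \<le> \<bar>K\<bar> * norm (u s)"
      by (intro onorm_le) (simp add: mult.commute mult_left_mono)
  qed (use s r in auto)
  also have "\<dots> \<le> (\<bar>K\<bar> * norm (u s)) * r"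
    using s(1) by (intro mult_left_mono) (auto simp: dist_norm norm_minus_commute)
  also have "\<dots> \<le> norm (u s) * (1/2)"
    using mult_left_mono[OF rK norm_ge_zero[of "u s"]] by (simp add: algebra_simps)
  finally have "norm (u s) = 0" using u0 by simp
  then have "u t = 0" if "t \<in> cball t0 r" for t using s(2)[OF that] by simp
  then show ?thesis using r by blast
qed

text \<open>In a chart the coordinate velocity satisfies \<open>u' = - \<Gamma>(u, u)\<close>. Near
  a zero of \<open>u\<close> the quadratic bound on \<open>\<Gamma>\<close> implies linear growth,
  so the zero spreads to a neighborhood; nonvanishing spreads by continuity. Since \<open>J\<close>
  is connected, the velocity vanishes everywhere.\<close>

lemma geodesic_const:
  fixes A :: "('a, 'e::euclidean_space) chart set"
  assumes A: "is_atlas A" and g: "lorentz_metric A g" and geo: "geodesic A g J \<gamma>"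
    and t: "0 \<in> J" "t \<in> J" and v0: "velocity A \<gamma> 0 = 0"
  shows "\<gamma> t = \<gamma> 0"
proof -
  have J: "open J" "connected J" and \<gamma>: "smooth_map euclid J A \<gamma>"
    using geo is_interval_connected by (auto simp: geodesic_def)
  have loc: "\<exists>c N. c \<in> A \<and> open N \<and> t0 \<in> N \<and> N \<subseteq> J \<and> \<gamma> ` N \<subseteq> fst c \<and> smooth_on N (\<lambda>s. snd c (\<gamma> s)) \<and>
     (\<forall>s\<in>N. comps A c (\<gamma> s) (velocity A \<gamma> s) = vector_derivative (\<lambda>s. snd c (\<gamma> s)) (at s)) \<and>
     (\<forall>s\<in>N. ((\<lambda>s. vector_derivative (\<lambda>s. snd c (\<gamma> s)) (at s)) has_vector_derivative
        - levi_civita A g c (snd c (\<gamma> s)) (vector_derivative (\<lambda>s. snd c (\<gamma> s)) (at s))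
            (vector_derivative (\<lambda>s. snd c (\<gamma> s)) (at s))) (at s))"
    if t0: "t0 \<in> J" for t0
  proof -
    have "\<gamma> t0 \<in> pts A" using smooth_map_image_pts[OF \<gamma>] t0 by blast
    then obtain c where c: "c \<in> A" "\<gamma> t0 \<in> fst c" by (auto simp: pts_def)
    obtain N where N: "open N" "t0 \<in> N" "N \<subseteq> J" "\<gamma> ` N \<subseteq> fst c" "smooth_on N (\<lambda>s. snd c (\<gamma> s))"
      using smooth_map_euclidD[OF A \<gamma> J(1) t0 c] by blast
    define x where "x s = snd c (\<gamma> s)" for s
    define u where "u s = vector_derivative x (at s)" for s
    have cu: "comps A c (\<gamma> s) (velocity A \<gamma> s) = u s" if "s \<in> N" for s
      unfolding u_def x_def using comps_velocity[OF A \<gamma> J(1) _ c(1), of s] N that by blast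
    have du: "(u has_vector_derivative - levi_civita A g c (x s) (u s) (u s)) (at s)" if s: "s \<in> N" for s
    proof -
      have x: "smooth_on N x" using N(5) by (simp add: x_def[abs_def])
      have eq: "frechet_derivative x (at s) 1 = u s" if "s \<in> N" for s
        unfolding u_def using frechet_derivative_eq_vector_derivative[OF smooth_on_differentiable[OF x that]] by simp
      have "smooth_on N u"
        by (rule smooth_on_cong[OF N(1) eq smooth_on_deriv[OF x]])
      then have "(u has_vector_derivative vector_derivative u (at s)) (at s)"
        using smooth_on_differentiable s vector_derivative_works by blast
      moreover have "vector_derivative (\<lambda>s. comps A c (\<gamma> s) (velocity A \<gamma> s)) (at s) = vector_derivative u (at s)"
        by (rule vector_derivative_cong_eq) (use N(1) s cu in \<open>auto simp: eventually_nhds\<close>)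
      moreover have "cov_deriv_in A g c \<gamma> (velocity A \<gamma>) s = 0"
        using geo c(1) N s unfolding geodesic_def by blast
      ultimately show ?thesis
        using cu[OF s] by (simp add: cov_deriv_in_def x_def add_eq_0_iff)
    qed
    show ?thesis
      using c(1) N cu du unfolding u_def x_def[abs_def] by (intro exI[of _ c] exI[of _ N]) blast
  qed
  have z: "velocity A \<gamma> s = 0 \<longleftrightarrow> velocity A \<gamma> 0 = 0" if "s \<in> J" for s
  proof (rule connected_local_const[OF J(2) that t(1), where f="\<lambda>s. velocity A \<gamma> s = 0"], intro ballI)
    fix t0 assume t0: "t0 \<in> J"
    obtain c N where c: "c \<in> A" and N: "open N" "t0 \<in> N" "N \<subseteq> J" "\<gamma> ` N \<subseteq> fst c"
      and sm: "smooth_on N (\<lambda>s. snd c (\<gamma> s))"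
      and cu: "\<forall>s\<in>N. comps A c (\<gamma> s) (velocity A \<gamma> s) = vector_derivative (\<lambda>s. snd c (\<gamma> s)) (at s)"
      and du: "\<forall>s\<in>N. ((\<lambda>s. vector_derivative (\<lambda>s. snd c (\<gamma> s)) (at s)) has_vector_derivative
        - levi_civita A g c (snd c (\<gamma> s)) (vector_derivative (\<lambda>s. snd c (\<gamma> s)) (at s))
            (vector_derivative (\<lambda>s. snd c (\<gamma> s)) (at s))) (at s)"
      using loc[OF t0] by blast
    define x where "x = (\<lambda>s. snd c (\<gamma> s))"
    define u where "u = (\<lambda>s. vector_derivative x (at s))"
    have du': "(u has_vector_derivative - levi_civita A g c (x s) (u s) (u s)) (at s)" if "s \<in> N" for s
      using du that unfolding x_def u_def by blast
    have iff: "velocity A \<gamma> s = 0 \<longleftrightarrow> u s = 0" if "s \<in> N" for s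
    proof -
      have "\<gamma> s \<in> fst c" using N that by blast
      moreover have "comps A c (\<gamma> s) (velocity A \<gamma> s) = u s"
        using cu that unfolding u_def x_def by blast
      ultimately show ?thesis
        using comps_inj[OF A c, of "\<gamma> s" "velocity A \<gamma> s" 0] linear_0[OF linear_comps[OF A c]] by metis
    qed
    have contu: "continuous_on N u"
      by (intro continuous_at_imp_continuous_on ballI has_vector_derivative_continuous[OF du'])
    have "\<exists>M. open M \<and> t0 \<in> M \<and> M \<subseteq> N \<and> (\<forall>s\<in>M. (u s = 0) = (u t0 = 0))"
    proof (cases "u t0 = 0")
      case False
      have "open {s \<in> N. u s \<in> - {0}}" by (rule open_preimage[OF N(1) contu]) auto
      moreover have "t0 \<in> {s \<in> N. u s \<in> - {0}}" using False N(2) by simp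
      ultimately show ?thesis using False by blast
    next
      case True
      have "x t0 \<in> snd c ` fst c" using N by (auto simp: x_def)
      from levi_civita_bound[OF A g c this] obtain K X where X: "open X" "x t0 \<in> X"
          "\<forall>y\<in>X. \<forall>v. norm (levi_civita A g c y v v) \<le> K * norm v ^ 2"
        by (elim exE conjE)
      \<comment> \<open>The condition \<open>norm (u s) < 1\<close> weakens the quadratic bound to
        the linear one that \<open>linear_growth_vanishes\<close> asks for.\<close>
      define M where "M = {s \<in> {s \<in> N. x s \<in> X}. u s \<in> ball 0 1}"
      have "continuous_on N x" using smooth_on_continuous[OF sm] by (simp add: x_def)
      then have o: "open {s \<in> N. x s \<in> X}" using open_preimage N(1) X(1) by blast
      have oM: "open M"
        unfolding M_def by (rule open_preimage[OF o continuous_on_subset[OF contu]]) auto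
      have "\<exists>r>0. cball t0 r \<subseteq> M \<and> (\<forall>t\<in>cball t0 r. u t = 0)"
      proof (rule linear_growth_vanishes[OF oM _ True du'])
        show "t0 \<in> M" using True X N by (simp add: M_def)
        show "norm (- levi_civita A g c (x s) (u s) (u s)) \<le> \<bar>K\<bar> * norm (u s)" if s: "s \<in> M" for s
        proof -
          have "norm (levi_civita A g c (x s) (u s) (u s)) \<le> K * norm (u s) ^ 2"
            using X(3) s by (auto simp: M_def)
          also have "\<dots> \<le> \<bar>K\<bar> * norm (u s) ^ 2" by (rule mult_right_mono) auto
          also have "\<dots> \<le> \<bar>K\<bar> * norm (u s)"
            using s by (intro mult_left_mono) (auto simp: M_def power2_eq_square mult_left_le)
          finally show ?thesis by simp
        qed
      qed (auto simp: M_def)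
      then obtain r where r: "r > 0" "cball t0 r \<subseteq> M" "\<forall>t\<in>cball t0 r. u t = 0" by blast
      have "ball t0 r \<subseteq> N" using r(2) ball_subset_cball[of t0 r] unfolding M_def by blast
      moreover have "u s = 0" if "s \<in> ball t0 r" for s using r(3) that by simp
      ultimately show ?thesis
        using True r(1) by (intro exI[of _ "ball t0 r"] conjI ballI) simp_all
    qed
    then obtain M where M: "open M" "t0 \<in> M" "M \<subseteq> N" "\<forall>s\<in>M. (u s = 0) = (u t0 = 0)" by blast
    have eqM: "(velocity A \<gamma> t0 = 0) = (velocity A \<gamma> s = 0)" if "s \<in> M" for s
      using M(2-4) iff that by blast
    show "\<forall>\<^sub>F s in at t0 within J. (velocity A \<gamma> t0 = 0) = (velocity A \<gamma> s = 0)"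
      unfolding eventually_at_topological using M(1,2) eqM by blast
  qed
  \<comment> \<open>Connectedness is used a second time: vanishing velocity makes the position
    locally constant in a chart, hence constant on \<open>J\<close>.\<close>
  show ?thesis
  proof (rule connected_local_const[OF J(2) t(2,1), where f=\<gamma>], intro ballI)
    fix t0 assume t0: "t0 \<in> J"
    obtain c N where c: "c \<in> A" and N: "open N" "t0 \<in> N" "N \<subseteq> J" "\<gamma> ` N \<subseteq> fst c"
      and sm: "smooth_on N (\<lambda>s. snd c (\<gamma> s))"
      and cu: "\<forall>s\<in>N. comps A c (\<gamma> s) (velocity A \<gamma> s) = vector_derivative (\<lambda>s. snd c (\<gamma> s)) (at s)"
      using loc[OF t0] by blast
    obtain r where r: "r > 0" "ball t0 r \<subseteq> N" using N openE by blast
    have e: "snd c (\<gamma> s) = snd c (\<gamma> t0)" if s: "s \<in> ball t0 r" for s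
    proof (rule has_derivative_zero_unique[of "ball t0 r" "\<lambda>s. snd c (\<gamma> s)" s t0])
      fix s assume "s \<in> ball t0 r"
      then have s: "s \<in> N" using r by blast
      then have "velocity A \<gamma> s = 0" using z N v0 by blast
      moreover have "\<gamma> s \<in> fst c" using N s by blast
      ultimately have v: "vector_derivative (\<lambda>s. snd c (\<gamma> s)) (at s) = 0"
        using cu s linear_0[OF linear_comps[OF A c]] by metis
      have "((\<lambda>s. snd c (\<gamma> s)) has_derivative (\<lambda>h. 0)) (at s)"
        using smooth_on_differentiable[OF sm s] v
        by (simp add: vector_derivative_works has_vector_derivative_def)
      then show "((\<lambda>s. snd c (\<gamma> s)) has_derivative (\<lambda>h. 0)) (at s within ball t0 r)"
        by (rule has_derivative_at_withinI)
    qed (use s r in auto)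
    have m: "\<gamma> s \<in> fst c" if "s \<in> ball t0 r" for s
      using that r(2) N(4) by blast
    have t0r: "t0 \<in> ball t0 r" using r(1) by simp
    have "\<gamma> t0 = \<gamma> s" if s: "s \<in> ball t0 r" for s
      using cinv_chart[OF A c m[OF s]] cinv_chart[OF A c m[OF t0r]] e[OF s] by metis
    then show "\<forall>\<^sub>F s in at t0 within J. \<gamma> t0 = \<gamma> s"
      unfolding eventually_at_topological using t0r by (intro exI[of _ "ball t0 r"]) simp
  qed
qed

lemma exp_map_zero:
  assumes A: "is_atlas A" and g: "lorentz_metric A g" and p: "(p, 0) \<in> exp_dom A g"
  shows "exp_map A g (p, 0) = p"
proof -
  obtain q where q: "exp_rel A g (p, 0) q" using p by (auto simp: exp_dom_def)
  have eq: "q = p" if "exp_rel A g (p, 0) q" for q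
  proof -
    obtain J \<gamma> where \<gamma>: "geodesic A g J \<gamma>" "{0..1} \<subseteq> J" "\<gamma> 0 = p" "velocity A \<gamma> 0 = 0" "\<gamma> 1 = q"
      using \<open>exp_rel A g (p, 0) q\<close> by (auto simp: exp_rel_def)
    have "0 \<in> J" "1 \<in> J" using \<gamma>(2) by (auto simp: subset_iff)
    then show "q = p" using geodesic_const[OF A g \<gamma>(1) _ _ \<gamma>(4), of 1] \<gamma>(3,5) by simp
  qed
  show ?thesis
    unfolding exp_map_def using q eq by (intro the_equality) auto
qed

section \<open>The null hypersurface\<close>

locale null_hypersurface =
  fixes A :: "('a, 'e::euclidean_space) chart set" and g :: "('a, 'e) metric"
    and S :: "'a set" and \<xi> :: "'a \<Rightarrow> 'e" and \<V> :: "('a \<times> 'e) set"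
  assumes atlas: "is_atlas A" and lorentz: "lorentz_metric A g" and S_pts: "S \<subseteq> pts A"
    and field: "lightlike_normal_field A g S \<xi>"
    and nbhd: "normal_exp_nbhd A g S \<V>"
begin

abbreviation TA where "TA \<equiv> tangent_bundle A"
abbreviation \<D> where "\<D> \<equiv> dom_Phi S \<xi> \<V>"
abbreviation \<Phi> where "\<Phi> p t \<equiv> Phi A g \<xi> (p, t)"
abbreviation \<Sigma> where "\<Sigma> \<equiv> hypersurf A g S \<xi> \<V>"
abbreviation U where "U \<equiv> geo_ext A g S \<xi> \<V>"
abbreviation F where "F \<equiv> proj A g S \<xi> \<V>"

section \<open>The map \<open>\<Phi>\<close>, its inverse and the projection\<close>

lemma tatlas: "is_atlas TA"
  by (rule is_atlas_tangent_bundle[OF atlas])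

lemma dom_iff: "(p, t) \<in> \<D> \<longleftrightarrow> p \<in> S \<and> (p, t *\<^sub>R \<xi> p) \<in> \<V>"
  by (simp add: dom_Phi_def)

lemma domD: "(p, t) \<in> \<D> \<Longrightarrow> p \<in> S"
  by (simp add: dom_iff)

lemma Phi_eq: "\<Phi> p t = exp_map A g (p, t *\<^sub>R \<xi> p)"
  by (simp add: Phi_def)

lemma xi_nonzero: "p \<in> S \<Longrightarrow> \<xi> p \<noteq> 0"
  using field by (auto simp: lightlike_normal_field_def)

lemma Phi_zero: "p \<in> S \<Longrightarrow> \<Phi> p 0 = p"
  using nbhd exp_map_zero[OF atlas lorentz, of p] by (auto simp: Phi_eq normal_exp_nbhd_def)

lemma dom_star: "(p, t) \<in> \<D> \<Longrightarrow> 0 \<le> s \<Longrightarrow> s \<le> 1 \<Longrightarrow> (p, s * t) \<in> \<D>"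
  using nbhd by (fastforce simp: dom_iff normal_exp_nbhd_def simp flip: scaleR_scaleR)

lemma exp_diffeo:
  obtains W where "openin (mtop A) W" "bij_betw (exp_map A g) \<V> W"
    "smooth_map TA \<V> A (exp_map A g)" "smooth_map A W TA (inv_into \<V> (exp_map A g))"
  using nbhd unfolding normal_exp_nbhd_def diffeo_def by blast

lemma exp_inj: "inj_on (exp_map A g) \<V>"
  by (rule exp_diffeo) (simp add: bij_betw_def)

text \<open>Injectivity of the exponential map on \<open>\<V>\<close> identifies the base points and
  the vectors \<open>t *\<^sub>R \<xi> p\<close>; the parameters then agree because
  \<open>\<xi> p\<close> is nonzero.\<close>

lemma Phi_inj: "inj_on (Phi A g \<xi>) \<D>"
proof (rule inj_onI, clarify)
  fix p t q s assume d: "(p, t) \<in> \<D>" "(q, s) \<in> \<D>" and "\<Phi> p t = \<Phi> q s"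
  then have "(p, t *\<^sub>R \<xi> p) = (q, s *\<^sub>R \<xi> q)"
    using exp_inj unfolding Phi_eq inj_on_def dom_iff by blast
  then show "p = q \<and> t = s"
    using xi_nonzero[OF domD[OF d(1)]] by auto
qed

lemma Phi_mem: "(p, t) \<in> \<D> \<Longrightarrow> \<Phi> p t \<in> \<Sigma>"
  by (auto simp: hypersurf_def)

lemma hypersurfE:
  assumes "q \<in> \<Sigma>"
  obtains p t where "(p, t) \<in> \<D>" "q = \<Phi> p t"
  using assms by (auto simp: hypersurf_def)

lemma Phi_inv_Phi: "(p, t) \<in> \<D> \<Longrightarrow> Phi_inv A g S \<xi> \<V> (\<Phi> p t) = (p, t)"
  unfolding Phi_inv_def by (rule inv_into_f_f[OF Phi_inj])

lemma proj_Phi: "(p, t) \<in> \<D> \<Longrightarrow> F (\<Phi> p t) = p"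
  by (simp add: proj_def Phi_inv_Phi)

lemma geo_ext_Phi: "(p, t) \<in> \<D> \<Longrightarrow> U (\<Phi> p t) = velocity A (\<lambda>s. \<Phi> p s) t"
  by (simp add: geo_ext_def Phi_inv_Phi)

lemma exp_inv_Phi: "(p, t) \<in> \<D> \<Longrightarrow> inv_into \<V> (exp_map A g) (\<Phi> p t) = (p, t *\<^sub>R \<xi> p)"
  unfolding Phi_eq by (rule inv_into_f_f[OF exp_inj]) (simp add: dom_iff)

lemma smooth_exp: "smooth_map TA \<V> A (exp_map A g)"
  by (rule exp_diffeo)

lemma smooth_exp_inv: "smooth_map A \<Sigma> TA (inv_into \<V> (exp_map A g))"
proof (rule exp_diffeo)
  fix W assume W: "bij_betw (exp_map A g) \<V> W" "smooth_map A W TA (inv_into \<V> (exp_map A g))"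
  have "\<Sigma> \<subseteq> W"
    using bij_betw_imp_surj_on[OF W(1)] by (auto simp: hypersurf_def Phi_eq dom_iff)
  then show ?thesis by (rule smooth_map_subset[OF W(2)])
qed

text \<open>\<open>F\<close> is the inverse of the normal exponential map followed by the bundle
  projection, and both are smooth.\<close>

lemma smooth_proj: "smooth_map A \<Sigma> A F"
proof (rule smooth_map_cong)
  show "smooth_map A \<Sigma> A (\<lambda>q. fst (inv_into \<V> (exp_map A g) q))"
    by (rule smooth_map_compose[OF atlas tatlas atlas smooth_exp_inv smooth_map_fst[OF atlas]
          smooth_map_image_pts[OF smooth_exp_inv]])
  show "fst (inv_into \<V> (exp_map A g) q) = F q" if "q \<in> \<Sigma>" for q
    using that by (rule hypersurfE) (simp add: exp_inv_Phi proj_Phi)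
qed

lemma proj_image: "F ` \<Sigma> \<subseteq> S"
  using proj_Phi domD by (auto elim!: hypersurfE)

lemma smooth_xi: "smooth_map A S TA (\<lambda>p. (p, \<xi> p))"
  using field by (simp add: lightlike_normal_field_def smooth_field_def)

section \<open>Smoothness of \<open>\<Phi>\<close> along curves in \<open>S\<close>\<close>

lemma normal_xi: "p \<in> S \<Longrightarrow> (p, t *\<^sub>R \<xi> p) \<in> normal_bundle A g S"
proof -
  assume p: "p \<in> S"
  then have "lorentz_product (g p)"
    using lorentz S_pts by (auto simp: lorentz_metric_def)
  then have "linear (g p u)" for u
    by (simp add: lorentz_product_def bilinear_def)
  then show ?thesis
    using p field linear_cmul[of "g p _"] by (fastforce simp: normal_bundle_def lightlike_normal_field_def)
qed

text \<open>This is the lift of the surface \<open>(s, t) \<mapsto> \<Phi>(\<gamma>(s), t)\<close>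
  to the tangent bundle, before the exponential map is applied. Its fibre component in a chart is
  \<open>t\<close> times a smooth function of \<open>s\<close>.\<close>

lemma smooth_scaled_xi:
  fixes \<gamma> :: "real \<Rightarrow> 'a"
  assumes \<gamma>: "smooth_map euclid J A \<gamma>" "open J" "\<gamma> ` J \<subseteq> S"
  shows "smooth_map euclid (J \<times> (UNIV :: real set)) TA (\<lambda>(s, t). (\<gamma> s, t *\<^sub>R \<xi> (\<gamma> s)))"
proof (rule smooth_map_euclidI[OF tatlas])
  fix x assume x: "x \<in> J \<times> (UNIV :: real set)"
  have "fst x \<in> J" using x by auto
  then have "\<gamma> (fst x) \<in> pts A" using \<gamma>(3) S_pts by blast
  then obtain c where c: "c \<in> A" "\<gamma> (fst x) \<in> fst c" by (auto simp: pts_def)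
  have "smooth_map euclid J TA (\<lambda>s. (\<gamma> s, \<xi> (\<gamma> s)))"
    by (rule smooth_map_compose[OF is_atlas_euclid atlas tatlas \<gamma>(1) smooth_xi \<gamma>(3)])
  from smooth_map_euclidD[OF tatlas this \<gamma>(2) _ tchart_mem[OF c(1)], of "fst x"] obtain N
    where N: "open N" "fst x \<in> N" "N \<subseteq> J" "(\<lambda>s. (\<gamma> s, \<xi> (\<gamma> s))) ` N \<subseteq> fst (tchart A c)"
      and sm: "smooth_on N (\<lambda>s. snd (tchart A c) (\<gamma> s, \<xi> (\<gamma> s)))"
    using x c by auto
  have oN: "open (N \<times> (UNIV :: real set))" using N(1) by (simp add: open_Times)
  have Nc: "\<gamma> s \<in> fst c" if "s \<in> N" for s using N(4) that by auto
  have 1: "smooth_on N (\<lambda>s. snd c (\<gamma> s))" and 2: "smooth_on N (\<lambda>s. comps A c (\<gamma> s) (\<xi> (\<gamma> s)))"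
    using smooth_on_fst[OF sm N(1)] smooth_on_snd[OF sm N(1)] by simp_all
  have f: "smooth_on (N \<times> (UNIV :: real set)) fst" "smooth_on (N \<times> (UNIV :: real set)) snd"
    by (rule smooth_on_linear[OF bounded_linear_fst], rule smooth_on_linear[OF bounded_linear_snd])
  have im: "fst ` (N \<times> (UNIV :: real set)) \<subseteq> N" by auto
  have "smooth_on (N \<times> UNIV) (\<lambda>y. (snd c (\<gamma> (fst y)), snd y *\<^sub>R comps A c (\<gamma> (fst y)) (\<xi> (\<gamma> (fst y)))))"
    by (rule smooth_on_Pair[OF oN smooth_on_compose[OF N(1) oN 1 f(1) im]
          smooth_on_bilinear[OF bounded_bilinear_scaleR oN f(2) smooth_on_compose[OF N(1) oN 2 f(1) im]]])
  then have "smooth_on (N \<times> UNIV) (\<lambda>y. snd (tchart A c) ((\<lambda>(s, t). (\<gamma> s, t *\<^sub>R \<xi> (\<gamma> s))) y))"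
    by (rule smooth_on_cong[OF oN, rotated])
       (use Nc linear_cmul[OF linear_comps[OF atlas c(1)]] in auto)
  then show "\<exists>d\<in>TA. \<exists>M. open M \<and> x \<in> M \<and> (\<lambda>(s, t). (\<gamma> s, t *\<^sub>R \<xi> (\<gamma> s))) ` M \<subseteq> fst d \<and>
      smooth_on M (\<lambda>y. snd d ((\<lambda>(s, t). (\<gamma> s, t *\<^sub>R \<xi> (\<gamma> s))) y))"
    using N(2) Nc oN by (intro bexI[OF _ tchart_mem[OF c(1)]] exI[of _ "N \<times> UNIV"]) (auto simp: mem_Times_iff)
qed

text \<open>Both claims follow by composing the lift with the exponential map. They give a map on an
  open subset of the plane, the setting in which derivatives in \<open>s\<close> and
  \<open>t\<close> commute.\<close>

lemma smooth_Phi_surface: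
  fixes \<gamma> :: "real \<Rightarrow> 'a"
  assumes \<gamma>: "smooth_map euclid J A \<gamma>" "open J" "\<gamma> ` J \<subseteq> S"
  shows "open {(s, t). s \<in> J \<and> (\<gamma> s, t) \<in> \<D>}"
    and "smooth_map euclid {(s, t). s \<in> J \<and> (\<gamma> s, t) \<in> \<D>} A (\<lambda>(s, t). \<Phi> (\<gamma> s) t)"
proof -
  let ?h = "\<lambda>(s, t). (\<gamma> s, t *\<^sub>R \<xi> (\<gamma> s))"
  let ?O = "{(s, t). s \<in> J \<and> (\<gamma> s, t) \<in> \<D>}"
  note sm = smooth_scaled_xi[OF \<gamma>]
  \<comment> \<open>\<open>\<V>\<close> is open only relative to the normal bundle. As
    \<open>t *\<^sub>R \<xi> p\<close> is always normal, the lift lies in \<open>\<V>\<close>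
    exactly when it lies in the open set \<open>V\<close>, and its domain is open.\<close>
  obtain V where V: "openin (mtop TA) V" "\<V> = V \<inter> normal_bundle A g S"
    using nbhd unfolding normal_exp_nbhd_def openin_subtopology by blast
  have O_eq: "?O = {x \<in> J \<times> UNIV. ?h x \<in> V}"
  proof -
    have "(\<gamma> s, t) \<in> \<D> \<longleftrightarrow> (\<gamma> s, t *\<^sub>R \<xi> (\<gamma> s)) \<in> V" if "s \<in> J" for s t
    proof -
      have "\<gamma> s \<in> S" using \<gamma>(3) that by blast
      then show ?thesis using normal_xi[of "\<gamma> s" t] V(2) unfolding dom_iff by blast
    qed
    then show ?thesis by auto
  qed
  show "open ?O"
    unfolding O_eq by (rule smooth_map_preimage_open[OF tatlas sm open_Times[OF \<gamma>(2) open_UNIV] V(1)])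
  have "?O \<subseteq> J \<times> UNIV" by auto
  have "smooth_map euclid ?O A (\<lambda>x. exp_map A g (?h x))"
    by (rule smooth_map_compose[OF is_atlas_euclid tatlas atlas smooth_map_subset[OF sm] smooth_exp])
       (use dom_iff in auto)
  then show "smooth_map euclid ?O A (\<lambda>(s, t). \<Phi> (\<gamma> s) t)"
    by (rule smooth_map_cong) (auto simp: Phi_eq)
qed

lemma smooth_Phi_ray:
  assumes "p \<in> S"
  shows "open {t. (p, t) \<in> \<D>}" and "smooth_map euclid {t. (p, t) \<in> \<D>} A (\<lambda>t. \<Phi> p t)"
proof -
  \<comment> \<open>The constant curve at \<open>p\<close> is a curve in \<open>S\<close>, so the
    ray is the line \<open>s = 0\<close> of a surface already known to be smooth.\<close>
  have p: "smooth_map euclid (UNIV :: real set) A (\<lambda>s. p)"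
    using assms S_pts by (intro smooth_map_euclid_const[OF atlas]) auto
  note o = smooth_Phi_surface[OF p open_UNIV]
  have pair: "smooth_map euclid (UNIV :: real set) euclid (\<lambda>t. (0::real, t))"
    by (intro smooth_map_euclid_smooth_on open_UNIV smooth_on_linear bounded_linear_Pair
        bounded_linear_zero bounded_linear_ident)
  have "open {t \<in> UNIV. (0::real, t) \<in> {(s, t). s \<in> (UNIV :: real set) \<and> (p, t) \<in> \<D>}}"
    by (rule smooth_map_preimage_open[OF is_atlas_euclid pair open_UNIV])
       (use o(1) assms in \<open>simp add: openin_euclid\<close>)
  then show "open {t. (p, t) \<in> \<D>}" by simp
  have "smooth_map euclid {t. (p, t) \<in> \<D>} A (\<lambda>t. (\<lambda>(s, t). \<Phi> p t) (0::real, t))"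
    by (rule smooth_map_compose[OF is_atlas_euclid is_atlas_euclid atlas smooth_map_subset[OF pair] o(2)])
       (use assms in auto)
  then show "smooth_map euclid {t. (p, t) \<in> \<D>} A (\<lambda>t. \<Phi> p t)" by simp
qed

lemma smooth_Phi_slice:
  fixes \<gamma> :: "real \<Rightarrow> 'a"
  assumes \<gamma>: "smooth_map euclid J A \<gamma>" "open J" "\<gamma> ` J \<subseteq> S"
  shows "open {s \<in> J. (\<gamma> s, t) \<in> \<D>}" and "smooth_map euclid {s \<in> J. (\<gamma> s, t) \<in> \<D>} A (\<lambda>s. \<Phi> (\<gamma> s) t)"
proof -
  note o = smooth_Phi_surface[OF \<gamma>]
  have "smooth_on UNIV (\<lambda>s::real. (s, t))"
    by (intro smooth_on_Pair open_UNIV smooth_on_const smooth_on_linear bounded_linear_ident)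
  then have pair: "smooth_map euclid (UNIV :: real set) euclid (\<lambda>s. (s, t))"
    by (intro smooth_map_euclid_smooth_on open_UNIV)
  have "open {s \<in> UNIV. (s, t) \<in> {(s, t). s \<in> J \<and> (\<gamma> s, t) \<in> \<D>}}"
    by (rule smooth_map_preimage_open[OF is_atlas_euclid pair open_UNIV])
       (use o(1) in \<open>simp add: openin_euclid\<close>)
  then show "open {s \<in> J. (\<gamma> s, t) \<in> \<D>}" by simp
  have "smooth_map euclid {s \<in> J. (\<gamma> s, t) \<in> \<D>} A (\<lambda>s. (\<lambda>(s, t). \<Phi> (\<gamma> s) t) (s, t))"
    by (rule smooth_map_compose[OF is_atlas_euclid is_atlas_euclid atlas smooth_map_subset[OF pair] o(2)]) auto
  then show "smooth_map euclid {s \<in> J. (\<gamma> s, t) \<in> \<D>} A (\<lambda>s. \<Phi> (\<gamma> s) t)" by simp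
qed

lemma curve_through_Phi_slice:
  assumes \<gamma>: "curve_through A S p \<gamma>" and d: "(p, t) \<in> \<D>"
  shows "curve_through A \<Sigma> (\<Phi> p t) (\<lambda>s. \<Phi> (\<gamma> s) t)"
proof -
  obtain J where J: "smooth_map euclid J A \<gamma>" "open J" "0 \<in> J" "\<gamma> ` J \<subseteq> S" "\<gamma> 0 = p"
    using \<gamma> by (rule curve_throughE)
  show ?thesis
    by (rule curve_throughI[OF smooth_Phi_slice(2)[OF J(1,2,4)] smooth_Phi_slice(1)[OF J(1,2,4)]])
       (use J d Phi_mem in auto)
qed

lemma smooth_scaled_xi_ray:
  assumes "p \<in> S"
  shows "smooth_map euclid (UNIV :: real set) TA (\<lambda>r. (p, r *\<^sub>R \<xi> p))"
proof -
  have p: "smooth_map euclid (UNIV :: real set) A (\<lambda>s. p)"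
    using assms S_pts by (intro smooth_map_euclid_const[OF atlas]) auto
  have im: "(\<lambda>s. p) ` (UNIV :: real set) \<subseteq> S" using assms by auto
  have pair: "smooth_map euclid (UNIV :: real set) euclid (\<lambda>t. (0::real, t))"
    by (intro smooth_map_euclid_smooth_on open_UNIV smooth_on_linear bounded_linear_Pair
        bounded_linear_zero bounded_linear_ident)
  have "smooth_map euclid (UNIV :: real set) TA (\<lambda>r. (\<lambda>(s, t). (p, t *\<^sub>R \<xi> p)) (0::real, r))"
    by (rule smooth_map_compose[OF is_atlas_euclid is_atlas_euclid tatlas pair smooth_scaled_xi[OF p open_UNIV im]]) auto
  then show ?thesis by simp
qed

text \<open>In charts, \<open>U = dexp(0, \<xi>)\<close> along the lift \<open>(p, t\<xi>\<^sub>p)\<close>.\<close>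

lemma geo_ext_chart:
  assumes d0: "(p0, t0) \<in> \<D>" and c: "c \<in> A" "\<Phi> p0 t0 \<in> fst c" and b: "b \<in> A" "p0 \<in> fst b"
  obtains E H W where "open E" "smooth_on E H" "openin (mtop TA) W" "(p0, t0 *\<^sub>R \<xi> p0) \<in> W"
    "\<And>p t. (p, t) \<in> \<D> \<Longrightarrow> (p, t *\<^sub>R \<xi> p) \<in> W \<Longrightarrow>
       p \<in> fst b \<and> snd (tchart A b) (p, t *\<^sub>R \<xi> p) \<in> E \<and>
       comps A c (\<Phi> p t) (U (\<Phi> p t)) =
         frechet_derivative H (at (snd (tchart A b) (p, t *\<^sub>R \<xi> p))) (0, comps A b p (\<xi> p))"
proof -
  let ?b = "tchart A b"
  have "(p0, t0 *\<^sub>R \<xi> p0) \<in> \<V>" using d0 by (simp add: dom_iff)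
  then obtain W1 h where W1: "(p0, t0 *\<^sub>R \<xi> p0) \<in> W1" "smooth_on_open TA W1 A h"
      "\<And>x. x \<in> \<V> \<Longrightarrow> x \<in> W1 \<Longrightarrow> h x = exp_map A g x"
    using smooth_mapE[OF smooth_exp] by blast
  note hD = smooth_on_openD[OF W1(2) tchart_mem[OF b(1)] c(1)]
  define W where "W = {x \<in> W1 \<inter> fst ?b. h x \<in> fst c}"
  \<comment> \<open>The exponential map in charts of \<open>TM\<close> and \<open>M\<close>, or
    rather its local extension \<open>h\<close>, since the map itself is known to be smooth only on
    \<open>\<V>\<close>, a subset of the normal bundle.\<close>
  define H where "H = (\<lambda>x. snd c (h (cinv ?b x)))"
  have W_eq: "W = {x \<in> W1. h x \<in> fst c} \<inter> fst ?b" by (auto simp: W_def)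
  have oW: "openin (mtop TA) W"
    unfolding W_eq
    by (intro openin_Int smooth_on_open_preimage[OF tatlas atlas W1(2)] openin_chart[OF atlas c(1)]
        openin_chart[OF tatlas tchart_mem[OF b(1)]])
  have hPhi: "h (p, t *\<^sub>R \<xi> p) = \<Phi> p t" if "(p, t) \<in> \<D>" "(p, t *\<^sub>R \<xi> p) \<in> W" for p t
    using that W1(3) unfolding Phi_eq dom_iff W_def by blast
  show ?thesis
  proof (rule that)
    show "open (snd ?b ` W)" "smooth_on (snd ?b ` W) H"
      using hD unfolding W_def H_def by auto
    show "openin (mtop TA) W" by (rule oW)
    have "h (p0, t0 *\<^sub>R \<xi> p0) = \<Phi> p0 t0"
      using W1(1,3) d0 by (simp add: dom_iff Phi_eq)
    then show "(p0, t0 *\<^sub>R \<xi> p0) \<in> W"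
      using W1(1) c b by (simp add: W_def)
    fix p t assume d: "(p, t) \<in> \<D>" and w: "(p, t *\<^sub>R \<xi> p) \<in> W"
    have p: "p \<in> S" using d by (rule domD)
    have pb: "p \<in> fst b" using w by (auto simp: W_def)
    have m: "snd ?b (p, t *\<^sub>R \<xi> p) \<in> snd ?b ` W" using w by (rule imageI)
    let ?x = "comps A b p (\<xi> p)"
    have sb: "snd ?b (p, r *\<^sub>R \<xi> p) = (snd b p, r *\<^sub>R ?x)" for r
      by (simp add: linear_cmul[OF linear_comps[OF atlas b(1) pb]])
    \<comment> \<open>On this open set of parameters \<open>H\<close> along the lifted ray is the
      chart expression of \<open>\<Phi>\<close>. The lifted ray has fixed base point and moves
      linearly in the fibre, whence the direction \<open>(0, ?x)\<close>.\<close>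
    let ?I = "{r \<in> {r. (p, r) \<in> \<D>}. (p, r *\<^sub>R \<xi> p) \<in> W}"
    have oI: "open ?I"
      by (rule smooth_map_preimage_open[OF tatlas smooth_map_subset[OF smooth_scaled_xi_ray[OF p] subset_UNIV]
            smooth_Phi_ray(1)[OF p] oW])
    have "(H has_derivative frechet_derivative H (at (snd b p, t *\<^sub>R ?x))) (at (snd b p, t *\<^sub>R ?x))"
      using smooth_on_has_derivative[OF \<open>smooth_on (snd ?b ` W) H\<close> m] unfolding sb .
    moreover have "((\<lambda>r. (snd b p, r *\<^sub>R ?x)) has_vector_derivative (0, ?x)) (at t)"
      by (intro has_vector_derivative_Pair) (auto intro!: derivative_eq_intros)
    ultimately have dH: "((\<lambda>r. H (snd b p, r *\<^sub>R ?x)) has_vector_derivative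
        frechet_derivative H (at (snd b p, t *\<^sub>R ?x)) (0, ?x)) (at t)"
      by (rule has_vector_derivative_chain)
    have H_eq: "H (snd b p, r *\<^sub>R ?x) = snd c (\<Phi> p r)" if "r \<in> ?I" for r
    proof -
      have r: "(p, r) \<in> \<D>" "(p, r *\<^sub>R \<xi> p) \<in> W" using that by auto
      have "cinv ?b (snd ?b (p, r *\<^sub>R \<xi> p)) = (p, r *\<^sub>R \<xi> p)"
        by (rule cinv_chart[OF tatlas tchart_mem[OF b(1)]]) (use pb in simp)
      then show ?thesis
        unfolding H_def sb[symmetric] using hPhi[OF r] by simp
    qed
    have tI: "t \<in> ?I" using d w by simp
    have "((\<lambda>r. snd c (\<Phi> p r)) has_vector_derivative
        frechet_derivative H (at (snd b p, t *\<^sub>R ?x)) (0, ?x)) (at t)"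
      by (rule has_vector_derivative_transform_within_open[OF dH oI tI H_eq])
    moreover have "\<Phi> p t \<in> fst c" using hPhi[OF d w] w by (auto simp: W_def)
    ultimately have "comps A c (\<Phi> p t) (U (\<Phi> p t)) = frechet_derivative H (at (snd b p, t *\<^sub>R ?x)) (0, ?x)"
      using comps_velocity[OF atlas smooth_Phi_ray(2,1)[OF p] _ c(1), of t] d
      by (simp add: geo_ext_Phi vector_derivative_at)
    then show "p \<in> fst b \<and> snd ?b (p, t *\<^sub>R \<xi> p) \<in> snd ?b ` W \<and>
       comps A c (\<Phi> p t) (U (\<Phi> p t)) =
         frechet_derivative H (at (snd ?b (p, t *\<^sub>R \<xi> p))) (0, ?x)"
      using pb m unfolding sb by blast
  qed
qed

text \<open>By \<open>geo_ext_chart\<close> the components of \<open>U\<close> are a smooth function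
  of two lifts of the point: the inverse exponential \<open>?k q\<close>, which gives the place of
  differentiation, and \<open>?x q\<close>, which gives the direction. Both lifts are smooth on
  \<open>\<Sigma>\<close>, so by \<open>velocity_compose_cong\<close> their velocities along a curve
  are determined by the velocity of that curve.\<close>

lemma cov_deriv_geo_ext_cong:
  assumes \<alpha>: "curve_through A \<Sigma> q \<alpha>" and \<beta>: "curve_through A \<Sigma> q \<beta>"
    and v: "velocity A \<alpha> 0 = velocity A \<beta> 0"
  shows "cov_deriv A g \<alpha> (U \<circ> \<alpha>) 0 = cov_deriv A g \<beta> (U \<circ> \<beta>) 0"
proof -
  let ?c = "pref A q" and ?k = "inv_into \<V> (exp_map A g)"
  let ?x = "\<lambda>q. (F q, \<xi> (F q))"
  have "q \<in> \<Sigma>" using \<alpha> by (metis curve_throughE image_subset_iff)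
  then obtain p0 t0 where d0: "(p0, t0) \<in> \<D>" "q = \<Phi> p0 t0" by (rule hypersurfE)
  have k: "smooth_map A \<Sigma> TA ?k" by (rule smooth_exp_inv)
  have x: "smooth_map A \<Sigma> TA ?x"
    by (rule smooth_map_compose[OF atlas atlas tatlas smooth_proj smooth_xi proj_image])
  have kq: "?k q = (p0, t0 *\<^sub>R \<xi> p0)" and Fq: "F q = p0"
    using d0 exp_inv_Phi proj_Phi by auto
  have "p0 \<in> pts A" using domD[OF d0(1)] S_pts by auto
  then obtain b where b: "b \<in> A" "p0 \<in> fst b" by (auto simp: pts_def)
  have q: "q \<in> pts A"
    using \<alpha> smooth_map_image_pts by (metis curve_throughE image_subset_iff)
  then have c: "?c \<in> A" "q \<in> fst ?c" using pref_chart[OF q] by auto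
  let ?b = "tchart A b"
  obtain E H W where E: "open E" "smooth_on E H" and W: "openin (mtop TA) W" "?k q \<in> W"
    and EW: "\<And>p t. (p, t) \<in> \<D> \<Longrightarrow> (p, t *\<^sub>R \<xi> p) \<in> W \<Longrightarrow>
       p \<in> fst b \<and> snd ?b (p, t *\<^sub>R \<xi> p) \<in> E \<and>
       comps A ?c (\<Phi> p t) (U (\<Phi> p t)) =
         frechet_derivative H (at (snd ?b (p, t *\<^sub>R \<xi> p))) (0, comps A b p (\<xi> p))"
    using geo_ext_chart[OF d0(1) c(1) _ b] c(2) unfolding d0(2)[symmetric] kq by metis
  \<comment> \<open>The first argument is the place, in the chart of the bundle, and the second the
    fibre direction; treating them as independent variables makes \<open>R\<close> smooth on a full
    product set.\<close>
  define R where "R = (\<lambda>xw. frechet_derivative H (at (fst xw)) (0, snd xw))"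
  have sR: "smooth_on (E \<times> UNIV) R"
  proof -
    have o: "open (E \<times> (UNIV :: 'e set))" using E(1) by (simp add: open_Times)
    have "smooth_on (E \<times> (UNIV :: 'e set)) (\<lambda>xw. (0 :: 'e, snd xw))"
      by (intro smooth_on_Pair o smooth_on_const smooth_on_linear bounded_linear_snd)
    from smooth_on_deriv_apply[OF E(1) o E(2) smooth_on_linear[OF bounded_linear_fst] this]
    show ?thesis unfolding R_def by fastforce
  qed
  have val: "vector_derivative (\<lambda>s. comps A ?c (\<eta> s) (U (\<eta> s))) (at 0) =
      frechet_derivative R (at (snd ?b (?k q), comps A b p0 (\<xi> p0)))
        (comps TA ?b (?k q) (velocity TA (\<lambda>s. ?k (\<eta> s)) 0),
         snd (comps TA ?b (?x q) (velocity TA (\<lambda>s. ?x (\<eta> s)) 0)))"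
    if \<eta>: "curve_through A \<Sigma> q \<eta>" for \<eta>
  proof -
    obtain J where J: "smooth_map euclid J A \<eta>" "open J" "0 \<in> J" "\<eta> ` J \<subseteq> \<Sigma>" "\<eta> 0 = q"
      using \<eta> by (rule curve_throughE)
    have k\<eta>: "smooth_map euclid J TA (\<lambda>s. ?k (\<eta> s))"
      by (rule smooth_map_compose[OF is_atlas_euclid atlas tatlas J(1) k J(4)])
    have x\<eta>: "smooth_map euclid J TA (\<lambda>s. ?x (\<eta> s))"
      by (rule smooth_map_compose[OF is_atlas_euclid atlas tatlas J(1) x J(4)])
    let ?J = "{s \<in> J. ?k (\<eta> s) \<in> W}"
    have oJ: "open ?J" by (rule smooth_map_preimage_open[OF tatlas k\<eta> J(2) W(1)])
    have on_J: "snd ?b (?k (\<eta> s)) \<in> E \<and> comps A ?c (\<eta> s) (U (\<eta> s)) =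
        R (snd ?b (?k (\<eta> s)), snd (snd ?b (?x (\<eta> s))))" if s: "s \<in> ?J" for s
    proof -
      have "\<eta> s \<in> \<Sigma>" using s J(4) by blast
      then obtain p t where d: "(p, t) \<in> \<D>" "\<eta> s = \<Phi> p t" by (rule hypersurfE)
      have "(p, t *\<^sub>R \<xi> p) \<in> W" using s exp_inv_Phi[OF d(1)] d(2) by simp
      from EW[OF d(1) this] show ?thesis
        unfolding d(2) exp_inv_Phi[OF d(1)] proj_Phi[OF d(1)] R_def by simp
    qed
    have "((\<lambda>s. snd ?b (?k (\<eta> s))) has_vector_derivative comps TA ?b (?k q) (velocity TA (\<lambda>s. ?k (\<eta> s)) 0)) (at 0)"
      using curve_chart_has_derivative[OF tatlas k\<eta> J(2,3) tchart_mem[OF b(1)]] J(5) kq b by simp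
    moreover have "((\<lambda>s. snd ?b (?x (\<eta> s))) has_vector_derivative comps TA ?b (?x q) (velocity TA (\<lambda>s. ?x (\<eta> s)) 0)) (at 0)"
      using curve_chart_has_derivative[OF tatlas x\<eta> J(2,3) tchart_mem[OF b(1)]] J(5) Fq b by simp
    then have "((\<lambda>s. snd (snd ?b (?x (\<eta> s)))) has_vector_derivative
        snd (comps TA ?b (?x q) (velocity TA (\<lambda>s. ?x (\<eta> s)) 0))) (at 0)"
      by (rule has_vector_derivative_chain[OF bounded_linear_imp_has_derivative[OF bounded_linear_snd]])
    ultimately have d1: "((\<lambda>s. (snd ?b (?k (\<eta> s)), snd (snd ?b (?x (\<eta> s))))) has_vector_derivative
        (comps TA ?b (?k q) (velocity TA (\<lambda>s. ?k (\<eta> s)) 0),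
         snd (comps TA ?b (?x q) (velocity TA (\<lambda>s. ?x (\<eta> s)) 0)))) (at 0)"
      by (rule has_vector_derivative_Pair)
    have z: "0 \<in> ?J" using J W by simp
    have pt: "(snd ?b (?k (\<eta> 0)), snd (snd ?b (?x (\<eta> 0)))) = (snd ?b (?k q), comps A b p0 (\<xi> p0))"
      using J(5) Fq by simp
    have "snd ?b (?k q) \<in> E" using on_J[OF z] J(5) by simp
    then have "(R has_derivative frechet_derivative R (at (snd ?b (?k q), comps A b p0 (\<xi> p0))))
        (at (snd ?b (?k (\<eta> 0)), snd (snd ?b (?x (\<eta> 0)))))"
      unfolding pt by (intro smooth_on_has_derivative[OF sR]) auto
    from has_vector_derivative_chain[OF this d1]
    have "((\<lambda>s. comps A ?c (\<eta> s) (U (\<eta> s))) has_vector_derivative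
       frechet_derivative R (at (snd ?b (?k q), comps A b p0 (\<xi> p0)))
        (comps TA ?b (?k q) (velocity TA (\<lambda>s. ?k (\<eta> s)) 0),
         snd (comps TA ?b (?x q) (velocity TA (\<lambda>s. ?x (\<eta> s)) 0)))) (at 0)"
      by (rule has_vector_derivative_transform_within_open[OF _ oJ z]) (use on_J in auto)
    then show ?thesis by (rule vector_derivative_at)
  qed
  have "velocity TA (\<lambda>s. ?k (\<alpha> s)) 0 = velocity TA (\<lambda>s. ?k (\<beta> s)) 0"
    "velocity TA (\<lambda>s. ?x (\<alpha> s)) 0 = velocity TA (\<lambda>s. ?x (\<beta> s)) 0"
    by (rule velocity_compose_cong[OF atlas tatlas k \<alpha> \<beta> v],
        rule velocity_compose_cong[OF atlas tatlas x \<alpha> \<beta> v])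
  then have "vector_derivative (\<lambda>s. comps A ?c (\<alpha> s) (U (\<alpha> s))) (at 0) =
      vector_derivative (\<lambda>s. comps A ?c (\<beta> s) (U (\<beta> s))) (at 0)"
    by (simp only: val[OF \<alpha>] val[OF \<beta>])
  moreover have "\<alpha> 0 = q" "\<beta> 0 = q" using \<alpha> \<beta> by (auto elim: curve_throughE)
  ultimately show ?thesis by (simp add: cov_deriv_def cov_deriv_in_def v)
qed

text \<open>Independence of the curve gives the definite description in \<open>nabla_on\<close> a
  unique candidate, so any convenient curve may be used to compute it.\<close>

lemma nabla_on_geo_ext:
  assumes "curve_through A \<Sigma> q \<alpha>"
  shows "nabla_on A g \<Sigma> U q (velocity A \<alpha> 0) = cov_deriv A g \<alpha> (U \<circ> \<alpha>) 0"
  unfolding nabla_on_def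
  by (rule the_equality) (use assms cov_deriv_geo_ext_cong in blast)+

section \<open>Jacobi fields of the variation by neighboring null generators\<close>

definition jacobi :: "(real \<Rightarrow> 'a) \<Rightarrow> real \<Rightarrow> 'e" where
  "jacobi \<gamma> t = velocity A (\<lambda>s. \<Phi> (\<gamma> s) t) 0"

text \<open>In a chart, \<open>\<nabla>\<^sub>t \<partial>\<^sub>s\<Phi> = \<nabla>\<^sub>s \<partial>\<^sub>t\<Phi> = \<nabla>\<^sub>J U\<close>, since mixed derivatives commute and the connection is torsion-free.\<close>

lemma jacobi_chart:
  assumes \<gamma>: "curve_through A S p \<gamma>" and d: "(p, r) \<in> \<D>"
  defines "c \<equiv> pref A (\<Phi> p r)"
  obtains N a' where "open N" "r \<in> N" "\<And>t. t \<in> N \<Longrightarrow> (p, t) \<in> \<D> \<and> \<Phi> p t \<in> fst c"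
    "((\<lambda>t. snd c (\<Phi> p t)) has_vector_derivative U (\<Phi> p r)) (at r)"
    "((\<lambda>t. comps A c (\<Phi> p t) (jacobi \<gamma> t)) has_vector_derivative a') (at r)"
    "a' + levi_civita A g c (snd c (\<Phi> p r)) (U (\<Phi> p r)) (jacobi \<gamma> r) = nabla_on A g \<Sigma> U (\<Phi> p r) (jacobi \<gamma> r)"
proof -
  obtain J where J: "smooth_map euclid J A \<gamma>" "open J" "0 \<in> J" "\<gamma> ` J \<subseteq> S" "\<gamma> 0 = p"
    using \<gamma> by (rule curve_throughE)
  note surf = smooth_Phi_surface[OF J(1,2,4)]
  let ?O = "{(s, t). s \<in> J \<and> (\<gamma> s, t) \<in> \<D>}"
  let ?q = "\<Phi> p r"
  have q: "?q \<in> pts A"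
    using smooth_map_image_pts[OF smooth_Phi_ray(2)[OF domD[OF d]]] d by blast
  then have c: "c \<in> A" "?q \<in> fst c" using pref_chart[OF q] unfolding c_def by auto
  \<comment> \<open>\<open>c\<close> is the preferred chart of \<open>?q\<close>, so a tangent
    vector there is its own component vector; \<open>comps\<close> has to be kept at nearby
    points.\<close>
  have cid: "comps A c ?q v = v" for v
    unfolding c_def by (rule comps_pref[OF atlas q])
  from smooth_map_euclidD[OF atlas surf(2,1) _ c(1), of "(0, r)"] obtain M
    where M: "open M" "(0, r) \<in> M" "M \<subseteq> ?O" "(\<lambda>(s, t). \<Phi> (\<gamma> s) t) ` M \<subseteq> fst c"
      and sm: "smooth_on M (\<lambda>y. snd c ((\<lambda>(s, t). \<Phi> (\<gamma> s) t) y))"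
    using J d c(2) by auto
  define X where "X = (\<lambda>y. snd c ((\<lambda>(s, t). \<Phi> (\<gamma> s) t) y))"
  have X: "smooth_on M X" using sm by (simp add: X_def)
  have Xst: "X (s, t) = snd c (\<Phi> (\<gamma> s) t)" for s t by (simp add: X_def)
  have MO: "s \<in> J" "(\<gamma> s, t) \<in> \<D>" "\<Phi> (\<gamma> s) t \<in> fst c" if "(s, t) \<in> M" for s t
    using M(3,4) that by auto
  have ds: "((\<lambda>s. snd c (\<Phi> (\<gamma> s) t)) has_vector_derivative frechet_derivative X (at (s, t)) (1, 0)) (at s)"
    if m: "(s, t) \<in> M" for s t
  proof -
    have "((\<lambda>s. (s, t)) has_vector_derivative (1, 0)) (at s)"
      by (intro has_vector_derivative_Pair) (auto intro!: derivative_eq_intros)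
    from has_vector_derivative_chain[OF smooth_on_has_derivative[OF X m] this]
    show ?thesis by (simp add: Xst)
  qed
  have dt: "((\<lambda>t. snd c (\<Phi> (\<gamma> s) t)) has_vector_derivative frechet_derivative X (at (s, t)) (0, 1)) (at t)"
    if m: "(s, t) \<in> M" for s t
  proof -
    have "((\<lambda>t. (s, t)) has_vector_derivative (0, 1)) (at t)"
      by (intro has_vector_derivative_Pair) (auto intro!: derivative_eq_intros)
    from has_vector_derivative_chain[OF smooth_on_has_derivative[OF X m] this]
    show ?thesis by (simp add: Xst)
  qed
  have Js: "comps A c (\<Phi> p t) (jacobi \<gamma> t) = frechet_derivative X (at (0, t)) (1, 0)" if m: "(0, t) \<in> M" for t
    using comps_velocity[OF atlas smooth_Phi_slice(2,1)[OF J(1,2,4)] _ c(1), of 0 t]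
      MO[OF m] J(5) vector_derivative_at[OF ds[OF m]] by (simp add: jacobi_def)
  have Us: "comps A c (\<Phi> (\<gamma> s) t) (U (\<Phi> (\<gamma> s) t)) = frechet_derivative X (at (s, t)) (0, 1)" if m: "(s, t) \<in> M" for s t
    using comps_velocity[OF atlas smooth_Phi_ray(2,1)[OF domD[OF MO(2)[OF m]]] _ c(1), of t]
      MO[OF m] vector_derivative_at[OF dt[OF m]] by (simp add: geo_ext_Phi)
  define N where "N = {t. (0, t) \<in> M}"
  define P where "P = {s. (s, r) \<in> M}"
  have oN: "open N"
    using open_preimage[OF open_UNIV, of "\<lambda>t. (0::real, t)" M] M(1) by (simp add: N_def continuous_intros)
  have oP: "open P"
    using open_preimage[OF open_UNIV, of "\<lambda>s::real. (s, r)" M] M(1) by (simp add: P_def continuous_intros)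
  \<comment> \<open>The mixed second derivative of the surface in coordinates. It is reached as the
    \<open>t\<close> derivative of the Jacobi field and again as the \<open>s\<close> derivative of
    \<open>U\<close>.\<close>
  define a' where "a' = frechet_derivative (\<lambda>y. frechet_derivative X (at y) (1, 0)) (at (0, r)) (0, 1)"
  show ?thesis
  proof (rule that)
    show "open N" by (rule oN)
    show "r \<in> N" using M by (simp add: N_def)
    show "(p, t) \<in> \<D> \<and> \<Phi> p t \<in> fst c" if "t \<in> N" for t
      using MO[of 0 t] that J(5) by (simp add: N_def)
    have U0: "frechet_derivative X (at (0, r)) (0, 1) = U ?q"
      using Us[OF M(2)] J(5) cid by simp
    have J0: "frechet_derivative X (at (0, r)) (1, 0) = jacobi \<gamma> r"
      using Js[OF M(2)] cid by simp
    show "((\<lambda>t. snd c (\<Phi> p t)) has_vector_derivative U ?q) (at r)"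
      using dt[OF M(2)] J(5) U0 by simp
    have "((\<lambda>t. (0::real, t)) has_vector_derivative (0, 1)) (at r)"
      by (intro has_vector_derivative_Pair) (auto intro!: derivative_eq_intros)
    from has_vector_derivative_chain[OF smooth_on_has_derivative[OF smooth_on_deriv[OF X] M(2)] this]
    have "((\<lambda>t. frechet_derivative X (at (0, t)) (1, 0)) has_vector_derivative a') (at r)"
      unfolding a'_def .
    then show "((\<lambda>t. comps A c (\<Phi> p t) (jacobi \<gamma> t)) has_vector_derivative a') (at r)"
      by (rule has_vector_derivative_transform_within_open[OF _ oN]) (use M(2) Js in \<open>auto simp: N_def\<close>)
    let ?\<alpha> = "\<lambda>s. \<Phi> (\<gamma> s) r"
    have \<alpha>: "curve_through A \<Sigma> ?q ?\<alpha>" by (rule curve_through_Phi_slice[OF \<gamma> d])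
    have "((\<lambda>s::real. (s, r)) has_vector_derivative (1, 0)) (at 0)"
      by (intro has_vector_derivative_Pair) (auto intro!: derivative_eq_intros)
    from has_vector_derivative_chain[OF smooth_on_has_derivative[OF smooth_on_deriv[OF X] M(2)] this]
    have "((\<lambda>s. frechet_derivative X (at (s, r)) (0, 1)) has_vector_derivative
        frechet_derivative (\<lambda>y. frechet_derivative X (at y) (0, 1)) (at (0, r)) (1, 0)) (at 0)" .
    also have "frechet_derivative (\<lambda>y. frechet_derivative X (at y) (0, 1)) (at (0, r)) (1, 0) = a'"
      unfolding a'_def by (rule schwarz[OF M(1) X M(2)])
    finally have "((\<lambda>s. comps A c (?\<alpha> s) (U (?\<alpha> s))) has_vector_derivative a') (at 0)"
      by (rule has_vector_derivative_transform_within_open[OF _ oP]) (use M(2) Us in \<open>auto simp: P_def\<close>)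
    then have "cov_deriv A g ?\<alpha> (U \<circ> ?\<alpha>) 0 =
        a' + levi_civita A g c (snd c ?q) (jacobi \<gamma> r) (U ?q)"
      unfolding cov_deriv_def cov_deriv_in_def using J(5) cid
      by (simp add: c_def[symmetric] vector_derivative_at jacobi_def)
    also have "levi_civita A g c (snd c ?q) (jacobi \<gamma> r) (U ?q) = levi_civita A g c (snd c ?q) (U ?q) (jacobi \<gamma> r)"
      using levi_civita_in[OF atlas lorentz c(1), of "snd c ?q"] c(2) unfolding is_levi_civita_def by blast
    finally show "a' + levi_civita A g c (snd c ?q) (U ?q) (jacobi \<gamma> r) = nabla_on A g \<Sigma> U ?q (jacobi \<gamma> r)"
      using nabla_on_geo_ext[OF \<alpha>] by (simp add: jacobi_def comp_def)
  qed
qed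

lemma jacobi_tangent:
  "curve_through A S p \<gamma> \<Longrightarrow> (p, r) \<in> \<D> \<Longrightarrow> jacobi \<gamma> r \<in> tangent_space A \<Sigma> (\<Phi> p r)"
  using curve_through_Phi_slice by (auto simp: tangent_space_def jacobi_def)

lemma jacobi_product_deriv:
  assumes umb: "totally_umbilical A g \<Sigma> U \<mu>"
    and \<gamma>: "curve_through A S p \<gamma>" and \<delta>: "curve_through A S p \<delta>" and d: "(p, r) \<in> \<D>"
  shows "((\<lambda>t. g (\<Phi> p t) (jacobi \<gamma> t) (jacobi \<delta> t)) has_real_derivative
    - 2 * \<mu> (\<Phi> p r) * g (\<Phi> p r) (jacobi \<gamma> r) (jacobi \<delta> r)) (at r)"
proof -
  let ?q = "\<Phi> p r"
  let ?c = "pref A ?q"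
  let ?G = "metric_in A g ?c"
  let ?n = "nabla_on A g \<Sigma> U ?q"
  obtain N a' where N: "open N" "r \<in> N" "\<And>t. t \<in> N \<Longrightarrow> (p, t) \<in> \<D> \<and> \<Phi> p t \<in> fst ?c"
    and x: "((\<lambda>t. snd ?c (\<Phi> p t)) has_vector_derivative U ?q) (at r)"
    and a: "((\<lambda>t. comps A ?c (\<Phi> p t) (jacobi \<gamma> t)) has_vector_derivative a') (at r)"
    and na: "a' + levi_civita A g ?c (snd ?c ?q) (U ?q) (jacobi \<gamma> r) = ?n (jacobi \<gamma> r)"
    by (rule jacobi_chart[OF \<gamma> d], rule that)
  obtain b' where b: "((\<lambda>t. comps A ?c (\<Phi> p t) (jacobi \<delta> t)) has_vector_derivative b') (at r)"
    and nb: "b' + levi_civita A g ?c (snd ?c ?q) (U ?q) (jacobi \<delta> r) = ?n (jacobi \<delta> r)"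
    by (rule jacobi_chart[OF \<delta> d], rule that)
  have q: "?q \<in> pts A"
    using smooth_map_image_pts[OF smooth_Phi_ray(2)[OF domD[OF d]]] d by blast
  then have c: "?c \<in> A" "?q \<in> fst ?c" using pref_chart[OF q] by auto
  have cid: "comps A ?c ?q v = v" for v by (rule comps_pref[OF atlas q])
  have g_eq: "g (\<Phi> p t) v w = ?G (snd ?c (\<Phi> p t)) (comps A ?c (\<Phi> p t) v) (comps A ?c (\<Phi> p t) w)" if "t \<in> N" for t v w
    by (rule metric_eq_metric_in[OF atlas c(1)]) (use N(3) that in auto)
  have xq: "snd ?c ?q \<in> snd ?c ` fst ?c" using c by auto
  have "((\<lambda>t. ?G (snd ?c (\<Phi> p t)) (comps A ?c (\<Phi> p t) (jacobi \<gamma> t)) (comps A ?c (\<Phi> p t) (jacobi \<delta> t)))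
      has_real_derivative ?G (snd ?c ?q) (?n (jacobi \<gamma> r)) (jacobi \<delta> r) + ?G (snd ?c ?q) (jacobi \<gamma> r) (?n (jacobi \<delta> r))) (at r)"
    using metric_in_along_curve[OF atlas lorentz c(1) x xq a b] unfolding cid na nb .
  then have "((\<lambda>t. g (\<Phi> p t) (jacobi \<gamma> t) (jacobi \<delta> t))
      has_real_derivative ?G (snd ?c ?q) (?n (jacobi \<gamma> r)) (jacobi \<delta> r) + ?G (snd ?c ?q) (jacobi \<gamma> r) (?n (jacobi \<delta> r))) (at r)"
    by (rule has_field_derivative_transform_within_open[OF _ N(1,2)]) (simp add: g_eq)
  moreover have "g ?q v w = ?G (snd ?c ?q) v w" for v w
    using g_eq[OF N(2)] cid by simp
  \<comment> \<open>Umbilicity is applied once to each factor of the product, with the roles of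
    \<open>\<gamma>\<close> and \<open>\<delta>\<close> exchanged; the two equal contributions
    produce the factor 2.\<close>
  moreover have "- g ?q (?n v) w = \<mu> ?q * g ?q v w"
    if "v \<in> tangent_space A \<Sigma> ?q" "w \<in> tangent_space A \<Sigma> ?q" for v w
    using umb Phi_mem[OF d] that unfolding totally_umbilical_def null_second_form_def by blast
  note this[OF jacobi_tangent[OF \<gamma> d] jacobi_tangent[OF \<delta> d]] this[OF jacobi_tangent[OF \<delta> d] jacobi_tangent[OF \<gamma> d]]
  moreover have "?G (snd ?c ?q) v w = ?G (snd ?c ?q) w v" for v w
    by (rule metric_in_sym[OF atlas lorentz c(1) xq])
  note this[of "jacobi \<gamma> r" "?n (jacobi \<delta> r)"] this[of "jacobi \<delta> r" "jacobi \<gamma> r"]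
  ultimately show ?thesis
    by (simp add: algebra_simps) (smt (verit))
qed

section \<open>Integration along a generator, starting from \<open>S\<close>\<close>

lemma continuous_on_mu:
  assumes umb: "totally_umbilical A g \<Sigma> U \<mu>" and p: "p \<in> S"
  shows "continuous_on {t. (p, t) \<in> \<D>} (\<lambda>t. \<mu> (\<Phi> p t))"
proof -
  have "smooth_map A \<Sigma> euclid \<mu>" using umb by (simp add: totally_umbilical_def)
  then have "smooth_map euclid {t. (p, t) \<in> \<D>} euclid (\<lambda>t. \<mu> (\<Phi> p t))"
    by (rule smooth_map_compose[OF is_atlas_euclid atlas is_atlas_euclid smooth_Phi_ray(2)[OF p]])
       (use Phi_mem in auto)
  then show ?thesis
    by (rule smooth_on_continuous[OF smooth_on_euclid]) (rule smooth_Phi_ray(1)[OF p])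
qed

text \<open>For \<open>t\<close> of either sign, \<open>r\<close> is \<open>r / t\<close> times
  \<open>t\<close> with a factor in the unit interval, so star-shapedness of \<open>\<V>\<close>
  applies. The integrals from 0 therefore stay inside the domain of \<open>\<Phi>\<close>.\<close>

lemma dom_segment:
  assumes d: "(p, t) \<in> \<D>" and r: "min 0 t \<le> r" "r \<le> max 0 t"
  shows "(p, r) \<in> \<D>"
proof (cases "t = 0")
  case True
  then show ?thesis using r d by simp
next
  case False
  have "0 \<le> r / t" "r / t \<le> 1"
    using r False by (auto simp: field_simps min_def max_def split: if_splits)
  from dom_star[OF d this] show ?thesis using False by simp
qed

lemma jacobi_product:
  assumes umb: "totally_umbilical A g \<Sigma> U \<mu>"
    and \<gamma>: "curve_through A S p \<gamma>" and \<delta>: "curve_through A S p \<delta>" and d: "(p, t) \<in> \<D>"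
  shows "g (\<Phi> p t) (jacobi \<gamma> t) (jacobi \<delta> t) =
    exp (- 2 * (LBINT r=(0::real)..t. \<mu> (\<Phi> p r))) * g p (velocity A \<gamma> 0) (velocity A \<delta> 0)"
proof -
  let ?I = "{min 0 t..max 0 t}"
  have p: "p \<in> S" using d by (rule domD)
  define m where "m r = \<mu> (\<Phi> p r)" for r
  define M where "M r = (LBINT y=(0::real)..r. m y)" for r :: real
  define \<phi> where "\<phi> r = g (\<Phi> p r) (jacobi \<gamma> r) (jacobi \<delta> r)" for r
  have cm: "continuous_on ?I m"
    unfolding m_def by (rule continuous_on_subset[OF continuous_on_mu[OF umb p]]) (use dom_segment[OF d] in auto)
  have dM: "(M has_real_derivative m r) (at r within ?I)" if "r \<in> ?I" for r
    unfolding M_def has_real_derivative_iff_has_vector_derivative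
    by (rule interval_integral_FTC2[OF _ _ cm]) (use that in auto)
  have d\<phi>: "(\<phi> has_real_derivative - 2 * m r * \<phi> r) (at r within ?I)" if "r \<in> ?I" for r
    unfolding \<phi>_def m_def
    by (rule has_field_derivative_at_within[OF jacobi_product_deriv[OF umb \<gamma> \<delta> dom_segment[OF d]]]) (use that in auto)
  \<comment> \<open>\<open>exp (2 * M r)\<close> is the integrating factor of the linear equation
    for \<open>\<phi>\<close>, so the product has zero derivative on the segment between 0 and
    \<open>t\<close>.\<close>
  have "\<exists>k. \<forall>r\<in>?I. \<phi> r * exp (2 * M r) = k"
  proof (rule has_field_derivative_zero_constant)
    fix r assume r: "r \<in> ?I"
    show "((\<lambda>r. \<phi> r * exp (2 * M r)) has_real_derivative 0) (at r within ?I)"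
      using d\<phi>[OF r] dM[OF r] by (auto intro!: derivative_eq_intros simp: algebra_simps)
  qed simp
  then have "\<phi> t * exp (2 * M t) = \<phi> 0 * exp (2 * M 0)" by force
  moreover have "M 0 = 0" by (simp add: M_def)
  ultimately have "\<phi> t = exp (- 2 * M t) * \<phi> 0"
    by (simp add: exp_minus field_simps)
  \<comment> \<open>At parameter 0 the curve \<open>\<Phi>(\<eta>(s), 0)\<close> is
    \<open>\<eta>\<close> itself, which turns the initial value into the metric of
    \<open>S\<close>.\<close>
  moreover have "jacobi \<eta> 0 = velocity A \<eta> 0" if \<eta>: "curve_through A S p \<eta>" for \<eta>
  proof -
    obtain J where J: "open J" "0 \<in> J" "\<eta> ` J \<subseteq> S" using \<eta> by (rule curve_throughE)
    then show ?thesis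
      unfolding jacobi_def by (intro velocity_cong[OF J(1,2)]) (use Phi_zero in auto)
  qed
  ultimately show ?thesis
    using \<gamma> \<delta> Phi_zero[OF p] by (simp add: \<phi>_def M_def m_def)
qed

end

section \<open>Leaves\<close>

context null_hypersurface
begin

text \<open>Tangency to the screen gives a curve \<open>\<gamma>\<close> whose slice
  \<open>\<Phi>(\<gamma>(s), t)\<close> has the same velocity as \<open>\<alpha>\<close>. Smooth
  maps preserve equality of velocities, so the images under \<open>F\<close> share theirs too, and
  \<open>F\<close> sends the slice back to \<open>\<gamma>\<close>.\<close>

lemma integral_curve:
  assumes L: "integral_manifold A \<Sigma> (screen A g S \<xi> \<V>) L" and \<alpha>: "curve_through L (pts L) q \<alpha>"
    and d: "(p, t) \<in> \<D>" "q = \<Phi> p t"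
  obtains \<gamma> where "curve_through A S p \<gamma>" "velocity A \<alpha> 0 = jacobi \<gamma> t"
    "velocity A \<gamma> 0 = velocity A (\<lambda>s. F (\<alpha> s)) 0"
proof -
  have aL: "is_atlas L" and incl: "smooth_map L (pts L) A (\<lambda>q. q)" and sub: "pts L \<subseteq> \<Sigma>"
    using L by (auto simp: integral_manifold_def immersed_submanifold_def manifold_def)
  have "q \<in> pts L" using \<alpha> by (metis curve_throughE image_subset_iff)
  then have "immersed_tangent_space A L q = screen A g S \<xi> \<V> q"
    using L by (simp add: integral_manifold_def)
  then have "velocity A \<alpha> 0 \<in> screen A g S \<xi> \<V> q"
    using \<alpha> by (auto simp: immersed_tangent_space_def)
  then obtain \<gamma> where \<gamma>: "curve_through A {x. (x, t) \<in> \<D>} p \<gamma>" "velocity A \<alpha> 0 = jacobi \<gamma> t"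
    unfolding screen_def d(2) Phi_inv_Phi[OF d(1)] jacobi_def by auto
  have \<gamma>S: "curve_through A S p \<gamma>"
    by (rule curve_through_mono[OF \<gamma>(1)]) (use domD in auto)
  have "curve_through A \<Sigma> q \<alpha>"
    by (rule curve_through_compose[OF aL atlas \<alpha> incl]) (use sub in auto)
  moreover have "curve_through A \<Sigma> q (\<lambda>s. \<Phi> (\<gamma> s) t)"
    unfolding d(2) by (rule curve_through_Phi_slice[OF \<gamma>S d(1)])
  ultimately have "velocity A (\<lambda>s. F (\<alpha> s)) 0 = velocity A (\<lambda>s. F (\<Phi> (\<gamma> s) t)) 0"
    using \<gamma>(2) unfolding jacobi_def by (intro velocity_compose_cong[OF atlas atlas smooth_proj])
  also have "\<dots> = velocity A \<gamma> 0"
  proof -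
    obtain J where J: "open J" "0 \<in> J" "\<gamma> ` J \<subseteq> {x. (x, t) \<in> \<D>}"
      using \<gamma>(1) by (rule curve_throughE)
    show ?thesis by (rule velocity_cong[OF J(1,2)]) (use J(3) proj_Phi in auto)
  qed
  finally show ?thesis using that[OF \<gamma>S \<gamma>(2)] by simp
qed

lemma integral_manifold_product:
  assumes umb: "totally_umbilical A g \<Sigma> U \<mu>"
    and L: "integral_manifold A \<Sigma> (screen A g S \<xi> \<V>) L"
    and \<alpha>: "curve_through L (pts L) q \<alpha>" and \<beta>: "curve_through L (pts L) q \<beta>"
    and d: "(p, t) \<in> \<D>" "q = \<Phi> p t"
  shows "g q (velocity A \<alpha> 0) (velocity A \<beta> 0) =
    exp (- 2 * (LBINT r=(0::real)..t. \<mu> (\<Phi> p r))) *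
      g p (velocity A (\<lambda>s. F (\<alpha> s)) 0) (velocity A (\<lambda>s. F (\<beta> s)) 0)"
proof -
  obtain \<gamma> where \<gamma>: "curve_through A S p \<gamma>" "velocity A \<alpha> 0 = jacobi \<gamma> t"
    "velocity A \<gamma> 0 = velocity A (\<lambda>s. F (\<alpha> s)) 0"
    by (rule integral_curve[OF L \<alpha> d])
  obtain \<delta> where \<delta>: "curve_through A S p \<delta>" "velocity A \<beta> 0 = jacobi \<delta> t"
    "velocity A \<delta> 0 = velocity A (\<lambda>s. F (\<beta> s)) 0"
    by (rule integral_curve[OF L \<beta> d])
  show ?thesis
    using jacobi_product[OF umb \<gamma>(1) \<delta>(1) d(1)] \<gamma> \<delta> d(2) by simp
qed

text \<open>A point of \<open>X\<close> over \<open>F q\<close> must be \<open>q\<close>, as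
  \<open>F\<close> is injective on \<open>X\<close>, and injectivity of \<open>\<Phi>\<close> then
  fixes its parameter; this settles the definite description in \<open>leaf_param\<close>.\<close>

lemma leaf_param_unique:
  assumes X: "X \<subseteq> \<Sigma>" "bij_betw F X S" and q: "q \<in> X"
  shows "(F q, leaf_param A g S \<xi> \<V> X (F q)) \<in> \<D> \<and> q = \<Phi> (F q) (leaf_param A g S \<xi> \<V> X (F q))"
proof -
  have "q \<in> \<Sigma>" using X(1) q by blast
  then obtain p t where pt: "(p, t) \<in> \<D>" "q = \<Phi> p t" by (rule hypersurfE)
  have Fq: "F q = p" using pt proj_Phi by simp
  have uniq: "s = t" if s: "(p, s) \<in> \<D>" "\<Phi> p s \<in> X" for s
  proof -
    have "F (\<Phi> p s) = F q" using proj_Phi[OF s(1)] Fq by simp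
    then have "\<Phi> p s = q" using X(2) s(2) q by (auto simp: bij_betw_def inj_on_def)
    then show "s = t" using Phi_inj s(1) pt unfolding inj_on_def by blast
  qed
  have "leaf_param A g S \<xi> \<V> X (F q) = t"
    unfolding leaf_param_def Fq
  proof (rule the_equality)
    show "(p, t) \<in> \<D> \<and> \<Phi> p t \<in> X" using pt(1) q unfolding pt(2) by (rule conjI)
    show "s = t" if "(p, s) \<in> \<D> \<and> \<Phi> p s \<in> X" for s using uniq that by blast
  qed
  then show ?thesis using pt unfolding Fq by simp
qed

text \<open>The segments from 0 to \<open>t\<close> and from 0 to \<open>t'\<close> lie in the
  domain, and together they cover everything between the two parameters. The integral from 0 is thus
  an antiderivative there, and the fundamental theorem of calculus yields the difference.\<close>

lemma integral_mu_split:
  assumes umb: "totally_umbilical A g \<Sigma> U \<mu>" and d: "(p, t) \<in> \<D>" "(p, t') \<in> \<D>"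
  shows "(LBINT r=t'..t. \<mu> (\<Phi> p r)) =
    (LBINT r=(0::real)..t. \<mu> (\<Phi> p r)) - (LBINT r=(0::real)..t'. \<mu> (\<Phi> p r))"
proof -
  define m where "m r = \<mu> (\<Phi> p r)" for r
  let ?a = "min 0 (min t' t)" and ?b = "max 0 (max t' t)"
  have "(p, r) \<in> \<D>" if "r \<in> {?a..?b}" for r
  proof (cases "min 0 t \<le> r \<and> r \<le> max 0 t")
    case True
    then show ?thesis using dom_segment[OF d(1)] by blast
  next
    case False
    then show ?thesis using that by (intro dom_segment[OF d(2)]) auto
  qed
  then have cm: "continuous_on {?a..?b} m"
    unfolding m_def by (intro continuous_on_subset[OF continuous_on_mu[OF umb domD[OF d(1)]]]) auto
  have "((\<lambda>u. LBINT y=(0::real)..u. m y) has_vector_derivative m r) (at r within {min t' t..max t' t})"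
    if "min t' t \<le> r" "r \<le> max t' t" for r
  proof (rule has_vector_derivative_within_subset)
    show "((\<lambda>u. LBINT y=(0::real)..u. m y) has_vector_derivative m r) (at r within {?a..?b})"
      by (rule interval_integral_FTC2[OF _ _ cm]) (use that in auto)
  qed auto
  moreover have "continuous_on {min t' t..max t' t} m"
    by (rule continuous_on_subset[OF cm]) auto
  ultimately have "(LBINT r=t'..t. m r) = (LBINT r=(0::real)..t. m r) - (LBINT r=(0::real)..t'. m r)"
    by (intro interval_integral_FTC_finite)
  then show ?thesis by (simp add: m_def)
qed

section \<open>The canonical map between two leaves\<close>

context
  fixes L L' :: "('a, 'k::euclidean_space) chart set"
  assumes dL: "diffeo L (pts L) A S F" and dL': "diffeo L' (pts L') A S F"
    and aL: "is_atlas L" and aL': "is_atlas L'"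
begin

abbreviation G where "G \<equiv> canonical_map A g S \<xi> \<V> (pts L')"

lemma bij_L: "bij_betw F (pts L) S" and bij_L': "bij_betw F (pts L') S"
  using dL dL' by (simp_all add: diffeo_def)

lemma canonical_map_mem: "q \<in> pts L \<Longrightarrow> G q \<in> pts L'"
  using bij_betwE[OF bij_L] bij_betwE[OF bij_betw_inv_into[OF bij_L']] by (simp add: canonical_map_def)

lemma proj_canonical_map: "q \<in> pts L \<Longrightarrow> F (G q) = F q"
  using bij_betwE[OF bij_L] bij_betw_inv_into_right[OF bij_L'] by (simp add: canonical_map_def)

lemma smooth_canonical_map: "smooth_map L (pts L) L' G"
proof -
  have "smooth_map L (pts L) L' (\<lambda>q. inv_into (pts L') F (F q))"
    by (rule smooth_map_compose[OF aL atlas aL', where Y=S])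
       (use dL dL' bij_betwE[OF bij_L] in \<open>auto simp: diffeo_def\<close>)
  then show ?thesis by (simp add: canonical_map_def comp_def)
qed

text \<open>The inverse is the same construction with the two leaves exchanged, so it is smooth for
  the same reason as \<open>G\<close>.\<close>

lemma diffeo_canonical_map: "diffeo L (pts L) L' (pts L') G"
proof -
  have bij: "bij_betw G (pts L) (pts L')"
    unfolding canonical_map_def by (rule bij_betw_trans[OF bij_L bij_betw_inv_into[OF bij_L']])
  have "smooth_map L' (pts L') L (inv_into (pts L) G)"
  proof (rule smooth_map_cong)
    show "smooth_map L' (pts L') L (\<lambda>y. inv_into (pts L) F (F y))"
      by (rule smooth_map_compose[OF aL' atlas aL, where Y=S])
         (use dL dL' bij_betwE[OF bij_L'] in \<open>auto simp: diffeo_def\<close>)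
    fix y assume y: "y \<in> pts L'"
    then have Fy: "F y \<in> S" using bij_betwE[OF bij_L'] by blast
    let ?x = "inv_into (pts L) F (F y)"
    have "?x \<in> pts L" using Fy bij_betwE[OF bij_betw_inv_into[OF bij_L]] by blast
    moreover have "F ?x = F y" by (rule bij_betw_inv_into_right[OF bij_L Fy])
    then have "G ?x = y"
      using bij_betw_inv_into_left[OF bij_L' y] by (simp add: canonical_map_def)
    ultimately show "?x = inv_into (pts L) G y"
      using bij by (metis bij_betw_inv_into_left)
  qed
  then show ?thesis using bij smooth_canonical_map by (simp add: diffeo_def)
qed

lemma curve_canonical_map:
  assumes \<alpha>: "curve_through L (pts L) q \<alpha>"
  shows "curve_through L' (pts L') (G q) (G \<circ> \<alpha>)"
    and "velocity A (\<lambda>s. F ((G \<circ> \<alpha>) s)) 0 = velocity A (\<lambda>s. F (\<alpha> s)) 0"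
proof -
  show "curve_through L' (pts L') (G q) (G \<circ> \<alpha>)"
    using curve_through_compose[OF aL aL' \<alpha> smooth_canonical_map] canonical_map_mem
    by (auto simp: comp_def)
  obtain J where J: "open J" "0 \<in> J" "\<alpha> ` J \<subseteq> pts L" using \<alpha> by (rule curve_throughE)
  show "velocity A (\<lambda>s. F ((G \<circ> \<alpha>) s)) 0 = velocity A (\<lambda>s. F (\<alpha> s)) 0"
    by (rule velocity_cong[OF J(1,2)]) (use J(3) proj_canonical_map in auto)
qed

text \<open>The inverse of \<open>F\<close> on \<open>L\<close> recovers \<open>\<alpha>\<close>
  from its projection, and a smooth map sends zero velocity to zero velocity; hence a nonzero
  velocity in \<open>L\<close> cannot project to zero.\<close>

lemma ex_curve_proj_nonzero:
  assumes q: "q \<in> pts L"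
  shows "\<exists>\<alpha>. curve_through L (pts L) q \<alpha> \<and> curve_through A S (F q) (\<lambda>s. F (\<alpha> s)) \<and>
    velocity A (\<lambda>s. F (\<alpha> s)) 0 \<noteq> 0"
proof -
  obtain \<alpha> where \<alpha>: "curve_through L (pts L) q \<alpha>" "velocity L \<alpha> 0 \<noteq> 0"
    using ex_curve_nonzero_velocity[OF aL q] by blast
  let ?I = "inv_into (pts L) F"
  have sF: "smooth_map L (pts L) A F" and sI: "smooth_map A S L ?I"
    using dL by (simp_all add: diffeo_def)
  have F\<alpha>: "curve_through A S (F q) (\<lambda>s. F (\<alpha> s))"
    by (rule curve_through_compose[OF aL atlas \<alpha>(1) sF]) (use bij_betwE[OF bij_L] in auto)
  have Fq: "F q \<in> S" using bij_betwE[OF bij_L] q by blast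
  \<comment> \<open>\<open>velocity_compose_cong\<close> compares two curves; the constant one
    represents the zero vector.\<close>
  have const: "curve_through A S (F q) (\<lambda>s. F q)"
    using Fq S_pts smooth_map_euclid_const[OF atlas, of "F q" UNIV]
    by (intro curve_throughI[of UNIV]) auto
  have "velocity A (\<lambda>s. F (\<alpha> s)) 0 \<noteq> 0"
  proof
    assume "velocity A (\<lambda>s. F (\<alpha> s)) 0 = 0"
    then have "velocity A (\<lambda>s. F (\<alpha> s)) 0 = velocity A (\<lambda>s. F q) 0"
      by (simp add: velocity_const)
    from velocity_compose_cong[OF atlas aL sI F\<alpha> const this]
    have "velocity L (\<lambda>s. ?I (F (\<alpha> s))) 0 = 0" by (simp add: velocity_const)
    moreover obtain J where J: "open J" "0 \<in> J" "\<alpha> ` J \<subseteq> pts L" using \<alpha>(1) by (rule curve_throughE)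
    have "velocity L (\<lambda>s. ?I (F (\<alpha> s))) 0 = velocity L \<alpha> 0"
      by (rule velocity_cong[OF J(1,2)]) (use J(3) bij_betw_inv_into_left[OF bij_L] in auto)
    ultimately show False using \<alpha>(2) by simp
  qed
  then show ?thesis using \<alpha>(1) F\<alpha> by blast
qed

text \<open>Equal factors match the products of all pairs of curves at once. Conversely a single
  nonzero projected vector over each \<open>p\<close> suffices, and every \<open>p\<close> is
  reached because \<open>F\<close> maps \<open>L\<close> onto \<open>S\<close>; injectivity of
  \<open>exp\<close> then gives back the integrals.\<close>

lemma induced_isometry_canonical_map_iff:
  assumes umb: "totally_umbilical A g \<Sigma> U \<mu>" and space: "spacelike A g S"
    and iL: "integral_manifold A \<Sigma> (screen A g S \<xi> \<V>) L"
    and iL': "integral_manifold A \<Sigma> (screen A g S \<xi> \<V>) L'"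
  shows "induced_isometry A g L L' G \<longleftrightarrow>
    (\<forall>p\<in>S. (LBINT r = leaf_param A g S \<xi> \<V> (pts L') p .. leaf_param A g S \<xi> \<V> (pts L) p. \<mu> (\<Phi> p r)) = 0)"
proof -
  let ?t = "leaf_param A g S \<xi> \<V> (pts L)" and ?t' = "leaf_param A g S \<xi> \<V> (pts L')"
  define M where "M p t = (LBINT r=(0::real)..t. \<mu> (\<Phi> p r))" for p t
  have sub: "pts L \<subseteq> \<Sigma>" "pts L' \<subseteq> \<Sigma>" using iL iL' by (simp_all add: integral_manifold_def)
  have par: "(F q, ?t (F q)) \<in> \<D>" "q = \<Phi> (F q) (?t (F q))" if "q \<in> pts L" for q
    using leaf_param_unique[OF sub(1) bij_L that] by blast+
  have par': "(F q, ?t' (F q)) \<in> \<D>" "G q = \<Phi> (F q) (?t' (F q))" if "q \<in> pts L" for q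
    using leaf_param_unique[OF sub(2) bij_L' canonical_map_mem[OF that]] proj_canonical_map[OF that] by metis+
  have int: "(LBINT r = ?t' (F q) .. ?t (F q). \<mu> (\<Phi> (F q) r)) = M (F q) (?t (F q)) - M (F q) (?t' (F q))"
    if "q \<in> pts L" for q
    unfolding M_def by (rule integral_mu_split[OF umb par(1)[OF that] par'(1)[OF that]])
  have prod: "g q (velocity A \<alpha> 0) (velocity A \<beta> 0) = exp (- 2 * M (F q) (?t (F q))) *
        g (F q) (velocity A (\<lambda>s. F (\<alpha> s)) 0) (velocity A (\<lambda>s. F (\<beta> s)) 0)"
    "g (G q) (velocity A (G \<circ> \<alpha>) 0) (velocity A (G \<circ> \<beta>) 0) = exp (- 2 * M (F q) (?t' (F q))) *
        g (F q) (velocity A (\<lambda>s. F (\<alpha> s)) 0) (velocity A (\<lambda>s. F (\<beta> s)) 0)"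
    if q: "q \<in> pts L" and \<alpha>: "curve_through L (pts L) q \<alpha>" and \<beta>: "curve_through L (pts L) q \<beta>" for q \<alpha> \<beta>
    using integral_manifold_product[OF umb iL \<alpha> \<beta> par[OF q]]
      integral_manifold_product[OF umb iL' curve_canonical_map(1)[OF \<alpha>] curve_canonical_map(1)[OF \<beta>] par'[OF q]]
      curve_canonical_map(2)[OF \<alpha>] curve_canonical_map(2)[OF \<beta>]
    by (simp_all add: M_def)
  show ?thesis
  proof
    assume iso: "induced_isometry A g L L' G"
    show "\<forall>p\<in>S. (LBINT r = ?t' p .. ?t p. \<mu> (\<Phi> p r)) = 0"
    proof
      fix p assume "p \<in> S"
      then obtain q where q: "q \<in> pts L" "p = F q"
        using bij_betw_imp_surj_on[OF bij_L] by blast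
      obtain \<alpha> where \<alpha>: "curve_through L (pts L) q \<alpha>" and F\<alpha>: "curve_through A S (F q) (\<lambda>s. F (\<alpha> s))"
        and v: "velocity A (\<lambda>s. F (\<alpha> s)) 0 \<noteq> 0"
        using ex_curve_proj_nonzero[OF q(1)] by blast
      let ?v = "velocity A (\<lambda>s. F (\<alpha> s)) 0"
      have "?v \<in> tangent_space A S (F q)" using F\<alpha> by (auto simp: tangent_space_def)
      \<comment> \<open>Positivity on \<open>S\<close> allows the common factor to be cancelled from
        the two products, so that the exponentials themselves are equal.\<close>
      then have pos: "g (F q) ?v ?v > 0"
        using space v \<open>p \<in> S\<close> q(2) by (simp add: spacelike_def)
      have "g (G q) (velocity A (G \<circ> \<alpha>) 0) (velocity A (G \<circ> \<alpha>) 0) = g q (velocity A \<alpha> 0) (velocity A \<alpha> 0)"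
        using iso q(1) \<alpha> unfolding induced_isometry_def by blast
      then have "exp (- 2 * M (F q) (?t' (F q))) = exp (- 2 * M (F q) (?t (F q)))"
        using prod[OF q(1) \<alpha> \<alpha>] pos by simp
      then show "(LBINT r = ?t' p .. ?t p. \<mu> (\<Phi> p r)) = 0"
        using int[OF q(1)] q(2) by simp
    qed
  next
    assume zero: "\<forall>p\<in>S. (LBINT r = ?t' p .. ?t p. \<mu> (\<Phi> p r)) = 0"
    show "induced_isometry A g L L' G"
      unfolding induced_isometry_def
    proof (intro conjI ballI allI impI diffeo_canonical_map)
      fix q \<alpha> \<beta> assume q: "q \<in> pts L" and ab: "curve_through L (pts L) q \<alpha> \<and> curve_through L (pts L) q \<beta>"
      have "F q \<in> S" using bij_betwE[OF bij_L] q by blast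
      then have "M (F q) (?t (F q)) = M (F q) (?t' (F q))" using zero int[OF q] by simp
      then show "g (G q) (velocity A (G \<circ> \<alpha>) 0) (velocity A (G \<circ> \<beta>) 0) = g q (velocity A \<alpha> 0) (velocity A \<beta> 0)"
        using prod[OF q] ab by simp
    qed
  qed
qed

end

end

theorem corollary7p4:
  fixes A :: "('a, 'e::euclidean_space) chart set"
    and g :: "('a, 'e) metric"
    and T \<xi> :: "'a \<Rightarrow> 'e"
    and S :: "'a set"
    and \<V> :: "('a \<times> 'e) set"
    and \<mu> :: "'a \<Rightarrow> real"
    and L L' :: "('a, 'k::euclidean_space) chart set"
    and n :: nat
  assumes "n \<ge> 2" and "DIM('e) = n + 2" and "DIM('k) = n"
    and "spacetime A g T"
    and "embedded_submanifold A n S" and "connectedin (mtop A) S" and "spacelike A g S"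
    and "lightlike_normal_field A g S \<xi>"
    and "normal_exp_nbhd A g S \<V>"
    and "totally_umbilical A g (hypersurf A g S \<xi> \<V>) (geo_ext A g S \<xi> \<V>) \<mu>"
    and "leaf A (hypersurf A g S \<xi> \<V>) (screen A g S \<xi> \<V>) L"
    and "leaf A (hypersurf A g S \<xi> \<V>) (screen A g S \<xi> \<V>) L'"
    and "diffeo L (pts L) A S (proj A g S \<xi> \<V>)"
    and "diffeo L' (pts L') A S (proj A g S \<xi> \<V>)"
  shows "induced_isometry A g L L' (canonical_map A g S \<xi> \<V> (pts L')) \<longleftrightarrow>
    (\<forall>p\<in>S. (LBINT r = leaf_param A g S \<xi> \<V> (pts L') p .. leaf_param A g S \<xi> \<V> (pts L) p.
              \<mu> (Phi A g \<xi> (p, r))) = 0)"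
proof -
  have atlas: "is_atlas A" and lor: "lorentz_metric A g"
    using assms(4) by (simp_all add: spacetime_def manifold_def)
  have "S \<subseteq> pts A" using assms(5) by (simp add: embedded_submanifold_def)
  then interpret null_hypersurface A g S \<xi> \<V>
    using atlas lor assms(8,9) by unfold_locales
  have iL: "integral_manifold A (hypersurf A g S \<xi> \<V>) (screen A g S \<xi> \<V>) L"
    and iL': "integral_manifold A (hypersurf A g S \<xi> \<V>) (screen A g S \<xi> \<V>) L'"
    using assms(11,12) by (simp_all add: leaf_def)
  then have "is_atlas L" "is_atlas L'"
    by (simp_all add: integral_manifold_def immersed_submanifold_def manifold_def)
  then show ?thesis
    using induced_isometry_canonical_map_iff[OF assms(13,14) _ _ assms(10,7) iL iL'] by blast
qed

end
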